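(* Let $\mathbf{C}$ be a regular category. Special dagger Frobenius structures in $\mathbf{Rel}(\mathbf{C})$ are the same as internal groupoids in $\mathbf{C}$. More precisely: (1) Every special dagger Frobenius structure $(A,\mu,\eta)$ in $\mathbf{Rel}(\mathbf{C})$ defines an internal groupoid in $\mathbf{C}$ with object of morphisms $A$, composition given by $\mu$ and identities given by $\eta$; that is, the object of objects is the subobject $U\rightarrowtail A$ given by $\eta$, the identity morphism $u$ is the inclusion $U\rightarrowtail A$, and $\mu(a,b,c)$ holds if and only if $a,b$ are composable and $m(a,b)=c$. (2) Conversely, every internal groupoid $(C_0,C_1,m,s,t,u,i)$ in $\mathbf{C}$ defines a special dagger Frobenius structure $(A,\mu,\eta)$ in $\mathbf{Rel}(\mathbf{C})$ with $A=C_1$, $\eta=(u\colon C_0\rightarrowtail A)$, and $\mu\colon A\times A\to A$ the relation given by the (partial) composition $m$, i.e. $\mu(a,b,c)$ if and only if $s(a)=t(b)$ and $m(a,b)=c$. These two assignments are mutually inverse (up to the choice of monomorphisms representing subobjects).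
   Context: A category is regular when it has finite limits, coequalizers of kernel pairs, and regular epimorphisms are stable under pullback. For $\mathbf{C}$ regular, $\mathbf{Rel}(\mathbf{C})$ has the same objects as $\mathbf{C}$; a morphism (relation) $R\colon A\to B$ is a subobject $R\rightarrowtail A\times B$ in $\mathbf{C}$; identities are diagonals; $S\circ R$ is the image of $R\times_B S\to A\times C$, i.e. $\{(a,c)\mid (\exists b)\,R(a,b)\wedge S(b,c)\}$. Formulas with elements are interpreted in the internal regular logic of $\mathbf{C}$ (equality by equalizers, conjunction by pullback of subobjects, $\exists$ by images, implication by inclusion of subobjects). $\mathbf{Rel}(\mathbf{C})$ is a compact dagger (symmetric monoidal) category with $\otimes=\times$ on objects, unit $I=1$, and $R^\dagger(b,a)\Leftrightarrow R(a,b)$. A morphism $I\to A$ in $\mathbf{Rel}(\mathbf{C})$ is identified with a subobject of $A$. A special dagger Frobenius structure in a dagger monoidal category is an object $A$ with morphisms $\mu\colon A\otimes A\to A$, $\eta\colon I\to A$ satisfying unitality $\mu(\mathrm{id}\otimes\eta)=\mathrm{id}_A=\mu(\eta\otimes\mathrm{id})$, associativity $\mu(\mu\otimes\mathrm{id})=\mu(\mathrm{id}\otimes\mu)$, speciality $\mu\circ\mu^\dagger=\mathrm{id}_A$, and the Frobenius law $(\mu\otimes\mathrm{id})(\mathrm{id}\otimes\mu^\dagger)=(\mathrm{id}\otimes\mu)(\mu^\dagger\otimes\mathrm{id})$. An internal category in a finitely complete category consists of objects $C_0$ (objects), $C_1$ (morphisms) and morphisms $s,t\colon C_1\to C_0$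 (source, target), $u\colon C_0\to C_1$ (identity), $m\colon C_1\times_{C_0}C_1\to C_1$ (composition, defined on the pullback of $s$ and $t$, so that $m(a,b)=a\circ b$ is defined when $s(a)=t(b)$) satisfying the usual equations. An internal groupoid additionally has an inversion morphism $i\colon C_1\to C_1$ satisfying the usual axioms. *)

theory Defs
  imports Main
begin

section \<open>Categories\<close>

text \<open>
  A category has a set of objects and a set of arrows inside the types 'o and 'm; outside these
  sets the operations are irrelevant.  Composition is in applicative order.
\<close>

record ('o, 'm) category =
  Obj :: "'o set"
  Arr :: "'m set"
  Dom :: "'m \<Rightarrow> 'o"
  Cod :: "'m \<Rightarrow> 'o"
  Ident :: "'o \<Rightarrow> 'm"
  Comp :: "'m \<Rightarrow> 'm \<Rightarrow> 'm"  (infixl "\<cdot>\<index>" 70)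

definition hom :: "('o, 'm, 'z) category_scheme \<Rightarrow> 'o \<Rightarrow> 'o \<Rightarrow> 'm set" where
  "hom C A B = {f \<in> Arr C. Dom C f = A \<and> Cod C f = B}"

locale category =
  fixes C :: "('o, 'm, 'z) category_scheme" (structure)
  assumes Dom_in_Obj: "f \<in> Arr C \<Longrightarrow> Dom C f \<in> Obj C"
    and Cod_in_Obj: "f \<in> Arr C \<Longrightarrow> Cod C f \<in> Obj C"
    and Ident_in_hom: "A \<in> Obj C \<Longrightarrow> Ident C A \<in> hom C A A"
    and Comp_in_hom: "f \<in> hom C X Y \<Longrightarrow> g \<in> hom C Y Z \<Longrightarrow> g \<cdot> f \<in> hom C X Z"
    and Comp_assoc: "f \<in> hom C W X \<Longrightarrow> g \<in> hom C X Y \<Longrightarrow> h \<in> hom C Y Z \<Longrightarrow>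
          (h \<cdot> g) \<cdot> f = h \<cdot> (g \<cdot> f)"
    and Comp_Ident_left: "f \<in> hom C X Y \<Longrightarrow> Ident C Y \<cdot> f = f"
    and Comp_Ident_right: "f \<in> hom C X Y \<Longrightarrow> f \<cdot> Ident C X = f"

definition monic :: "('o, 'm, 'z) category_scheme \<Rightarrow> 'm \<Rightarrow> bool" where
  "monic C m \<longleftrightarrow> m \<in> Arr C \<and>
     (\<forall>X. \<forall>f \<in> hom C X (Dom C m). \<forall>g \<in> hom C X (Dom C m).
        m \<cdot>\<^bsub>C\<^esub> f = m \<cdot>\<^bsub>C\<^esub> g \<longrightarrow> f = g)"

definition iso :: "('o, 'm, 'z) category_scheme \<Rightarrow> 'm \<Rightarrow> bool" where
  "iso C f \<longleftrightarrow> f \<in> Arr C \<and>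
     (\<exists>g \<in> hom C (Cod C f) (Dom C f).
        g \<cdot>\<^bsub>C\<^esub> f = Ident C (Dom C f) \<and> f \<cdot>\<^bsub>C\<^esub> g = Ident C (Cod C f))"


section \<open>Finite limits\<close>

definition diagram :: "('i, 'j, 'y) category_scheme \<Rightarrow> ('o, 'm, 'z) category_scheme \<Rightarrow>
    ('i \<Rightarrow> 'o) \<Rightarrow> ('j \<Rightarrow> 'm) \<Rightarrow> bool" where
  "diagram J C Fo Fa \<longleftrightarrow>
     (\<forall>j \<in> Obj J. Fo j \<in> Obj C) \<and>
     (\<forall>f \<in> Arr J. Fa f \<in> hom C (Fo (Dom J f)) (Fo (Cod J f))) \<and>
     (\<forall>j \<in> Obj J. Fa (Ident J j) = Ident C (Fo j)) \<and>
     (\<forall>f \<in> Arr J. \<forall>g \<in> Arr J. Dom J g = Cod J f \<longrightarrow>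
        Fa (g \<cdot>\<^bsub>J\<^esub> f) = Fa g \<cdot>\<^bsub>C\<^esub> Fa f)"

definition cone :: "('i, 'j, 'y) category_scheme \<Rightarrow> ('o, 'm, 'z) category_scheme \<Rightarrow>
    ('i \<Rightarrow> 'o) \<Rightarrow> ('j \<Rightarrow> 'm) \<Rightarrow> 'o \<Rightarrow> ('i \<Rightarrow> 'm) \<Rightarrow> bool" where
  "cone J C Fo Fa X l \<longleftrightarrow> X \<in> Obj C \<and>
     (\<forall>j \<in> Obj J. l j \<in> hom C X (Fo j)) \<and>
     (\<forall>f \<in> Arr J. Fa f \<cdot>\<^bsub>C\<^esub> l (Dom J f) = l (Cod J f))"

definition limit_cone :: "('i, 'j, 'y) category_scheme \<Rightarrow> ('o, 'm, 'z) category_scheme \<Rightarrow>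
    ('i \<Rightarrow> 'o) \<Rightarrow> ('j \<Rightarrow> 'm) \<Rightarrow> 'o \<Rightarrow> ('i \<Rightarrow> 'm) \<Rightarrow> bool" where
  "limit_cone J C Fo Fa L l \<longleftrightarrow> cone J C Fo Fa L l \<and>
     (\<forall>X k. cone J C Fo Fa X k \<longrightarrow>
        (\<exists>!h. h \<in> hom C X L \<and> (\<forall>j \<in> Obj J. l j \<cdot>\<^bsub>C\<^esub> h = k j)))"

text \<open>
  Every finite category is isomorphic to one whose objects and arrows are natural numbers, so it
  suffices to quantify over those shapes.
\<close>

definition has_finite_limits :: "('o, 'm, 'z) category_scheme \<Rightarrow> bool" where
  "has_finite_limits C \<longleftrightarrow>
     (\<forall>(J :: (nat, nat) category) Fo Fa.
        category J \<and> finite (Obj J) \<and> finite (Arr J) \<and> diagram J C Fo Fa \<longrightarrow>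
        (\<exists>L l. limit_cone J C Fo Fa L l))"

definition is_terminal :: "('o, 'm, 'z) category_scheme \<Rightarrow> 'o \<Rightarrow> bool" where
  "is_terminal C T \<longleftrightarrow> T \<in> Obj C \<and> (\<forall>X \<in> Obj C. \<exists>!h. h \<in> hom C X T)"

definition is_product :: "('o, 'm, 'z) category_scheme \<Rightarrow> 'o \<Rightarrow> 'o \<Rightarrow> 'm \<Rightarrow> 'm \<Rightarrow> bool" where
  "is_product C A B p q \<longleftrightarrow> p \<in> hom C (Dom C p) A \<and> q \<in> hom C (Dom C p) B \<and>
     (\<forall>X. \<forall>f \<in> hom C X A. \<forall>g \<in> hom C X B.
        \<exists>!h. h \<in> hom C X (Dom C p) \<and> p \<cdot>\<^bsub>C\<^esub> h = f \<and> q \<cdot>\<^bsub>C\<^esub> h = g)"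

definition is_pullback :: "('o, 'm, 'z) category_scheme \<Rightarrow> 'm \<Rightarrow> 'm \<Rightarrow> 'm \<Rightarrow> 'm \<Rightarrow> bool" where
  "is_pullback C f g p q \<longleftrightarrow> f \<in> Arr C \<and> g \<in> Arr C \<and> Cod C f = Cod C g \<and>
     p \<in> hom C (Dom C p) (Dom C f) \<and> q \<in> hom C (Dom C p) (Dom C g) \<and>
     f \<cdot>\<^bsub>C\<^esub> p = g \<cdot>\<^bsub>C\<^esub> q \<and>
     (\<forall>X. \<forall>a \<in> hom C X (Dom C f). \<forall>b \<in> hom C X (Dom C g).
        f \<cdot>\<^bsub>C\<^esub> a = g \<cdot>\<^bsub>C\<^esub> b \<longrightarrow>
        (\<exists>!h. h \<in> hom C X (Dom C p) \<and> p \<cdot>\<^bsub>C\<^esub> h = a \<and> q \<cdot>\<^bsub>C\<^esub> h = b))"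

text \<open>
  Choices of a terminal object, binary products and pullbacks.  They are meaningful in any category
  with finite limits; a product or pullback is recorded by its two projections.
\<close>

definition terminal_obj :: "('o, 'm, 'z) category_scheme \<Rightarrow> 'o" where
  "terminal_obj C = (SOME T. is_terminal C T)"

definition bang :: "('o, 'm, 'z) category_scheme \<Rightarrow> 'o \<Rightarrow> 'm" where
  "bang C X = (THE h. h \<in> hom C X (terminal_obj C))"

definition projections :: "('o, 'm, 'z) category_scheme \<Rightarrow> 'o \<Rightarrow> 'o \<Rightarrow> 'm \<times> 'm" where
  "projections C A B = (SOME pq. is_product C A B (fst pq) (snd pq))"

definition pr1 :: "('o, 'm, 'z) category_scheme \<Rightarrow> 'o \<Rightarrow> 'o \<Rightarrow> 'm" where
  "pr1 C A B = fst (projections C A B)"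

definition pr2 :: "('o, 'm, 'z) category_scheme \<Rightarrow> 'o \<Rightarrow> 'o \<Rightarrow> 'm" where
  "pr2 C A B = snd (projections C A B)"

definition prd :: "('o, 'm, 'z) category_scheme \<Rightarrow> 'o \<Rightarrow> 'o \<Rightarrow> 'o" where
  "prd C A B = Dom C (pr1 C A B)"

definition pair :: "('o, 'm, 'z) category_scheme \<Rightarrow> 'm \<Rightarrow> 'm \<Rightarrow> 'm" where
  "pair C f g = (THE h. h \<in> hom C (Dom C f) (prd C (Cod C f) (Cod C g)) \<and>
     pr1 C (Cod C f) (Cod C g) \<cdot>\<^bsub>C\<^esub> h = f \<and> pr2 C (Cod C f) (Cod C g) \<cdot>\<^bsub>C\<^esub> h = g)"

definition pb_projections :: "('o, 'm, 'z) category_scheme \<Rightarrow> 'm \<Rightarrow> 'm \<Rightarrow> 'm \<times> 'm" where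
  "pb_projections C f g = (SOME pq. is_pullback C f g (fst pq) (snd pq))"

definition pb1 :: "('o, 'm, 'z) category_scheme \<Rightarrow> 'm \<Rightarrow> 'm \<Rightarrow> 'm" where
  "pb1 C f g = fst (pb_projections C f g)"

definition pb2 :: "('o, 'm, 'z) category_scheme \<Rightarrow> 'm \<Rightarrow> 'm \<Rightarrow> 'm" where
  "pb2 C f g = snd (pb_projections C f g)"

definition pb :: "('o, 'm, 'z) category_scheme \<Rightarrow> 'm \<Rightarrow> 'm \<Rightarrow> 'o" where
  "pb C f g = Dom C (pb1 C f g)"

definition pb_pair :: "('o, 'm, 'z) category_scheme \<Rightarrow> 'm \<Rightarrow> 'm \<Rightarrow> 'm \<Rightarrow> 'm \<Rightarrow> 'm" where
  "pb_pair C f g a b = (THE h. h \<in> hom C (Dom C a) (pb C f g) \<and>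
     pb1 C f g \<cdot>\<^bsub>C\<^esub> h = a \<and> pb2 C f g \<cdot>\<^bsub>C\<^esub> h = b)"


section \<open>Regular categories\<close>

definition is_coequalizer :: "('o, 'm, 'z) category_scheme \<Rightarrow> 'm \<Rightarrow> 'm \<Rightarrow> 'm \<Rightarrow> bool" where
  "is_coequalizer C f g e \<longleftrightarrow> f \<in> Arr C \<and> g \<in> hom C (Dom C f) (Cod C f) \<and>
     e \<in> hom C (Cod C f) (Cod C e) \<and> e \<cdot>\<^bsub>C\<^esub> f = e \<cdot>\<^bsub>C\<^esub> g \<and>
     (\<forall>Z. \<forall>k \<in> hom C (Cod C f) Z. k \<cdot>\<^bsub>C\<^esub> f = k \<cdot>\<^bsub>C\<^esub> g \<longrightarrow>
        (\<exists>!h. h \<in> hom C (Cod C e) Z \<and> h \<cdot>\<^bsub>C\<^esub> e = k))"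

definition regular_epi :: "('o, 'm, 'z) category_scheme \<Rightarrow> 'm \<Rightarrow> bool" where
  "regular_epi C e \<longleftrightarrow> (\<exists>f g. is_coequalizer C f g e)"

locale regular_category = category +
  assumes finite_limits: "has_finite_limits C"
    and kernel_pair_coequalizer: "is_pullback C f f p q \<Longrightarrow> \<exists>e. is_coequalizer C p q e"
    and regular_epi_stable: "is_pullback C f e p q \<Longrightarrow> regular_epi C e \<Longrightarrow> regular_epi C p"

text \<open>A subobject is the set of all monomorphisms representing it.\<close>

definition subobject :: "('o, 'm, 'z) category_scheme \<Rightarrow> 'm \<Rightarrow> 'm set" where
  "subobject C m = {n. monic C n \<and>
     (\<exists>f \<in> hom C (Dom C n) (Dom C m). iso C f \<and> m \<cdot>\<^bsub>C\<^esub> f = n)}"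

definition subobjects :: "('o, 'm, 'z) category_scheme \<Rightarrow> 'o \<Rightarrow> 'm set set" where
  "subobjects C X = {subobject C m | m. monic C m \<and> Cod C m = X}"

text \<open>
  The image of an arrow, as a subobject of its codomain: the monic parts of all its factorizations
  as a regular epimorphism followed by a monomorphism.
\<close>

definition image_subobject :: "('o, 'm, 'z) category_scheme \<Rightarrow> 'm \<Rightarrow> 'm set" where
  "image_subobject C f = {m. monic C m \<and>
     (\<exists>e \<in> hom C (Dom C f) (Dom C m). regular_epi C e \<and> m \<cdot>\<^bsub>C\<^esub> e = f)}"


section \<open>Special dagger Frobenius structures\<close>

record ('o, 'm) dagger_monoidal = "('o, 'm) category" +
  tensor_obj :: "'o \<Rightarrow> 'o \<Rightarrow> 'o"
  tensor :: "'m \<Rightarrow> 'm \<Rightarrow> 'm"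
  unit_obj :: "'o"
  assoc :: "'o \<Rightarrow> 'o \<Rightarrow> 'o \<Rightarrow> 'm"
  lunit :: "'o \<Rightarrow> 'm"
  runit :: "'o \<Rightarrow> 'm"
  dagger :: "'m \<Rightarrow> 'm"

text \<open>
  The record carries the operations of a dagger monoidal category; the definition of a special dagger
  Frobenius structure refers only to these.  The components are \<open>assoc A B D : (A \<otimes> B) \<otimes> D \<rightarrow> A \<otimes> (B \<otimes> D)\<close>,
  \<open>lunit A : I \<otimes> A \<rightarrow> A\<close> and \<open>runit A : A \<otimes> I \<rightarrow> A\<close>.  The coherence
  isomorphisms, usually suppressed, are inserted explicitly below.  As the associator of a dagger
  monoidal category is unitary, its inverse is its dagger.
\<close>

definition special_dagger_frobenius ::
    "('o, 'm, 'z) dagger_monoidal_scheme \<Rightarrow> 'o \<Rightarrow> 'm \<Rightarrow> 'm \<Rightarrow> bool" where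
  "special_dagger_frobenius D A \<mu> \<eta> \<longleftrightarrow>
     A \<in> Obj D \<and> \<mu> \<in> hom D (tensor_obj D A A) A \<and> \<eta> \<in> hom D (unit_obj D) A \<and>
     \<mu> \<cdot>\<^bsub>D\<^esub> tensor D (Ident D A) \<eta> = runit D A \<and>
     \<mu> \<cdot>\<^bsub>D\<^esub> tensor D \<eta> (Ident D A) = lunit D A \<and>
     \<mu> \<cdot>\<^bsub>D\<^esub> tensor D \<mu> (Ident D A) =
       \<mu> \<cdot>\<^bsub>D\<^esub> (tensor D (Ident D A) \<mu> \<cdot>\<^bsub>D\<^esub> assoc D A A A) \<and>
     \<mu> \<cdot>\<^bsub>D\<^esub> dagger D \<mu> = Ident D A \<and>
     tensor D \<mu> (Ident D A) \<cdot>\<^bsub>D\<^esub>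
         (dagger D (assoc D A A A) \<cdot>\<^bsub>D\<^esub> tensor D (Ident D A) (dagger D \<mu>)) =
       tensor D (Ident D A) \<mu> \<cdot>\<^bsub>D\<^esub>
         (assoc D A A A \<cdot>\<^bsub>D\<^esub> tensor D (dagger D \<mu>) (Ident D A))"


section \<open>The category of relations\<close>

text \<open>
  A relation from \<open>A\<close> to \<open>B\<close> consists of its source \<open>A\<close>, its target \<open>B\<close>, and a subobject
  of the chosen product of \<open>A\<close> and \<open>B\<close>.
\<close>

datatype ('o, 'm) relation = Relation (rdom: 'o) (rcod: 'o) (rsub: "'m set")

definition relations :: "('o, 'm, 'z) category_scheme \<Rightarrow> ('o, 'm) relation set" where
  "relations C = {R. rdom R \<in> Obj C \<and> rcod R \<in> Obj C \<and>
     rsub R \<in> subobjects C (prd C (rdom R) (rcod R))}"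

definition leg1 :: "('o, 'm, 'z) category_scheme \<Rightarrow> ('o, 'm) relation \<Rightarrow> 'm \<Rightarrow> 'm" where
  "leg1 C R r = pr1 C (rdom R) (rcod R) \<cdot>\<^bsub>C\<^esub> r"

definition leg2 :: "('o, 'm, 'z) category_scheme \<Rightarrow> ('o, 'm) relation \<Rightarrow> 'm \<Rightarrow> 'm" where
  "leg2 C R r = pr2 C (rdom R) (rcod R) \<cdot>\<^bsub>C\<^esub> r"

text \<open>The relation given by a jointly monic pair of arrows with a common domain.\<close>

definition span_rel :: "('o, 'm, 'z) category_scheme \<Rightarrow> 'm \<Rightarrow> 'm \<Rightarrow> ('o, 'm) relation" where
  "span_rel C f g = Relation (Cod C f) (Cod C g) (subobject C (pair C f g))"

definition graph_rel :: "('o, 'm, 'z) category_scheme \<Rightarrow> 'm \<Rightarrow> ('o, 'm) relation" where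
  "graph_rel C f = span_rel C (Ident C (Dom C f)) f"

text \<open>
  The operations on relations collect the results for all representing monomorphisms (and all
  pullbacks), which is the same as the subobject obtained from any one of them.
\<close>

definition rel_comp ::
    "('o, 'm, 'z) category_scheme \<Rightarrow> ('o, 'm) relation \<Rightarrow> ('o, 'm) relation \<Rightarrow> ('o, 'm) relation"
  where
  "rel_comp C S R = Relation (rdom R) (rcod S)
     (\<Union>{image_subobject C (pair C (leg1 C R r \<cdot>\<^bsub>C\<^esub> p) (leg2 C S s \<cdot>\<^bsub>C\<^esub> q)) | r s p q.
         r \<in> rsub R \<and> s \<in> rsub S \<and> is_pullback C (leg2 C R r) (leg1 C S s) p q})"

definition rel_dagger ::
    "('o, 'm, 'z) category_scheme \<Rightarrow> ('o, 'm) relation \<Rightarrow> ('o, 'm) relation" where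
  "rel_dagger C R = Relation (rcod R) (rdom R)
     (\<Union>r \<in> rsub R. subobject C (pair C (leg2 C R r) (leg1 C R r)))"

text \<open>\<open>(R \<otimes> S)((a, b), (a', b'))\<close> holds iff \<open>R(a, a')\<close> and \<open>S(b, b')\<close>.\<close>

definition rel_tensor ::
    "('o, 'm, 'z) category_scheme \<Rightarrow> ('o, 'm) relation \<Rightarrow> ('o, 'm) relation \<Rightarrow> ('o, 'm) relation"
  where
  "rel_tensor C R S = Relation (prd C (rdom R) (rdom S)) (prd C (rcod R) (rcod S))
     (\<Union>r \<in> rsub R. \<Union>s \<in> rsub S.
        let p = pr1 C (Dom C r) (Dom C s); q = pr2 C (Dom C r) (Dom C s)
        in subobject C
             (pair C (pair C (leg1 C R r \<cdot>\<^bsub>C\<^esub> p) (leg1 C S s \<cdot>\<^bsub>C\<^esub> q))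
                     (pair C (leg2 C R r \<cdot>\<^bsub>C\<^esub> p) (leg2 C S s \<cdot>\<^bsub>C\<^esub> q))))"

definition prd_assoc :: "('o, 'm, 'z) category_scheme \<Rightarrow> 'o \<Rightarrow> 'o \<Rightarrow> 'o \<Rightarrow> 'm" where
  "prd_assoc C A B D =
     (let p = pr1 C (prd C A B) D; q = pr2 C (prd C A B) D
      in pair C (pr1 C A B \<cdot>\<^bsub>C\<^esub> p) (pair C (pr2 C A B \<cdot>\<^bsub>C\<^esub> p) q))"

definition Rel :: "('o, 'm, 'z) category_scheme \<Rightarrow> ('o, ('o, 'm) relation) dagger_monoidal" where
  "Rel C = \<lparr>
     Obj = Obj C,
     Arr = relations C,
     Dom = rdom,
     Cod = rcod,
     Ident = (\<lambda>A. graph_rel C (Ident C A)),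
     Comp = rel_comp C,
     tensor_obj = prd C,
     tensor = rel_tensor C,
     unit_obj = terminal_obj C,
     assoc = (\<lambda>A B D. graph_rel C (prd_assoc C A B D)),
     lunit = (\<lambda>A. graph_rel C (pr2 C (terminal_obj C) A)),
     runit = (\<lambda>A. graph_rel C (pr1 C A (terminal_obj C))),
     dagger = rel_dagger C \<rparr>"

text \<open>
  The morphism \<open>1 \<rightarrow> A\<close> of relations identified with the subobject of \<open>A\<close> represented by a
  monomorphism \<open>u\<close> into \<open>A\<close>.
\<close>

definition state_rel :: "('o, 'm, 'z) category_scheme \<Rightarrow> 'm \<Rightarrow> ('o, 'm) relation" where
  "state_rel C u = span_rel C (bang C (Dom C u)) u"


section \<open>Internal categories and groupoids\<close>

record ('o, 'm) internal_category =
  C0 :: 'o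
  C1 :: 'o
  src :: 'm
  tgt :: 'm
  idn :: 'm
  cmp :: 'm

record ('o, 'm) internal_groupoid = "('o, 'm) internal_category" +
  invn :: 'm

text \<open>
  The object of composable pairs \<open>(a, b)\<close>, i.e. those with \<open>s(a) = t(b)\<close>, is the chosen
  pullback of \<open>src G\<close> and \<open>tgt G\<close>.
\<close>

abbreviation composable :: "('o, 'm, 'z) category_scheme \<Rightarrow> ('o, 'm, 'y) internal_category_scheme \<Rightarrow> 'o"
  where "composable C G \<equiv> pb C (src G) (tgt G)"

abbreviation first :: "('o, 'm, 'z) category_scheme \<Rightarrow> ('o, 'm, 'y) internal_category_scheme \<Rightarrow> 'm"
  where "first C G \<equiv> pb1 C (src G) (tgt G)"

abbreviation second :: "('o, 'm, 'z) category_scheme \<Rightarrow> ('o, 'm, 'y) internal_category_scheme \<Rightarrow> 'm"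
  where "second C G \<equiv> pb2 C (src G) (tgt G)"

text \<open>\<open>mult C G a b\<close> is \<open>m(a, b)\<close> for generalized elements \<open>a, b\<close> with \<open>s(a) = t(b)\<close>.\<close>

definition mult :: "('o, 'm, 'z) category_scheme \<Rightarrow> ('o, 'm, 'y) internal_category_scheme \<Rightarrow>
    'm \<Rightarrow> 'm \<Rightarrow> 'm" where
  "mult C G a b = cmp G \<cdot>\<^bsub>C\<^esub> pb_pair C (src G) (tgt G) a b"

text \<open>
  Associativity is an equation between arrows out of the object of composable triples
  \<open>((a, b), c)\<close>, the pullback of \<open>(a, b) \<mapsto> s(b)\<close> and \<open>t\<close>.
\<close>

definition internal_category ::
    "('o, 'm, 'z) category_scheme \<Rightarrow> ('o, 'm, 'y) internal_category_scheme \<Rightarrow> bool" where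
  "internal_category C G \<longleftrightarrow>
     C0 G \<in> Obj C \<and> C1 G \<in> Obj C \<and>
     src G \<in> hom C (C1 G) (C0 G) \<and> tgt G \<in> hom C (C1 G) (C0 G) \<and>
     idn G \<in> hom C (C0 G) (C1 G) \<and> cmp G \<in> hom C (composable C G) (C1 G) \<and>
     src G \<cdot>\<^bsub>C\<^esub> idn G = Ident C (C0 G) \<and>
     tgt G \<cdot>\<^bsub>C\<^esub> idn G = Ident C (C0 G) \<and>
     src G \<cdot>\<^bsub>C\<^esub> cmp G = src G \<cdot>\<^bsub>C\<^esub> second C G \<and>
     tgt G \<cdot>\<^bsub>C\<^esub> cmp G = tgt G \<cdot>\<^bsub>C\<^esub> first C G \<and>
     mult C G (idn G \<cdot>\<^bsub>C\<^esub> tgt G) (Ident C (C1 G)) = Ident C (C1 G) \<and>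
     mult C G (Ident C (C1 G)) (idn G \<cdot>\<^bsub>C\<^esub> src G) = Ident C (C1 G) \<and>
     (let ab = pb1 C (src G \<cdot>\<^bsub>C\<^esub> second C G) (tgt G);
          a = first C G \<cdot>\<^bsub>C\<^esub> ab;
          b = second C G \<cdot>\<^bsub>C\<^esub> ab;
          c = pb2 C (src G \<cdot>\<^bsub>C\<^esub> second C G) (tgt G)
      in mult C G (mult C G a b) c = mult C G a (mult C G b c))"

definition internal_groupoid ::
    "('o, 'm, 'z) category_scheme \<Rightarrow> ('o, 'm, 'y) internal_groupoid_scheme \<Rightarrow> bool" where
  "internal_groupoid C G \<longleftrightarrow> internal_category C G \<and>
     invn G \<in> hom C (C1 G) (C1 G) \<and>
     src G \<cdot>\<^bsub>C\<^esub> invn G = tgt G \<and>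
     tgt G \<cdot>\<^bsub>C\<^esub> invn G = src G \<and>
     mult C G (invn G) (Ident C (C1 G)) = idn G \<cdot>\<^bsub>C\<^esub> src G \<and>
     mult C G (Ident C (C1 G)) (invn G) = idn G \<cdot>\<^bsub>C\<^esub> tgt G"

text \<open>
  Isomorphisms of internal groupoids that are the identity on arrows: they merely replace the
  monomorphism \<open>idn G\<close> by another one representing the same subobject.
\<close>

definition iso_on_objects :: "('o, 'm, 'z) category_scheme \<Rightarrow>
    ('o, 'm) internal_groupoid \<Rightarrow> ('o, 'm) internal_groupoid \<Rightarrow> bool" where
  "iso_on_objects C G H \<longleftrightarrow> C1 G = C1 H \<and> invn G = invn H \<and>
     (\<exists>f \<in> hom C (C0 G) (C0 H). iso C f \<and>
        src H = f \<cdot>\<^bsub>C\<^esub> src G \<and> tgt H = f \<cdot>\<^bsub>C\<^esub> tgt G \<and>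
        idn H \<cdot>\<^bsub>C\<^esub> f = idn G) \<and>
     mult C H (first C G) (second C G) = cmp G"


section \<open>The correspondence\<close>

text \<open>
  The subobject of all \<open>((a, b), c)\<close> with \<open>s(a) = t(b)\<close> and \<open>m(a, b) = c\<close>: the graph of the
  partial composition.
\<close>

definition composition_rel ::
    "('o, 'm, 'z) category_scheme \<Rightarrow> ('o, 'm) internal_groupoid \<Rightarrow> ('o, 'm) relation" where
  "composition_rel C G = span_rel C (pair C (first C G) (second C G)) (cmp G)"

text \<open>Triples \<open>(A, \<mu>, \<eta>)\<close>.\<close>

type_synonym ('o, 'm) frobenius_data = "'o \<times> ('o, 'm) relation \<times> ('o, 'm) relation"

definition frobenius_of_groupoid ::
    "('o, 'm, 'z) category_scheme \<Rightarrow> ('o, 'm) internal_groupoid \<Rightarrow> ('o, 'm) frobenius_data" where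
  "frobenius_of_groupoid C G = (C1 G, composition_rel C G, state_rel C (idn G))"

text \<open>\<open>u\<close> is a monomorphism representing the subobject \<open>U\<close> of \<open>A\<close> given by \<open>\<eta>\<close>.\<close>

definition represents_unit ::
    "('o, 'm, 'z) category_scheme \<Rightarrow> 'm \<Rightarrow> 'o \<Rightarrow> ('o, 'm) relation \<Rightarrow> bool" where
  "represents_unit C u A \<eta> \<longleftrightarrow> monic C u \<and> Cod C u = A \<and> state_rel C u = \<eta>"

definition groupoid_from_frobenius :: "('o, 'm, 'z) category_scheme \<Rightarrow> ('o, 'm) frobenius_data \<Rightarrow>
    'm \<Rightarrow> ('o, 'm) internal_groupoid \<Rightarrow> bool" where
  "groupoid_from_frobenius C F u G \<longleftrightarrow> (case F of (A, \<mu>, \<eta>) \<Rightarrow>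
     internal_groupoid C G \<and> C1 G = A \<and> C0 G = Dom C u \<and> idn G = u \<and>
     \<mu> = composition_rel C G)"

definition groupoid_of_frobenius :: "('o, 'm, 'z) category_scheme \<Rightarrow> ('o, 'm) frobenius_data \<Rightarrow>
    'm \<Rightarrow> ('o, 'm) internal_groupoid" where
  "groupoid_of_frobenius C F u = (THE G. groupoid_from_frobenius C F u G)"

end

theory Submission
  imports Defs
begin

text \<open>
  Relations in a regular category are handled through their generalized elements: \<open>sat R a b\<close> says that
  \<open>(a, b)\<close> belongs to \<open>R\<close>.  Relations are extensional (\<open>relation_eqI\<close>), and membership in a composite
  means existence of a middle element on a regular epimorphic cover (\<open>rel_comp_sat\<close>).  This is the
  Kripke--Joyal semantics of regular logic.  It turns the axioms of a special dagger Frobenius structure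
  into statements about a ternary predicate \<open>\<mu>(a, b, c)\<close> and a unary predicate \<open>U\<close>
  (\<open>special_dagger_frobenius_iff\<close>).

  From these the groupoid is constructed as in sets.  Speciality makes the multiplication a partial
  function.  The unit laws and associativity give every \<open>a\<close> a unique right unit \<open>s a\<close> and a unique
  left unit \<open>t a\<close>, and a product \<open>a b\<close> can exist only if \<open>s a = t b\<close> (\<open>M_composable\<close>).  The decisive step
  is that the Frobenius law, applied to the trivial products \<open>(t a) a = a\<close> and \<open>a (s a) = a\<close>, produces an
  inverse of \<open>a\<close> (\<open>inverse_local\<close>).  Multiplying with that inverse shows conversely that \<open>a b\<close> exists
  whenever \<open>s a = t b\<close> (\<open>M_total\<close>).  All these witnesses exist only on covers, but they are unique and
  therefore descend to actual arrows (\<open>unique_choice\<close>), which assemble into an internal groupoid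
  (\<open>groupoid_exists\<close>).

  Conversely, in a groupoid all existential statements in the axioms have explicit witnesses; in the
  Frobenius law the witness on one side is the inverse of the witness on the other.  The two
  constructions are mutually inverse because the composition relation and the subobject of identities
  determine source, target, composition and inverses (\<open>groupoids_agree\<close>).
\<close>

section \<open>Subobjects and regular epimorphisms\<close>

context category begin

text \<open>
  Arrows are typed by simplification: once membership in \<open>hom\<close> is unfolded, domains and codomains of
  composites are computed by rewriting, and composites are normalized to the right.
\<close>

lemma Comp_simps [simp]:
  assumes "f \<in> Arr C" "g \<in> Arr C" "Dom C g = Cod C f"
  shows "g \<cdot> f \<in> Arr C" "Dom C (g \<cdot> f) = Dom C f" "Cod C (g \<cdot> f) = Cod C g"
  using Comp_in_hom[of f "Dom C f" "Cod C f" g "Cod C g"] assms by (simp_all add: hom_def)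

lemma Comp_assoc_simp [simp]:
  assumes "f \<in> Arr C" "g \<in> Arr C" "h \<in> Arr C" "Dom C g = Cod C f" "Dom C h = Cod C g"
  shows "(h \<cdot> g) \<cdot> f = h \<cdot> (g \<cdot> f)"
  using Comp_assoc[of f "Dom C f" "Cod C f" g "Cod C g" h "Cod C h"] assms by (simp_all add: hom_def)

lemma Ident_simps [simp]:
  assumes "A \<in> Obj C"
  shows "Ident C A \<in> Arr C" "Dom C (Ident C A) = A" "Cod C (Ident C A) = A"
  using Ident_in_hom[OF assms] by (simp_all add: hom_def)

lemma Comp_Ident_simps [simp]:
  "f \<in> Arr C \<Longrightarrow> Cod C f = A \<Longrightarrow> Ident C A \<cdot> f = f"
  "f \<in> Arr C \<Longrightarrow> Dom C f = A \<Longrightarrow> f \<cdot> Ident C A = f"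
  using Comp_Ident_left[of f "Dom C f" "Cod C f"] Comp_Ident_right[of f "Dom C f" "Cod C f"]
  by (simp_all add: hom_def)

lemma homD:
  assumes "f \<in> hom C X Y"
  shows "f \<in> Arr C" "Dom C f = X" "Cod C f = Y" "X \<in> Obj C" "Y \<in> Obj C"
  using assms Dom_in_Obj[of f] Cod_in_Obj[of f] by (auto simp: hom_def)

text \<open>
  A replacement for rewriting with \<open>m \<cdot> f = n\<close>, whose left-hand side is no longer visible in the
  right-associated normal form \<open>m \<cdot> (f \<cdot> g)\<close>.
\<close>

lemma Comp_reassoc:
  assumes "m \<cdot> f = n" "f \<in> Arr C" "m \<in> Arr C" "Dom C m = Cod C f" "g \<in> Arr C" "Cod C g = Dom C f"
  shows "m \<cdot> (f \<cdot> g) = n \<cdot> g"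
  using assms(2-) unfolding assms(1)[symmetric] by simp

lemma monicD:
  assumes "monic C m" "m \<cdot> f = m \<cdot> g" "f \<in> hom C X (Dom C m)" "g \<in> hom C X (Dom C m)"
  shows "f = g"
  using assms unfolding monic_def by blast

lemma monic_Arr: "monic C m \<Longrightarrow> m \<in> Arr C"
  by (simp add: monic_def)

text \<open>
  For a monomorphism \<open>m\<close>, this says that the generalized element \<open>h\<close> belongs to the subobject
  represented by \<open>m\<close>.
\<close>

definition factors :: "'m \<Rightarrow> 'm \<Rightarrow> bool" where
  "factors m h \<longleftrightarrow> (\<exists>k \<in> hom C (Dom C h) (Dom C m). m \<cdot> k = h)"

lemma factors_refl: "m \<in> Arr C \<Longrightarrow> factors m m"
  unfolding factors_def by (rule bexI[of _ "Ident C (Dom C m)"]) (simp_all add: hom_def Dom_in_Obj)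

lemma factors_trans:
  assumes "factors m h" "factors n m" "n \<in> Arr C"
  shows "factors n h"
proof -
  obtain k l where "k \<in> hom C (Dom C h) (Dom C m)" "m \<cdot> k = h"
    "l \<in> hom C (Dom C m) (Dom C n)" "n \<cdot> l = m"
    using assms unfolding factors_def by blast
  then have "l \<cdot> k \<in> hom C (Dom C h) (Dom C n)" "n \<cdot> (l \<cdot> k) = h"
    using assms(3) Comp_reassoc[of n l m k] by (simp_all add: hom_def)
  then show ?thesis unfolding factors_def by blast
qed

lemma mem_subobject_iff:
  assumes m: "monic C m"
  shows "n \<in> subobject C m \<longleftrightarrow> monic C n \<and> factors m n \<and> factors n m"
proof
  assume "n \<in> subobject C m"
  then obtain f g where n: "monic C n" and f: "f \<in> hom C (Dom C n) (Dom C m)" "m \<cdot> f = n"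
    and g: "g \<in> hom C (Dom C m) (Dom C n)" "f \<cdot> g = Ident C (Dom C m)"
    unfolding subobject_def iso_def by (force simp: hom_def)
  have "n \<cdot> g = m \<cdot> (f \<cdot> g)"
    using f g(1) monic_Arr[OF m] Comp_reassoc[of m f n g] by (simp add: hom_def)
  also have "\<dots> = m" using g(2) monic_Arr[OF m] by simp
  finally show "monic C n \<and> factors m n \<and> factors n m"
    using n f g(1) unfolding factors_def by blast
next
  assume *: "monic C n \<and> factors m n \<and> factors n m"
  then obtain f g where f: "f \<in> hom C (Dom C n) (Dom C m)" "m \<cdot> f = n"
    and g: "g \<in> hom C (Dom C m) (Dom C n)" "n \<cdot> g = m"
    unfolding factors_def by blast
  have arr: "m \<in> Arr C" "n \<in> Arr C" using m * monic_Arr by auto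
  have "m \<cdot> (f \<cdot> g) = m \<cdot> Ident C (Dom C m)"
    using f g arr by (simp_all add: hom_def flip: Comp_assoc_simp)
  then have fg: "f \<cdot> g = Ident C (Dom C m)"
    by (rule monicD[OF m]) (use f g arr in \<open>simp_all add: hom_def Dom_in_Obj\<close>)
  have "n \<cdot> (g \<cdot> f) = n \<cdot> Ident C (Dom C n)"
    using f g arr by (simp_all add: hom_def flip: Comp_assoc_simp)
  then have "g \<cdot> f = Ident C (Dom C n)"
    by (rule monicD[OF conjunct1[OF *]]) (use f g arr in \<open>simp_all add: hom_def Dom_in_Obj\<close>)
  with fg f(1) g(1) have "iso C f" unfolding iso_def by (auto simp: hom_def)
  with * f show "n \<in> subobject C m" unfolding subobject_def by auto
qed

lemma subobject_self: "monic C m \<Longrightarrow> m \<in> subobject C m"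
  by (simp add: mem_subobject_iff factors_refl monic_Arr)

lemma subobject_eqI:
  assumes "monic C m" "monic C n" "factors m n" "factors n m"
  shows "subobject C m = subobject C n"
proof (rule set_eqI)
  fix x
  have "factors m x \<longleftrightarrow> factors n x" "monic C x \<Longrightarrow> factors x m \<longleftrightarrow> factors x n"
    using assms factors_trans monic_Arr by blast+
  then show "x \<in> subobject C m \<longleftrightarrow> x \<in> subobject C n"
    using assms by (auto simp: mem_subobject_iff)
qed

text \<open>
  Subobjects are extensional: they are determined by the generalized elements that belong to them.
  Yoneda reduces this to the two monomorphisms themselves, as elements of the common codomain.
\<close>

lemma subobject_eqI_factors:
  assumes "monic C m" "monic C n" "Cod C m = Cod C n"
    and "\<And>h. h \<in> hom C (Dom C h) (Cod C m) \<Longrightarrow> factors m h \<longleftrightarrow> factors n h"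
  shows "subobject C m = subobject C n"
proof -
  have "m \<in> hom C (Dom C m) (Cod C m)" "n \<in> hom C (Dom C n) (Cod C m)"
    using assms(1-3) by (simp_all add: hom_def monic_Arr)
  then have "factors m n" "factors n m"
    using assms(4)[of m] assms(4)[of n] assms(1,2) factors_refl monic_Arr homD(2) by metis+
  then show ?thesis using assms(1,2) by (intro subobject_eqI)
qed

lemma mem_subobject_factors:
  assumes "monic C m" "n \<in> subobject C m"
  shows "monic C n" "Cod C n = Cod C m" "factors n h \<longleftrightarrow> factors m h"
    "subobject C n = subobject C m"
proof -
  have *: "monic C n" "factors m n" "factors n m" using assms by (auto simp: mem_subobject_iff)
  then show "monic C n" by simp
  obtain k where "k \<in> hom C (Dom C n) (Dom C m)" "m \<cdot> k = n" using *(2) unfolding factors_def by blast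
  then show "Cod C n = Cod C m" using assms(1) Comp_simps(3)[of k m]
    by (simp add: hom_def monic_Arr)
  show "factors n h \<longleftrightarrow> factors m h" using * assms(1) factors_trans monic_Arr by blast
  show "subobject C n = subobject C m" using * assms(1) by (intro subobject_eqI)
qed

lemma regular_epi_Arr: "regular_epi C e \<Longrightarrow> e \<in> Arr C"
  unfolding regular_epi_def is_coequalizer_def by (auto simp: hom_def)

text \<open>
  The pair of which \<open>e\<close> is the coequalizer remains hidden, so that a regular epimorphism can be used
  like the quotient map of an equivalence relation.
\<close>

lemma regular_epi_descend:
  assumes e: "regular_epi C e" and k: "k \<in> hom C (Dom C e) Z"
    and kk: "\<And>W x y. x \<in> hom C W (Dom C e) \<Longrightarrow> y \<in> hom C W (Dom C e) \<Longrightarrow> e \<cdot> x = e \<cdot> y \<Longrightarrow> k \<cdot> x = k \<cdot> y"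
  obtains h where "h \<in> hom C (Cod C e) Z" "h \<cdot> e = k"
proof -
  obtain f g where fg: "is_coequalizer C f g e" using e unfolding regular_epi_def by blast
  then have "f \<in> hom C (Dom C f) (Dom C e)" "g \<in> hom C (Dom C f) (Dom C e)" "e \<cdot> f = e \<cdot> g"
    unfolding is_coequalizer_def by (simp_all add: hom_def)
  then have "k \<cdot> f = k \<cdot> g" by (rule kk)
  moreover have "k \<in> hom C (Cod C f) Z" using k fg unfolding is_coequalizer_def by (simp_all add: hom_def)
  ultimately show ?thesis using fg that unfolding is_coequalizer_def by blast
qed

lemma regular_epi_cancel:
  assumes e: "regular_epi C e" and h: "h \<in> hom C (Cod C e) Z" and k: "k \<in> hom C (Cod C e) Z"
    and eq: "h \<cdot> e = k \<cdot> e"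
  shows "h = k"
proof -
  obtain f g where fg: "is_coequalizer C f g e" using e unfolding regular_epi_def by blast
  then have t: "f \<in> hom C (Dom C f) (Dom C e)" "g \<in> hom C (Dom C f) (Dom C e)" "e \<cdot> f = e \<cdot> g"
    "e \<in> Arr C" "Cod C f = Dom C e"
    unfolding is_coequalizer_def by (simp_all add: hom_def)
  then have "h \<cdot> e \<in> hom C (Cod C f) Z" using h by (simp_all add: hom_def)
  moreover have "(h \<cdot> e) \<cdot> f = (h \<cdot> e) \<cdot> g" using t h by (simp_all add: hom_def)
  ultimately have "\<exists>!l. l \<in> hom C (Cod C e) Z \<and> l \<cdot> e = h \<cdot> e"
    using fg unfolding is_coequalizer_def by blast
  then show ?thesis using h k eq by metis
qed

text \<open>
  Membership in a subobject is local: it may be tested after pulling back along a regular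
  epimorphism.  Indeed the factorization over the cover descends, because \<open>m\<close> is a monomorphism.
\<close>

lemma regular_epi_factors:
  assumes e: "regular_epi C e" and m: "monic C m" and h: "h \<in> hom C (Cod C e) (Cod C m)"
    and he: "factors m (h \<cdot> e)"
  shows "factors m h"
proof -
  note arr = regular_epi_Arr[OF e] monic_Arr[OF m]
  obtain k where k: "k \<in> hom C (Dom C e) (Dom C m)" "m \<cdot> k = h \<cdot> e"
    using he h arr unfolding factors_def by (auto simp: hom_def)
  obtain l where l: "l \<in> hom C (Cod C e) (Dom C m)" "l \<cdot> e = k"
  proof (rule regular_epi_descend[OF e k(1)])
    fix W x y assume x: "x \<in> hom C W (Dom C e)" and y: "y \<in> hom C W (Dom C e)" and xy: "e \<cdot> x = e \<cdot> y"
    have "m \<cdot> (k \<cdot> x) = (h \<cdot> e) \<cdot> x" using k x arr by (simp_all add: hom_def flip: Comp_assoc_simp)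
    also have "\<dots> = (h \<cdot> e) \<cdot> y" using x y xy h arr by (simp_all add: hom_def)
    also have "\<dots> = m \<cdot> (k \<cdot> y)" using k y arr by (simp_all add: hom_def flip: Comp_assoc_simp)
    finally show "k \<cdot> x = k \<cdot> y"
      by (rule monicD[OF m]) (use k x y in \<open>simp_all add: hom_def\<close>)
  qed
  have "(m \<cdot> l) \<cdot> e = h \<cdot> e" using l k arr by (simp_all add: hom_def)
  then have "m \<cdot> l = h"
    by (rule regular_epi_cancel[OF e, rotated 2]) (use l h arr in \<open>simp_all add: hom_def\<close>)
  then show ?thesis using l h unfolding factors_def by (intro bexI[of _ l]) (simp_all add: hom_def)
qed

lemma regular_epi_Ident: "A \<in> Obj C \<Longrightarrow> regular_epi C (Ident C A)"
  unfolding regular_epi_def is_coequalizer_def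
  by (rule exI[of _ "Ident C A"], rule exI[of _ "Ident C A"]) (auto simp: hom_def)

lemma regular_epi_iso_Comp:
  assumes e: "regular_epi C e" and i: "iso C i" "Dom C i = Cod C e"
  shows "regular_epi C (i \<cdot> e)"
proof -
  obtain f g where fg: "is_coequalizer C f g e" using e unfolding regular_epi_def by blast
  obtain j where j: "j \<in> hom C (Cod C i) (Dom C i)" "j \<cdot> i = Ident C (Dom C i)" "i \<cdot> j = Ident C (Cod C i)"
    and ia: "i \<in> Arr C" using i unfolding iso_def by blast
  have t: "f \<in> hom C (Dom C f) (Dom C e)" "g \<in> hom C (Dom C f) (Dom C e)" "e \<cdot> f = e \<cdot> g"
    "e \<in> Arr C" "Cod C f = Dom C e"
    using fg unfolding is_coequalizer_def by (simp_all add: hom_def)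
  have "is_coequalizer C f g (i \<cdot> e)" unfolding is_coequalizer_def
  proof (intro conjI allI ballI impI)
    fix Z k assume k: "k \<in> hom C (Cod C f) Z" "k \<cdot> f = k \<cdot> g"
    then obtain l where l: "l \<in> hom C (Cod C e) Z" "l \<cdot> e = k"
      using fg unfolding is_coequalizer_def by blast
    have ji: "j \<cdot> (i \<cdot> e) = e" using j ia t i by (simp_all add: hom_def flip: Comp_assoc_simp)
    show "\<exists>!h. h \<in> hom C (Cod C (i \<cdot> e)) Z \<and> h \<cdot> (i \<cdot> e) = k"
    proof (rule ex1I[of _ "l \<cdot> j"])
      show "l \<cdot> j \<in> hom C (Cod C (i \<cdot> e)) Z \<and> (l \<cdot> j) \<cdot> (i \<cdot> e) = k"
        using l j ia t i ji by (simp_all add: hom_def)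
      fix h assume h: "h \<in> hom C (Cod C (i \<cdot> e)) Z \<and> h \<cdot> (i \<cdot> e) = k"
      then have hi: "h \<in> hom C (Cod C i) Z" using ia t i by (simp_all add: hom_def)
      have "(h \<cdot> i) \<cdot> e = l \<cdot> e" using h hi l ia t i by (simp_all add: hom_def)
      then have "h \<cdot> i = l"
        by (rule regular_epi_cancel[OF e, rotated 2]) (use hi l ia t i in \<open>simp_all add: hom_def\<close>)
      then have "l \<cdot> j = h \<cdot> (i \<cdot> j)" using hi ia j Comp_reassoc[of h i l j] by (simp add: hom_def)
      then show "h = l \<cdot> j" using j hi by (simp_all add: hom_def)
    qed
  qed (use t ia i in \<open>simp_all add: hom_def\<close>)
  then show ?thesis unfolding regular_epi_def by blast
qed

end

section \<open>Finite limits\<close>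

context regular_category begin

text \<open>
  Terminal objects, products and pullbacks are limits over three explicit finite categories.  In the
  last one, arrows \<open>0\<close>, \<open>1\<close>, \<open>2\<close> are the identities, and \<open>3 : 0 \<rightarrow> 2\<close> and \<open>4 : 1 \<rightarrow> 2\<close> form the
  cospan; of two composable arrows one is always an identity.
\<close>

definition empty_shape :: "(nat, nat) category" where
  "empty_shape = \<lparr>Obj = {}, Arr = {}, Dom = id, Cod = id, Ident = id, Comp = (\<lambda>g f. f)\<rparr>"

definition pair_shape :: "(nat, nat) category" where
  "pair_shape = \<lparr>Obj = {0, 1}, Arr = {0, 1}, Dom = id, Cod = id, Ident = id, Comp = (\<lambda>g f. f)\<rparr>"

definition cospan_shape :: "(nat, nat) category" where
  "cospan_shape = \<lparr>Obj = {0, 1, 2}, Arr = {0, 1, 2, 3, 4},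
     Dom = (\<lambda>f. if f = 3 then 0 else if f = 4 then 1 else f),
     Cod = (\<lambda>f. if f = 3 \<or> f = 4 then 2 else f),
     Ident = id, Comp = (\<lambda>g f. if f = 3 \<or> f = 4 then f else g)\<rparr>"

lemma category_empty_shape: "category empty_shape"
  by unfold_locales (auto simp: empty_shape_def hom_def)

lemma category_pair_shape: "category pair_shape"
  by unfold_locales (auto simp: pair_shape_def hom_def)

lemma category_cospan_shape: "category cospan_shape"
  by unfold_locales (auto simp: cospan_shape_def hom_def split: if_splits)

lemma limit_coneE:
  fixes J :: "(nat, nat) category"
  assumes "category J" "finite (Obj J)" "finite (Arr J)" "diagram J C Fo Fa"
  obtains L l where "limit_cone J C Fo Fa L l"
  using finite_limits assms unfolding has_finite_limits_def by blast

lemma terminal_exists: "\<exists>T. is_terminal C T"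
proof -
  obtain L l where "limit_cone empty_shape C (\<lambda>_. undefined) (\<lambda>_. undefined) L l"
    by (rule limit_coneE[OF category_empty_shape]) (auto simp: empty_shape_def diagram_def)
  then have "is_terminal C L"
    unfolding limit_cone_def cone_def is_terminal_def by (auto simp: empty_shape_def)
  then show ?thesis ..
qed

lemma product_exists:
  assumes A: "A \<in> Obj C" and B: "B \<in> Obj C"
  shows "\<exists>pq. is_product C A B (fst pq) (snd pq)"
proof -
  let ?Fo = "\<lambda>i::nat. if i = 0 then A else B"
  let ?Fa = "\<lambda>i::nat. Ident C (?Fo i)"
  obtain L l where L: "limit_cone pair_shape C ?Fo ?Fa L l"
    by (rule limit_coneE[OF category_pair_shape, where Fo = ?Fo and Fa = ?Fa])
      (use A B in \<open>auto simp: pair_shape_def diagram_def hom_def\<close>)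
  have cone: "cone pair_shape C ?Fo ?Fa X k \<longleftrightarrow> k 0 \<in> hom C X A \<and> k 1 \<in> hom C X B" for X k
    using A B homD(4) by (auto simp: cone_def pair_shape_def hom_def)
  have "is_product C A B (l 0) (l 1)" unfolding is_product_def
  proof (intro conjI allI ballI)
    show "l 0 \<in> hom C (Dom C (l 0)) A" "l 1 \<in> hom C (Dom C (l 0)) B"
      using L cone[of L l] by (auto simp: limit_cone_def hom_def)
    fix X f g assume fg: "f \<in> hom C X A" "g \<in> hom C X B"
    let ?k = "\<lambda>i::nat. if i = 0 then f else g"
    have "cone pair_shape C ?Fo ?Fa X ?k" unfolding cone using fg by auto
    then have "\<exists>!h. h \<in> hom C X L \<and> (\<forall>j \<in> Obj pair_shape. l j \<cdot> h = ?k j)"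
      using L unfolding limit_cone_def by blast
    moreover have "Dom C (l 0) = L" using L cone[of L l] by (auto simp: limit_cone_def hom_def)
    ultimately show "\<exists>!h. h \<in> hom C X (Dom C (l 0)) \<and> l 0 \<cdot> h = f \<and> l 1 \<cdot> h = g"
      by (simp add: pair_shape_def)
  qed
  then show ?thesis by (intro exI[of _ "(l 0, l 1)"]) simp
qed

lemma pullback_exists:
  assumes f: "f \<in> hom C A D" and g: "g \<in> hom C B D"
  shows "\<exists>pq. is_pullback C f g (fst pq) (snd pq)"
proof -
  let ?Fo = "\<lambda>i::nat. if i = 0 then A else if i = 1 then B else D"
  let ?Fa = "\<lambda>i::nat. if i = 3 then f else if i = 4 then g else Ident C (?Fo i)"
  note obj = homD[OF f] homD[OF g]
  obtain L l where L: "limit_cone cospan_shape C ?Fo ?Fa L l"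
    by (rule limit_coneE[OF category_cospan_shape, where Fo = ?Fo and Fa = ?Fa])
      (use obj in \<open>auto simp: cospan_shape_def diagram_def hom_def\<close>)
  have cone: "cone cospan_shape C ?Fo ?Fa X k \<longleftrightarrow>
      k 0 \<in> hom C X A \<and> k 1 \<in> hom C X B \<and> k 2 = f \<cdot> k 0 \<and> f \<cdot> k 0 = g \<cdot> k 1" for X k
    using obj homD(4) by (auto simp: cone_def cospan_shape_def hom_def Dom_in_Obj)
  have l: "l 0 \<in> hom C L A" "l 1 \<in> hom C L B" "l 2 = f \<cdot> l 0" "f \<cdot> l 0 = g \<cdot> l 1"
    using L cone[of L l] by (auto simp: limit_cone_def)
  have "is_pullback C f g (l 0) (l 1)" unfolding is_pullback_def
  proof (intro conjI allI ballI impI)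
    fix X a b assume ab: "a \<in> hom C X (Dom C f)" "b \<in> hom C X (Dom C g)" "f \<cdot> a = g \<cdot> b"
    let ?k = "\<lambda>i::nat. if i = 0 then a else if i = 1 then b else f \<cdot> a"
    have "cone cospan_shape C ?Fo ?Fa X ?k" unfolding cone using ab obj by auto
    then have "\<exists>!h. h \<in> hom C X L \<and> (\<forall>j \<in> Obj cospan_shape. l j \<cdot> h = ?k j)"
      using L unfolding limit_cone_def by blast
    moreover have "h \<in> hom C X L \<Longrightarrow>
        (\<forall>j \<in> Obj cospan_shape. l j \<cdot> h = ?k j) \<longleftrightarrow> l 0 \<cdot> h = a \<and> l 1 \<cdot> h = b" for h
      using l obj Comp_reassoc[of f "l 0" "g \<cdot> l 1" h] by (auto simp: cospan_shape_def hom_def)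
    moreover have "Dom C (l 0) = L" using l by (simp_all add: hom_def)
    ultimately show "\<exists>!h. h \<in> hom C X (Dom C (l 0)) \<and> l 0 \<cdot> h = a \<and> l 1 \<cdot> h = b"
      by (simp cong: conj_cong)
  qed (use l obj in \<open>simp_all add: hom_def\<close>)
  then show ?thesis by (intro exI[of _ "(l 0, l 1)"]) simp
qed

lemma terminal_obj_Obj [simp]: "terminal_obj C \<in> Obj C"
  and ex1_bang: "X \<in> Obj C \<Longrightarrow> \<exists>!h. h \<in> hom C X (terminal_obj C)"
proof -
  have "is_terminal C (terminal_obj C)"
    unfolding terminal_obj_def by (rule someI_ex[OF terminal_exists])
  then show "terminal_obj C \<in> Obj C" "X \<in> Obj C \<Longrightarrow> \<exists>!h. h \<in> hom C X (terminal_obj C)"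
    unfolding is_terminal_def by blast+
qed

lemma bang_simps [simp]:
  assumes "X \<in> Obj C"
  shows "bang C X \<in> Arr C" "Dom C (bang C X) = X" "Cod C (bang C X) = terminal_obj C"
  using theI'[OF ex1_bang[OF assms]] unfolding bang_def[symmetric] by (simp_all add: hom_def)

lemma terminal_unique:
  assumes "f \<in> hom C X (terminal_obj C)" "g \<in> hom C X (terminal_obj C)"
  shows "f = g"
  using ex1_bang[of X] homD(4)[OF assms(1)] assms by auto

lemma is_product_pr:
  "A \<in> Obj C \<Longrightarrow> B \<in> Obj C \<Longrightarrow> is_product C A B (pr1 C A B) (pr2 C A B)"
  unfolding pr1_def pr2_def projections_def by (rule someI_ex[OF product_exists])

lemma pr_simps [simp]:
  assumes "A \<in> Obj C" "B \<in> Obj C"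
  shows "pr1 C A B \<in> Arr C" "Dom C (pr1 C A B) = prd C A B" "Cod C (pr1 C A B) = A"
    "pr2 C A B \<in> Arr C" "Dom C (pr2 C A B) = prd C A B" "Cod C (pr2 C A B) = B"
    "prd C A B \<in> Obj C"
  using is_product_pr[OF assms] Dom_in_Obj[of "pr1 C A B"] unfolding is_product_def prd_def
  by (simp_all add: hom_def)

lemma pair_unique:
  assumes "f \<in> hom C X A" "g \<in> hom C X B"
  shows "\<exists>!h. h \<in> hom C X (prd C A B) \<and> pr1 C A B \<cdot> h = f \<and> pr2 C A B \<cdot> h = g"
  using is_product_pr[of A B] homD(5)[OF assms(1)] homD(5)[OF assms(2)] assms
  unfolding is_product_def prd_def by blast

lemma prd_ext:
  assumes "h \<in> hom C X (prd C A B)" "k \<in> hom C X (prd C A B)" "A \<in> Obj C" "B \<in> Obj C"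
    and "pr1 C A B \<cdot> h = pr1 C A B \<cdot> k" "pr2 C A B \<cdot> h = pr2 C A B \<cdot> k"
  shows "h = k"
proof -
  have "pr1 C A B \<cdot> h \<in> hom C X A" "pr2 C A B \<cdot> h \<in> hom C X B"
    using assms by (simp_all add: hom_def)
  from pair_unique[OF this] show ?thesis using assms by metis
qed

lemma pair_simps [simp]:
  assumes "f \<in> Arr C" "g \<in> Arr C" "Dom C f = Dom C g"
  shows "pair C f g \<in> Arr C" "Dom C (pair C f g) = Dom C g" "Cod C (pair C f g) = prd C (Cod C f) (Cod C g)"
    "A = Cod C f \<Longrightarrow> B = Cod C g \<Longrightarrow> pr1 C A B \<cdot> pair C f g = f"
    "A = Cod C f \<Longrightarrow> B = Cod C g \<Longrightarrow> pr2 C A B \<cdot> pair C f g = g"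
proof -
  have "f \<in> hom C (Dom C f) (Cod C f)" "g \<in> hom C (Dom C f) (Cod C g)"
    using assms by (simp_all add: hom_def)
  note theI'[OF pair_unique[OF this]]
  then show "pair C f g \<in> Arr C" "Dom C (pair C f g) = Dom C g" "Cod C (pair C f g) = prd C (Cod C f) (Cod C g)"
    "A = Cod C f \<Longrightarrow> B = Cod C g \<Longrightarrow> pr1 C A B \<cdot> pair C f g = f"
    "A = Cod C f \<Longrightarrow> B = Cod C g \<Longrightarrow> pr2 C A B \<cdot> pair C f g = g"
    unfolding pair_def[symmetric] using assms by (simp_all add: hom_def)
qed

lemma pair_Comp [simp]:
  assumes "f \<in> Arr C" "g \<in> Arr C" "Dom C f = Dom C g" "h \<in> Arr C" "Cod C h = Dom C g"
  shows "pair C f g \<cdot> h = pair C (f \<cdot> h) (g \<cdot> h)"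
  by (rule prd_ext[of _ "Dom C h" "Cod C f" "Cod C g"])
    (use assms in \<open>simp_all add: hom_def Cod_in_Obj flip: Comp_assoc_simp\<close>)

lemma pair_eta:
  assumes "h \<in> hom C X (prd C A B)" "A \<in> Obj C" "B \<in> Obj C"
  shows "pair C (pr1 C A B \<cdot> h) (pr2 C A B \<cdot> h) = h"
  by (rule prd_ext[of _ X A B]) (use assms in \<open>simp_all add: hom_def\<close>)

lemma pair_eq_iff [simp]:
  assumes "f \<in> Arr C" "g \<in> Arr C" "Dom C f = Dom C g" "f' \<in> Arr C" "g' \<in> Arr C" "Dom C f' = Dom C g'"
    "Cod C f = Cod C f'" "Cod C g = Cod C g'"
  shows "pair C f g = pair C f' g' \<longleftrightarrow> f = f' \<and> g = g'"
  using pair_simps(4,5)[of f g "Cod C f" "Cod C g"] pair_simps(4,5)[of f' g' "Cod C f" "Cod C g"] assms by metis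

lemma is_pullback_pb:
  assumes "f \<in> Arr C" "g \<in> Arr C" "Cod C f = Cod C g"
  shows "is_pullback C f g (pb1 C f g) (pb2 C f g)"
  unfolding pb1_def pb2_def pb_projections_def
  by (rule someI_ex[OF pullback_exists]) (use assms in \<open>simp_all add: hom_def\<close>)

lemma pb_simps [simp]:
  assumes "f \<in> Arr C" "g \<in> Arr C" "Cod C f = Cod C g"
  shows "pb1 C f g \<in> Arr C" "Dom C (pb1 C f g) = pb C f g" "Cod C (pb1 C f g) = Dom C f"
    "pb2 C f g \<in> Arr C" "Dom C (pb2 C f g) = pb C f g" "Cod C (pb2 C f g) = Dom C g"
    "pb C f g \<in> Obj C"
  using is_pullback_pb[OF assms] Dom_in_Obj[of "pb1 C f g"] unfolding is_pullback_def pb_def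
  by (simp_all add: hom_def)

lemma pb_commutes:
  assumes "f \<in> Arr C" "g \<in> Arr C" "Cod C f = Cod C g"
  shows "f \<cdot> pb1 C f g = g \<cdot> pb2 C f g"
  using is_pullback_pb[OF assms] unfolding is_pullback_def by blast

lemma pb_pair_unique:
  assumes "f \<in> Arr C" "g \<in> Arr C" "Cod C f = Cod C g"
    "a \<in> hom C X (Dom C f)" "b \<in> hom C X (Dom C g)" "f \<cdot> a = g \<cdot> b"
  shows "\<exists>!h. h \<in> hom C X (pb C f g) \<and> pb1 C f g \<cdot> h = a \<and> pb2 C f g \<cdot> h = b"
  using is_pullback_pb[OF assms(1-3)] assms(4-) unfolding is_pullback_def pb_def by blast

lemma pb_ext:
  assumes f: "f \<in> Arr C" "g \<in> Arr C" "Cod C f = Cod C g"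
    and h: "h \<in> hom C X (pb C f g)" "k \<in> hom C X (pb C f g)"
    and eq: "pb1 C f g \<cdot> h = pb1 C f g \<cdot> k" "pb2 C f g \<cdot> h = pb2 C f g \<cdot> k"
  shows "h = k"
proof -
  have "f \<cdot> (pb1 C f g \<cdot> h) = g \<cdot> (pb2 C f g \<cdot> h)"
    using f h pb_commutes[OF f] by (simp_all add: hom_def flip: Comp_assoc_simp)
  moreover have "pb1 C f g \<cdot> h \<in> hom C X (Dom C f)" "pb2 C f g \<cdot> h \<in> hom C X (Dom C g)"
    using f h by (simp_all add: hom_def)
  ultimately show ?thesis using pb_pair_unique[OF f] h eq by metis
qed

lemma pb_pair_simps [simp]:
  assumes "f \<in> Arr C" "g \<in> Arr C" "Cod C f = Cod C g"
    "a \<in> Arr C" "b \<in> Arr C" "Dom C a = Dom C b" "Cod C a = Dom C f" "Cod C b = Dom C g" "f \<cdot> a = g \<cdot> b"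
  shows "pb_pair C f g a b \<in> Arr C" "Dom C (pb_pair C f g a b) = Dom C b"
    "Cod C (pb_pair C f g a b) = pb C f g"
    "pb1 C f g \<cdot> pb_pair C f g a b = a" "pb2 C f g \<cdot> pb_pair C f g a b = b"
proof -
  have "a \<in> hom C (Dom C a) (Dom C f)" "b \<in> hom C (Dom C a) (Dom C g)"
    using assms by (simp_all add: hom_def)
  note theI'[OF pb_pair_unique[OF assms(1-3) this assms(9)]]
  then show "pb_pair C f g a b \<in> Arr C" "Dom C (pb_pair C f g a b) = Dom C b"
    "Cod C (pb_pair C f g a b) = pb C f g"
    "pb1 C f g \<cdot> pb_pair C f g a b = a" "pb2 C f g \<cdot> pb_pair C f g a b = b"
    unfolding pb_pair_def[symmetric] using assms by (simp_all add: hom_def)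
qed

section \<open>Images and covers\<close>

lemma regular_epi_pullback:
  assumes e: "regular_epi C e" and f: "f \<in> hom C Z (Cod C e)"
  obtains W e' f' where "e' \<in> hom C W Z" "regular_epi C e'" "f' \<in> hom C W (Dom C e)" "f \<cdot> e' = e \<cdot> f'"
proof -
  have t: "f \<in> Arr C" "e \<in> Arr C" "Cod C f = Cod C e" "Dom C f = Z"
    using f regular_epi_Arr[OF e] by (simp_all add: hom_def)
  note pb = is_pullback_pb[OF t(1-3)]
  show ?thesis
    by (rule that[of "pb1 C f e" "pb C f e" "pb2 C f e"])
      (use t regular_epi_stable[OF pb e] pb_commutes[OF t(1-3)] in \<open>simp_all add: hom_def\<close>)
qed

text \<open>
  The coequalizer \<open>e\<close> of the kernel pair of \<open>f\<close> is the regular epimorphism; it remains to see that the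
  induced \<open>m\<close> is a monomorphism.  If \<open>m \<cdot> a = m \<cdot> b\<close>, then on a common cover \<open>a\<close> and \<open>b\<close> lift along
  \<open>e\<close> to \<open>x\<close> and \<open>y\<close>.  As \<open>f\<close> identifies \<open>x\<close> and \<open>y\<close>, they factor through the kernel pair,
  hence \<open>e\<close> identifies them, and \<open>a = b\<close> holds on the cover.
\<close>

lemma image_factorization:
  assumes f: "f \<in> Arr C"
  obtains m e where "monic C m" "e \<in> hom C (Dom C f) (Dom C m)" "regular_epi C e" "m \<cdot> e = f"
proof -
  note pb = is_pullback_pb[OF f f refl]
  let ?p = "pb1 C f f" and ?q = "pb2 C f f"
  have pq: "?p \<in> hom C (pb C f f) (Dom C f)" "?q \<in> hom C (pb C f f) (Dom C f)" "f \<cdot> ?p = f \<cdot> ?q"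
    using f pb_commutes[OF f f] by (simp_all add: hom_def)
  obtain e where e: "is_coequalizer C ?p ?q e" using kernel_pair_coequalizer[OF pb] by blast
  then have re: "regular_epi C e" unfolding regular_epi_def by blast
  have et: "e \<in> hom C (Dom C f) (Cod C e)" "e \<cdot> ?p = e \<cdot> ?q"
    using e f unfolding is_coequalizer_def by auto
  have "\<forall>k\<in>hom C (Dom C f) (Cod C f). k \<cdot> ?p = k \<cdot> ?q \<longrightarrow> (\<exists>!h. h \<in> hom C (Cod C e) (Cod C f) \<and> h \<cdot> e = k)"
    using e f unfolding is_coequalizer_def by auto
  moreover have "f \<in> hom C (Dom C f) (Cod C f)" using f by (simp add: hom_def)
  ultimately obtain m where m: "m \<in> hom C (Cod C e) (Cod C f)" "m \<cdot> e = f"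
    using pq(3) by blast
  have "monic C m" unfolding monic_def
  proof (intro conjI allI ballI impI)
    show "m \<in> Arr C" using m by (simp add: hom_def)
    fix Z a b assume a: "a \<in> hom C Z (Dom C m)" and b: "b \<in> hom C Z (Dom C m)" and ab: "m \<cdot> a = m \<cdot> b"
    have dm: "Dom C m = Cod C e" using m by (simp add: hom_def)
    obtain W e1 x where e1: "e1 \<in> hom C W Z" "regular_epi C e1" and x: "x \<in> hom C W (Dom C e)" "a \<cdot> e1 = e \<cdot> x"
      using regular_epi_pullback[OF re] a dm by metis
    have "b \<cdot> e1 \<in> hom C W (Cod C e)" using b e1 dm by (simp_all add: hom_def)
    then obtain V e2 y where e2: "e2 \<in> hom C V W" "regular_epi C e2" and y: "y \<in> hom C V (Dom C e)"
        "(b \<cdot> e1) \<cdot> e2 = e \<cdot> y"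
      using regular_epi_pullback[OF re] by metis
    note ty = homD[OF a] homD[OF b] homD[OF e1(1)] homD[OF e2(1)] homD[OF x(1)] homD[OF y(1)]
       homD[OF et(1)] homD[OF m(1)] dm f
    have xe: "x \<cdot> e2 \<in> hom C V (Dom C f)" using ty by (simp_all add: hom_def)
    have yf: "y \<in> hom C V (Dom C f)" using ty by (simp_all add: hom_def)
    have ex: "e \<cdot> (x \<cdot> e2) = a \<cdot> (e1 \<cdot> e2)"
    proof -
      have "e \<cdot> (x \<cdot> e2) = (e \<cdot> x) \<cdot> e2" using ty by simp
      also have "\<dots> = a \<cdot> (e1 \<cdot> e2)" unfolding x(2)[symmetric] using ty by simp
      finally show ?thesis .
    qed
    have ey: "e \<cdot> y = b \<cdot> (e1 \<cdot> e2)" unfolding y(2)[symmetric] using ty by simp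
    have "f \<cdot> (x \<cdot> e2) = m \<cdot> (e \<cdot> (x \<cdot> e2))" unfolding m(2)[symmetric] using ty by simp
    also have "\<dots> = (m \<cdot> a) \<cdot> (e1 \<cdot> e2)" unfolding ex using ty by simp
    also have "\<dots> = (m \<cdot> b) \<cdot> (e1 \<cdot> e2)" using ab by simp
    also have "\<dots> = m \<cdot> (e \<cdot> y)" unfolding ey using ty by simp
    also have "\<dots> = f \<cdot> y" unfolding m(2)[symmetric] using ty by simp
    finally obtain k where k: "k \<in> hom C V (pb C f f)" "?p \<cdot> k = x \<cdot> e2" "?q \<cdot> k = y"
      using pb_pair_unique[OF f f refl xe yf] by auto
    have "e \<cdot> (x \<cdot> e2) = (e \<cdot> ?p) \<cdot> k" unfolding k(2)[symmetric] using ty pq k(1) by (simp add: hom_def)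
    also have "\<dots> = e \<cdot> y" unfolding et(2) k(3)[symmetric] using ty pq k(1) by (simp add: hom_def)
    finally have "a \<cdot> (e1 \<cdot> e2) = b \<cdot> (e1 \<cdot> e2)" using ex ey by simp
    then have "(a \<cdot> e1) \<cdot> e2 = (b \<cdot> e1) \<cdot> e2" using ty by simp
    then have "a \<cdot> e1 = b \<cdot> e1"
      by (rule regular_epi_cancel[OF e2(2), rotated 2]) (use ty in \<open>simp_all add: hom_def\<close>)
    then show "a = b"
      by (rule regular_epi_cancel[OF e1(2), rotated 2]) (use ty in \<open>simp_all add: hom_def\<close>)
  qed
  then show ?thesis using that[of m e] re et m by (simp_all add: hom_def)
qed

text \<open>
  The monic part of an image factorization of \<open>d \<cdot> e\<close> is invertible: by locality of membership,
  first along \<open>e\<close> and then along \<open>d\<close>, the identity of the codomain factors through it.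
\<close>

lemma regular_epi_Comp:
  assumes e: "regular_epi C e" and d: "regular_epi C d" and ed: "Dom C d = Cod C e"
  shows "regular_epi C (d \<cdot> e)"
proof -
  note arr = regular_epi_Arr[OF e] regular_epi_Arr[OF d] ed
  have de: "d \<cdot> e \<in> Arr C" using arr by simp
  obtain m c where m: "monic C m" and c: "c \<in> hom C (Dom C e) (Dom C m)" "regular_epi C c" "m \<cdot> c = d \<cdot> e"
    using image_factorization[OF de] arr by auto
  have cm: "Cod C m = Cod C d"
  proof -
    have "Cod C m = Cod C (m \<cdot> c)" using c(1) monic_Arr[OF m] by (simp add: hom_def)
    also have "\<dots> = Cod C d" unfolding c(3) using arr by simp
    finally show ?thesis .
  qed
  have "factors m (d \<cdot> e)" using c arr unfolding factors_def by auto
  then have "factors m d"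
    by (rule regular_epi_factors[OF e m, rotated]) (use arr cm in \<open>simp_all add: hom_def\<close>)
  then have "factors m (Ident C (Cod C d) \<cdot> d)" using arr by simp
  then have "factors m (Ident C (Cod C d))"
    by (rule regular_epi_factors[OF d m, rotated]) (use arr cm in \<open>simp_all add: hom_def Cod_in_Obj\<close>)
  then obtain l where l: "l \<in> hom C (Cod C d) (Dom C m)" "m \<cdot> l = Ident C (Cod C m)"
    unfolding factors_def using arr cm by (auto simp: Cod_in_Obj)
  have "m \<cdot> (l \<cdot> m) = m \<cdot> Ident C (Dom C m)"
    using l monic_Arr[OF m] cm by (simp_all add: hom_def flip: Comp_assoc_simp)
  then have "l \<cdot> m = Ident C (Dom C m)"
    by (rule monicD[OF m]) (use l monic_Arr[OF m] cm in \<open>simp_all add: hom_def Dom_in_Obj\<close>)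
  then have "iso C m" using l m cm unfolding iso_def by (auto simp: monic_Arr)
  then have "regular_epi C (m \<cdot> c)" using regular_epi_iso_Comp[OF c(2)] c(1) by (simp_all add: hom_def)
  then show ?thesis using c(3) by simp
qed

text \<open>
  The existential quantifier of regular logic: an element belongs to an image iff it has a preimage
  on some cover.
\<close>

lemma image_factors_iff:
  assumes m: "m \<in> image_subobject C f" and h: "h \<in> hom C X (Cod C f)"
  shows "factors m h \<longleftrightarrow> (\<exists>Y. \<exists>e \<in> hom C Y X. regular_epi C e \<and> (\<exists>k \<in> hom C Y (Dom C f). f \<cdot> k = h \<cdot> e))"
proof -
  obtain c where mm: "monic C m" and c: "c \<in> hom C (Dom C f) (Dom C m)" "regular_epi C c" "m \<cdot> c = f"
    using m unfolding image_subobject_def by blast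
  note ma = monic_Arr[OF mm]
  have cm: "Cod C m = Cod C f" using c(1) ma unfolding c(3)[symmetric] by (simp add: hom_def)
  show ?thesis
  proof
    assume "factors m h"
    then obtain j where j: "j \<in> hom C X (Dom C m)" "m \<cdot> j = h"
      unfolding factors_def homD(2)[OF h] by blast
    then have "j \<in> hom C X (Cod C c)" using c by (simp_all add: hom_def)
    then obtain W e' k where ek: "e' \<in> hom C W X" "regular_epi C e'" "k \<in> hom C W (Dom C c)" "j \<cdot> e' = c \<cdot> k"
      by (rule regular_epi_pullback[OF c(2)])
    have "f \<cdot> k = m \<cdot> (j \<cdot> e')" unfolding c(3)[symmetric] ek(4) using c(1) ek(3) ma by (simp_all add: hom_def)
    also have "\<dots> = h \<cdot> e'" unfolding j(2)[symmetric] using j(1) ek(1) ma by (simp_all add: hom_def)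
    finally show "\<exists>Y. \<exists>e \<in> hom C Y X. regular_epi C e \<and> (\<exists>k \<in> hom C Y (Dom C f). f \<cdot> k = h \<cdot> e)"
      using ek(1-3) unfolding homD(2)[OF c(1)] by blast
  next
    assume "\<exists>Y. \<exists>e \<in> hom C Y X. regular_epi C e \<and> (\<exists>k \<in> hom C Y (Dom C f). f \<cdot> k = h \<cdot> e)"
    then obtain Y e k where e: "e \<in> hom C Y X" "regular_epi C e" and k: "k \<in> hom C Y (Dom C f)" "f \<cdot> k = h \<cdot> e"
      by blast
    have "m \<cdot> (c \<cdot> k) = h \<cdot> e" unfolding k(2)[symmetric] c(3)[symmetric] using c(1) k(1) ma by (simp_all add: hom_def)
    moreover have "c \<cdot> k \<in> hom C (Dom C (h \<cdot> e)) (Dom C m)" using c(1) k(1) e(1) h by (simp_all add: hom_def)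
    ultimately have "factors m (h \<cdot> e)" unfolding factors_def by blast
    then show "factors m h"
      by (rule regular_epi_factors[OF e(2) mm, rotated]) (use h e cm in \<open>simp_all add: hom_def\<close>)
  qed
qed

lemma image_subobject_Cod:
  "m \<in> image_subobject C f \<Longrightarrow> Cod C m = Cod C f"
  unfolding image_subobject_def by (auto simp: hom_def monic_Arr)

lemma image_subobject_eq:
  assumes m: "m \<in> image_subobject C f"
  shows "image_subobject C f = subobject C m"
proof -
  obtain c where mm: "monic C m" and c: "c \<in> hom C (Dom C f) (Dom C m)" "regular_epi C c" "m \<cdot> c = f"
    using m unfolding image_subobject_def by blast
  show ?thesis
  proof (intro set_eqI iffI)
    fix n assume n: "n \<in> image_subobject C f"
    then have mn: "monic C n" unfolding image_subobject_def by blast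
    have ty: "n \<in> hom C (Dom C n) (Cod C f)" "m \<in> hom C (Dom C m) (Cod C f)"
      using image_subobject_Cod[OF n] image_subobject_Cod[OF m] mn mm by (simp_all add: hom_def monic_Arr)
    have "factors m n" "factors n m"
      using image_factors_iff[OF m ty(1)] image_factors_iff[OF n ty(1)]
        image_factors_iff[OF m ty(2)] image_factors_iff[OF n ty(2)]
        factors_refl[OF monic_Arr[OF mn]] factors_refl[OF monic_Arr[OF mm]] by blast+
    then show "n \<in> subobject C m" using mm mn by (simp add: mem_subobject_iff)
  next
    fix n assume "n \<in> subobject C m"
    then have "m \<in> subobject C n" "monic C n" using mm by (auto simp: mem_subobject_iff)
    then obtain i where i: "i \<in> hom C (Dom C m) (Dom C n)" "iso C i" "n \<cdot> i = m"
      unfolding subobject_def by blast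
    have "n \<cdot> (i \<cdot> c) = f" unfolding c(3)[symmetric] i(3)[symmetric]
      using i(1) c(1) monic_Arr[OF \<open>monic C n\<close>] by (simp_all add: hom_def)
    moreover have "regular_epi C (i \<cdot> c)" using i c by (intro regular_epi_iso_Comp) (simp_all add: hom_def)
    moreover have "i \<cdot> c \<in> hom C (Dom C f) (Dom C n)" using i c by (simp_all add: hom_def)
    ultimately show "n \<in> image_subobject C f" using \<open>monic C n\<close> unfolding image_subobject_def by blast
  qed
qed

end

section \<open>Relations and generalized elements\<close>

context regular_category begin

text \<open>
  \<open>sat R a b\<close> is the statement \<open>R(a, b)\<close> about generalized elements with a common stage of definition.
\<close>

definition sat :: "('a, 'b) relation \<Rightarrow> 'b \<Rightarrow> 'b \<Rightarrow> bool" where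
  "sat R a b \<longleftrightarrow> (\<exists>r \<in> rsub R. factors r (pair C a b))"

lemma monic_pairI:
  assumes "f \<in> hom C W A" "g \<in> hom C W B"
    and "\<And>X h k. h \<in> hom C X W \<Longrightarrow> k \<in> hom C X W \<Longrightarrow> f \<cdot> h = f \<cdot> k \<Longrightarrow> g \<cdot> h = g \<cdot> k \<Longrightarrow> h = k"
  shows "monic C (pair C f g)"
  unfolding monic_def
proof (intro conjI allI ballI impI)
  show "pair C f g \<in> Arr C" using assms(1,2) by (simp add: hom_def)
  fix X h k assume h: "h \<in> hom C X (Dom C (pair C f g))" "k \<in> hom C X (Dom C (pair C f g))"
    and eq: "pair C f g \<cdot> h = pair C f g \<cdot> k"
  have hk: "h \<in> hom C X W" "k \<in> hom C X W" using h assms(1,2) by (simp_all add: hom_def)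
  then have "f \<cdot> h = f \<cdot> k \<and> g \<cdot> h = g \<cdot> k"
    using eq assms(1,2) by (simp add: hom_def)
  then show "h = k" using assms(3) hk by blast
qed

lemma factors_pair_iff:
  assumes "f \<in> hom C W A" "g \<in> hom C W B" "a \<in> hom C X A" "b \<in> hom C X B"
  shows "factors (pair C f g) (pair C a b) \<longleftrightarrow> (\<exists>k \<in> hom C X W. f \<cdot> k = a \<and> g \<cdot> k = b)"
proof -
  have "Dom C (pair C a b) = X" "Dom C (pair C f g) = W" using assms by (simp_all add: hom_def)
  moreover have "pair C f g \<cdot> k = pair C a b \<longleftrightarrow> f \<cdot> k = a \<and> g \<cdot> k = b" if "k \<in> hom C X W" for k
    using assms that by (simp add: hom_def)
  ultimately show ?thesis unfolding factors_def by (metis (no_types, lifting))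
qed

lemma all_prd:
  assumes "A \<in> Obj C" "B \<in> Obj C"
  shows "(\<forall>z \<in> hom C X (prd C A B). P z) \<longleftrightarrow> (\<forall>a \<in> hom C X A. \<forall>b \<in> hom C X B. P (pair C a b))"
proof
  assume *: "\<forall>z \<in> hom C X (prd C A B). P z"
  show "\<forall>a \<in> hom C X A. \<forall>b \<in> hom C X B. P (pair C a b)"
  proof (intro ballI)
    fix a b assume "a \<in> hom C X A" "b \<in> hom C X B"
    then have "pair C a b \<in> hom C X (prd C A B)" by (simp add: hom_def)
    then show "P (pair C a b)" using * by blast
  qed
next
  assume *: "\<forall>a \<in> hom C X A. \<forall>b \<in> hom C X B. P (pair C a b)"
  show "\<forall>z \<in> hom C X (prd C A B). P z"
  proof
    fix z assume z: "z \<in> hom C X (prd C A B)"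
    then have "pr1 C A B \<cdot> z \<in> hom C X A" "pr2 C A B \<cdot> z \<in> hom C X B"
      using assms by (simp_all add: hom_def)
    then show "P z" using * pair_eta[OF z assms] by metis
  qed
qed

lemma ex_prd:
  assumes "A \<in> Obj C" "B \<in> Obj C"
  shows "(\<exists>z. z \<in> hom C X (prd C A B) \<and> P z) \<longleftrightarrow>
    (\<exists>a b. a \<in> hom C X A \<and> b \<in> hom C X B \<and> P (pair C a b))"
  using all_prd[OF assms, of X "\<lambda>z. \<not> P z"] by blast

lemma all_terminal:
  "(\<forall>z \<in> hom C X (terminal_obj C). P z) \<longleftrightarrow> (X \<in> Obj C \<longrightarrow> P (bang C X))"
proof -
  have "z \<in> hom C X (terminal_obj C) \<longleftrightarrow> X \<in> Obj C \<and> z = bang C X" for z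
  proof
    assume z: "z \<in> hom C X (terminal_obj C)"
    have "bang C X \<in> hom C X (terminal_obj C)" using homD(4)[OF z] by (simp add: hom_def)
    then show "X \<in> Obj C \<and> z = bang C X" using z homD(4)[OF z] terminal_unique by blast
  next
    assume "X \<in> Obj C \<and> z = bang C X"
    then show "z \<in> hom C X (terminal_obj C)" by (simp add: hom_def)
  qed
  then show ?thesis by (simp add: Ball_def)
qed

lemma pair_hom: "a \<in> hom C X A \<Longrightarrow> b \<in> hom C X B \<Longrightarrow> pair C a b \<in> hom C X (prd C A B)"
  by (simp add: hom_def)

text \<open>
  Each operation on relations is defined as a union of subobjects, one for every choice of
  representatives.  As soon as all of them have the same elements, they coincide by extensionality,
  and the union is that one subobject.
\<close>

lemma relation_of_subobjects:
  assumes "\<S> \<noteq> {}" and A: "A \<in> Obj C" and B: "B \<in> Obj C"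
    and S: "\<forall>T \<in> \<S>. \<exists>m. monic C m \<and> Cod C m = prd C A B \<and> T = subobject C m \<and>
      (\<forall>X. \<forall>a \<in> hom C X A. \<forall>b \<in> hom C X B. factors m (pair C a b) \<longleftrightarrow> P a b)"
  shows "Relation A B (\<Union>\<S>) \<in> relations C"
    and "a \<in> hom C X A \<Longrightarrow> b \<in> hom C X B \<Longrightarrow> sat (Relation A B (\<Union>\<S>)) a b \<longleftrightarrow> P a b"
proof -
  obtain T0 where T0: "T0 \<in> \<S>" using assms(1) by blast
  obtain m where m: "monic C m" "Cod C m = prd C A B" "T0 = subobject C m"
     "\<forall>X. \<forall>a \<in> hom C X A. \<forall>b \<in> hom C X B. factors m (pair C a b) \<longleftrightarrow> P a b"
    using bspec[OF S T0] by blast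
  have "T = subobject C m" if T: "T \<in> \<S>" for T
  proof -
    obtain n where n: "monic C n" "Cod C n = prd C A B" "T = subobject C n"
       "\<forall>X. \<forall>a \<in> hom C X A. \<forall>b \<in> hom C X B. factors n (pair C a b) \<longleftrightarrow> P a b"
      using bspec[OF S T] by blast
    have "\<forall>z \<in> hom C X (prd C A B). factors n z \<longleftrightarrow> factors m z" for X
      unfolding all_prd[OF A B] using m(4) n(4) by blast
    then show ?thesis unfolding n(3)
      by (intro subobject_eqI_factors) (use m n in auto)
  qed
  then have U: "\<Union>\<S> = subobject C m" using T0 by blast
  show "Relation A B (\<Union>\<S>) \<in> relations C"
    unfolding U relations_def subobjects_def using A B m by auto
  show "sat (Relation A B (\<Union>\<S>)) a b \<longleftrightarrow> P a b" if "a \<in> hom C X A" "b \<in> hom C X B"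
  proof -
    have "sat (Relation A B (\<Union>\<S>)) a b \<longleftrightarrow> factors m (pair C a b)"
      unfolding sat_def U relation.sel
      using subobject_self[OF m(1)] mem_subobject_factors(3)[OF m(1)] by blast
    then show ?thesis using m(4) that by blast
  qed
qed

lemma rsub_nonempty: "R \<in> relations C \<Longrightarrow> \<exists>r. r \<in> rsub R"
  unfolding relations_def subobjects_def using subobject_self by blast

lemma rsubD:
  assumes "R \<in> relations C" "r \<in> rsub R"
  shows "monic C r" "r \<in> hom C (Dom C r) (prd C (rdom R) (rcod R))" "rsub R = subobject C r"
    "sat R a b \<longleftrightarrow> factors r (pair C a b)"
proof -
  obtain m where m: "monic C m" "Cod C m = prd C (rdom R) (rcod R)" "rsub R = subobject C m"
    using assms(1) unfolding relations_def subobjects_def by blast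
  note f = mem_subobject_factors[OF m(1), of r]
  show "monic C r" "r \<in> hom C (Dom C r) (prd C (rdom R) (rcod R))" "rsub R = subobject C r"
    using f m assms(2) by (simp_all add: hom_def monic_Arr)
  show "sat R a b \<longleftrightarrow> factors r (pair C a b)"
    unfolding sat_def m(3) using mem_subobject_factors(3)[OF m(1)] assms(2) m(3) by blast
qed

lemma relationsD:
  assumes "R \<in> relations C" shows "rdom R \<in> Obj C" "rcod R \<in> Obj C"
  using assms unfolding relations_def by auto

text \<open>
  Relations are extensional, which turns every equation between relations into an equivalence of
  statements about generalized elements.
\<close>

lemma relation_eqI:
  assumes R: "R \<in> relations C" and S: "S \<in> relations C" and eq: "rdom R = rdom S" "rcod R = rcod S"
    and sat: "\<And>X a b. a \<in> hom C X (rdom S) \<Longrightarrow> b \<in> hom C X (rcod S) \<Longrightarrow> sat R a b \<longleftrightarrow> sat S a b"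
  shows "R = S"
proof -
  obtain r s where r: "r \<in> rsub R" and s: "s \<in> rsub S" using R S rsub_nonempty by blast
  note r' = rsubD[OF R r] and s' = rsubD[OF S s]
  have "\<forall>z \<in> hom C X (prd C (rdom S) (rcod S)). factors r z \<longleftrightarrow> factors s z" for X
    unfolding all_prd[OF relationsD[OF S]] using r'(4) s'(4) sat by blast
  moreover have "Cod C r = prd C (rdom S) (rcod S)" "Cod C s = prd C (rdom S) (rcod S)"
    using homD(3)[OF r'(2)] homD(3)[OF s'(2)] eq by simp_all
  ultimately have "subobject C r = subobject C s"
    using r'(1) s'(1) by (intro subobject_eqI_factors) auto
  then show ?thesis using r'(3) s'(3) eq by (intro relation.expand) auto
qed

lemma relation_eq_iff:
  assumes R: "R \<in> relations C" and S: "S \<in> relations C" and eq: "rdom R = rdom S" "rcod R = rcod S"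
  shows "R = S \<longleftrightarrow> (\<forall>X. \<forall>a \<in> hom C X (rdom S). \<forall>b \<in> hom C X (rcod S). sat R a b \<longleftrightarrow> sat S a b)"
  using relation_eqI[OF assms] by blast

lemma leg_simps:
  assumes "R \<in> relations C" "r \<in> rsub R"
  shows "leg1 C R r \<in> hom C (Dom C r) (rdom R)" "leg2 C R r \<in> hom C (Dom C r) (rcod R)"
    "pair C (leg1 C R r) (leg2 C R r) = r"
  using rsubD(2)[OF assms] relationsD[OF assms(1)] pair_eta unfolding leg1_def leg2_def
  by (simp_all add: hom_def)

lemma sat_legs_iff:
  assumes R: "R \<in> relations C" "r \<in> rsub R" and a: "a \<in> hom C X (rdom R)" and b: "b \<in> hom C X (rcod R)"
  shows "sat R a b \<longleftrightarrow> (\<exists>k \<in> hom C X (Dom C r). leg1 C R r \<cdot> k = a \<and> leg2 C R r \<cdot> k = b)"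
  using factors_pair_iff[OF leg_simps(1,2)[OF R] a b] leg_simps(3)[OF R] rsubD(4)[OF R] by simp

lemma legs_jointly_monic:
  assumes R: "R \<in> relations C" "r \<in> rsub R" and h: "h \<in> hom C X (Dom C r)" "k \<in> hom C X (Dom C r)"
    and eq: "leg1 C R r \<cdot> h = leg1 C R r \<cdot> k" "leg2 C R r \<cdot> h = leg2 C R r \<cdot> k"
  shows "h = k"
proof (rule monicD[OF rsubD(1)[OF R] _ h])
  have "pair C (leg1 C R r) (leg2 C R r) \<cdot> h = pair C (leg1 C R r) (leg2 C R r) \<cdot> k"
    using leg_simps(1,2)[OF R] h eq by (simp add: hom_def)
  then show "r \<cdot> h = r \<cdot> k" using leg_simps(3)[OF R] by simp
qed

lemma sat_Comp:
  assumes R: "R \<in> relations C" and a: "a \<in> hom C X (rdom R)" and b: "b \<in> hom C X (rcod R)"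
    and y: "y \<in> hom C Y X" and s: "sat R a b"
  shows "sat R (a \<cdot> y) (b \<cdot> y)"
proof -
  obtain r where r: "r \<in> rsub R" using R rsub_nonempty by blast
  obtain k where k: "k \<in> hom C X (Dom C r)" "leg1 C R r \<cdot> k = a" "leg2 C R r \<cdot> k = b"
    using s sat_legs_iff[OF R r a b] by blast
  have "k \<cdot> y \<in> hom C Y (Dom C r)" "leg1 C R r \<cdot> (k \<cdot> y) = a \<cdot> y" "leg2 C R r \<cdot> (k \<cdot> y) = b \<cdot> y"
    using k(1) y leg_simps(1,2)[OF R r] Comp_reassoc[OF k(2)] Comp_reassoc[OF k(3)] by (simp_all add: hom_def)
  moreover have "a \<cdot> y \<in> hom C Y (rdom R)" "b \<cdot> y \<in> hom C Y (rcod R)"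
    using a b y by (simp_all add: hom_def)
  ultimately show ?thesis using sat_legs_iff[OF R r] by blast
qed

text \<open>
  Together with stability under change of stage, locality makes \<open>sat R\<close> a subsheaf of the pairs of
  generalized elements, for the topology of regular epimorphisms; this is what allows existential
  witnesses to be chosen on a cover.
\<close>

lemma sat_local:
  assumes R: "R \<in> relations C" and a: "a \<in> hom C X (rdom R)" and b: "b \<in> hom C X (rcod R)"
    and e: "e \<in> hom C Y X" "regular_epi C e" and s: "sat R (a \<cdot> e) (b \<cdot> e)"
  shows "sat R a b"
proof -
  obtain r where r: "r \<in> rsub R" using R rsub_nonempty by blast
  note r' = rsubD[OF R r]
  have "factors r (pair C a b \<cdot> e)" using s r'(4) a b e(1) by (simp add: hom_def)
  then have "factors r (pair C a b)"
    by (rule regular_epi_factors[OF e(2) r'(1), rotated]) (use a b e r'(2) in \<open>simp add: hom_def\<close>)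
  then show ?thesis using r'(4) by simp
qed

lemma span_rel_sat:
  assumes f: "f \<in> hom C W A" and g: "g \<in> hom C W B" and m: "monic C (pair C f g)"
  shows "span_rel C f g \<in> relations C" "rdom (span_rel C f g) = A" "rcod (span_rel C f g) = B"
    "a \<in> hom C X A \<Longrightarrow> b \<in> hom C X B \<Longrightarrow>
      sat (span_rel C f g) a b \<longleftrightarrow> (\<exists>k \<in> hom C (Dom C a) W. f \<cdot> k = a \<and> g \<cdot> k = b)"
proof -
  let ?P = "\<lambda>a b. \<exists>k \<in> hom C (Dom C a) W. f \<cdot> k = a \<and> g \<cdot> k = b"
  have *: "span_rel C f g = Relation A B (\<Union>{subobject C (pair C f g)})"
    using f g by (simp add: span_rel_def hom_def)
  have S: "\<forall>T \<in> {subobject C (pair C f g)}. \<exists>m. monic C m \<and> Cod C m = prd C A B \<and> T = subobject C m \<and>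
      (\<forall>X. \<forall>a \<in> hom C X A. \<forall>b \<in> hom C X B. factors m (pair C a b) \<longleftrightarrow> ?P a b)"
    unfolding ball_simps
  proof (intro exI conjI allI ballI TrueI)
    show "monic C (pair C f g)" by fact
    show "Cod C (pair C f g) = prd C A B" using f g by (simp add: hom_def)
    show "subobject C (pair C f g) = subobject C (pair C f g)" ..
    fix X a b assume a: "a \<in> hom C X A" and b: "b \<in> hom C X B"
    show "factors (pair C f g) (pair C a b) \<longleftrightarrow> ?P a b"
      unfolding homD(2)[OF a] by (rule factors_pair_iff[OF f g a b])
  qed
  note rel = relation_of_subobjects[OF insert_not_empty homD(5)[OF f] homD(5)[OF g], where P = ?P, OF S]
  show "span_rel C f g \<in> relations C" "rdom (span_rel C f g) = A" "rcod (span_rel C f g) = B"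
    using rel(1) unfolding * by simp_all
  show "a \<in> hom C X A \<Longrightarrow> b \<in> hom C X B \<Longrightarrow> sat (span_rel C f g) a b \<longleftrightarrow> ?P a b"
    using rel(2) unfolding * by simp
qed

lemma graph_rel_sat:
  assumes f: "f \<in> hom C A B"
  shows "graph_rel C f \<in> relations C" "rdom (graph_rel C f) = A" "rcod (graph_rel C f) = B"
    "a \<in> hom C X A \<Longrightarrow> b \<in> hom C X B \<Longrightarrow> sat (graph_rel C f) a b \<longleftrightarrow> f \<cdot> a = b"
proof -
  note i = Ident_in_hom[OF homD(4)[OF f]]
  have "monic C (pair C (Ident C A) f)"
    by (rule monic_pairI[OF i f]) (use homD[OF f] in \<open>auto simp: hom_def\<close>)
  note s = span_rel_sat[OF i f this]
  have eq: "graph_rel C f = span_rel C (Ident C A) f" using f by (simp add: graph_rel_def hom_def)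
  show "graph_rel C f \<in> relations C" "rdom (graph_rel C f) = A" "rcod (graph_rel C f) = B"
    using s(1-3) eq by simp_all
  show "sat (graph_rel C f) a b \<longleftrightarrow> f \<cdot> a = b" if "a \<in> hom C X A" "b \<in> hom C X B"
    unfolding eq s(4)[OF that] using that homD[OF f] by (auto simp: hom_def)
qed

lemma rel_dagger_sat:
  assumes R: "R \<in> relations C"
  shows "rel_dagger C R \<in> relations C" "rdom (rel_dagger C R) = rcod R" "rcod (rel_dagger C R) = rdom R"
    "b \<in> hom C X (rcod R) \<Longrightarrow> a \<in> hom C X (rdom R) \<Longrightarrow> sat (rel_dagger C R) b a \<longleftrightarrow> sat R a b"
proof -
  let ?\<S> = "(\<lambda>r. subobject C (pair C (leg2 C R r) (leg1 C R r))) ` rsub R"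
  have *: "rel_dagger C R = Relation (rcod R) (rdom R) (\<Union>?\<S>)"
    by (simp add: rel_dagger_def)
  have S: "\<forall>T \<in> ?\<S>. \<exists>m. monic C m \<and> Cod C m = prd C (rcod R) (rdom R) \<and> T = subobject C m \<and>
      (\<forall>X. \<forall>b \<in> hom C X (rcod R). \<forall>a \<in> hom C X (rdom R). factors m (pair C b a) \<longleftrightarrow> sat R a b)"
  proof
    fix T assume TS: "T \<in> ?\<S>"
    obtain r where r: "r \<in> rsub R" and T: "T = subobject C (pair C (leg2 C R r) (leg1 C R r))"
      using TS by blast
    note l = leg_simps[OF R r]
    show "\<exists>m. monic C m \<and> Cod C m = prd C (rcod R) (rdom R) \<and> T = subobject C m \<and>
      (\<forall>X. \<forall>b \<in> hom C X (rcod R). \<forall>a \<in> hom C X (rdom R). factors m (pair C b a) \<longleftrightarrow> sat R a b)"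
    proof (intro exI conjI allI ballI)
      show "monic C (pair C (leg2 C R r) (leg1 C R r))"
        by (rule monic_pairI[OF l(2,1)]) (rule legs_jointly_monic[OF R r])
      show "Cod C (pair C (leg2 C R r) (leg1 C R r)) = prd C (rcod R) (rdom R)" using l(1,2) by (simp add: hom_def)
      show "T = subobject C (pair C (leg2 C R r) (leg1 C R r))" by fact
      fix X b a assume b: "b \<in> hom C X (rcod R)" and a: "a \<in> hom C X (rdom R)"
      show "factors (pair C (leg2 C R r) (leg1 C R r)) (pair C b a) \<longleftrightarrow> sat R a b"
        unfolding factors_pair_iff[OF l(2,1) b a] sat_legs_iff[OF R r a b] by blast
    qed
  qed
  have ne: "?\<S> \<noteq> {}" using rsub_nonempty[OF R] by blast
  note rel = relation_of_subobjects[OF ne relationsD(2,1)[OF R], where P = "\<lambda>b a. sat R a b", OF S]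
  show "rel_dagger C R \<in> relations C" "rdom (rel_dagger C R) = rcod R" "rcod (rel_dagger C R) = rdom R"
    using rel(1) unfolding * by simp_all
  show "b \<in> hom C X (rcod R) \<Longrightarrow> a \<in> hom C X (rdom R) \<Longrightarrow> sat (rel_dagger C R) b a \<longleftrightarrow> sat R a b"
    using rel(2) unfolding * by blast
qed

text \<open>
  A common element of the pullback is a pair of elements of the two relations with the same middle
  component \<open>b\<close>, so the image of the pullback consists of the \<open>(a, c)\<close> for which such a \<open>b\<close> exists on a
  cover.
\<close>

lemma rel_comp_sat:
  assumes R: "R \<in> relations C" and S: "S \<in> relations C" and RS: "rcod R = rdom S"
  shows "rel_comp C S R \<in> relations C" "rdom (rel_comp C S R) = rdom R" "rcod (rel_comp C S R) = rcod S"
    "a \<in> hom C X (rdom R) \<Longrightarrow> c \<in> hom C X (rcod S) \<Longrightarrow> sat (rel_comp C S R) a c \<longleftrightarrow>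
      (\<exists>Y e b. e \<in> hom C Y X \<and> regular_epi C e \<and> b \<in> hom C Y (rdom S) \<and> sat R (a \<cdot> e) b \<and> sat S b (c \<cdot> e))"
proof -
  let ?\<S> = "{image_subobject C (pair C (leg1 C R r \<cdot> p) (leg2 C S s \<cdot> q)) | r s p q.
         r \<in> rsub R \<and> s \<in> rsub S \<and> is_pullback C (leg2 C R r) (leg1 C S s) p q}"
  let ?P = "\<lambda>a c. \<exists>Y e b. e \<in> hom C Y (Dom C a) \<and> regular_epi C e \<and> b \<in> hom C Y (rdom S) \<and>
    sat R (a \<cdot> e) b \<and> sat S b (c \<cdot> e)"
  have *: "rel_comp C S R = Relation (rdom R) (rcod S) (\<Union>?\<S>)"
    by (simp add: rel_comp_def)
  have ne: "?\<S> \<noteq> {}"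
  proof -
    obtain r s where r: "r \<in> rsub R" and s: "s \<in> rsub S" using R S rsub_nonempty by blast
    have "is_pullback C (leg2 C R r) (leg1 C S s) (pb1 C (leg2 C R r) (leg1 C S s)) (pb2 C (leg2 C R r) (leg1 C S s))"
      using leg_simps(2)[OF R r] leg_simps(1)[OF S s] RS by (intro is_pullback_pb) (simp_all add: hom_def)
    then show ?thesis using r s by blast
  qed
  have M: "\<forall>T \<in> ?\<S>. \<exists>m. monic C m \<and> Cod C m = prd C (rdom R) (rcod S) \<and> T = subobject C m \<and>
      (\<forall>X. \<forall>a \<in> hom C X (rdom R). \<forall>c \<in> hom C X (rcod S). factors m (pair C a c) \<longleftrightarrow> ?P a c)"
  proof
    fix T assume TS: "T \<in> ?\<S>"
    obtain r s p q where r: "r \<in> rsub R" and s: "s \<in> rsub S"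
      and pq: "is_pullback C (leg2 C R r) (leg1 C S s) p q"
      and T: "T = image_subobject C (pair C (leg1 C R r \<cdot> p) (leg2 C S s \<cdot> q))"
      using TS by blast
    note l = leg_simps[OF R r] and k = leg_simps[OF S s]
    have p: "p \<in> hom C (Dom C p) (Dom C r)" and q: "q \<in> hom C (Dom C p) (Dom C s)"
      and com: "leg2 C R r \<cdot> p = leg1 C S s \<cdot> q"
      using pq homD(2)[OF l(2)] homD(2)[OF k(1)] unfolding is_pullback_def by simp_all
    have univ: "\<exists>h \<in> hom C X (Dom C p). p \<cdot> h = x \<and> q \<cdot> h = y"
      if "x \<in> hom C X (Dom C r)" "y \<in> hom C X (Dom C s)" "leg2 C R r \<cdot> x = leg1 C S s \<cdot> y" for X x y
      using pq that homD(2)[OF l(2)] homD(2)[OF k(1)] unfolding is_pullback_def by metis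
    let ?f = "leg1 C R r \<cdot> p" and ?g = "leg2 C S s \<cdot> q"
    have f: "?f \<in> hom C (Dom C p) (rdom R)" and g: "?g \<in> hom C (Dom C p) (rcod S)"
      using l(1) k(2) p q by (simp_all add: hom_def)
    have fg: "pair C ?f ?g \<in> Arr C" "Dom C (pair C ?f ?g) = Dom C p" "Cod C (pair C ?f ?g) = prd C (rdom R) (rcod S)"
      using homD[OF f] homD[OF g] by simp_all
    obtain m e0 where "monic C m" "e0 \<in> hom C (Dom C (pair C ?f ?g)) (Dom C m)" "regular_epi C e0" "m \<cdot> e0 = pair C ?f ?g"
      using image_factorization[OF fg(1)] by blast
    then have m: "monic C m" "m \<in> image_subobject C (pair C ?f ?g)"
      unfolding image_subobject_def by blast+
    show "\<exists>m. monic C m \<and> Cod C m = prd C (rdom R) (rcod S) \<and> T = subobject C m \<and>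
      (\<forall>X. \<forall>a \<in> hom C X (rdom R). \<forall>c \<in> hom C X (rcod S). factors m (pair C a c) \<longleftrightarrow> ?P a c)"
    proof (intro exI conjI allI ballI)
      show "monic C m" by fact
      show "Cod C m = prd C (rdom R) (rcod S)" using image_subobject_Cod[OF m(2)] fg(3) by simp
      show "T = subobject C m" unfolding T by (rule image_subobject_eq[OF m(2)])
      fix X a c assume a: "a \<in> hom C X (rdom R)" and c: "c \<in> hom C X (rcod S)"
      have ac: "pair C a c \<in> hom C X (Cod C (pair C ?f ?g))" using a c fg(3) by (simp add: hom_def)
      have "(\<exists>j \<in> hom C Y (Dom C p). pair C ?f ?g \<cdot> j = pair C a c \<cdot> e) \<longleftrightarrow>
         (\<exists>b \<in> hom C Y (rdom S). sat R (a \<cdot> e) b \<and> sat S b (c \<cdot> e))"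
        if e: "e \<in> hom C Y X" for e Y
      proof -
        have ae: "a \<cdot> e \<in> hom C Y (rdom R)" and ce: "c \<cdot> e \<in> hom C Y (rcod S)"
          using a c e by (simp_all add: hom_def)
        have "pair C ?f ?g \<cdot> j = pair C a c \<cdot> e \<longleftrightarrow>
            leg1 C R r \<cdot> (p \<cdot> j) = a \<cdot> e \<and> leg2 C S s \<cdot> (q \<cdot> j) = c \<cdot> e" if "j \<in> hom C Y (Dom C p)" for j
          using that f g a c e l(1) k(2) p q by (simp add: hom_def)
        then have "(\<exists>j \<in> hom C Y (Dom C p). pair C ?f ?g \<cdot> j = pair C a c \<cdot> e) \<longleftrightarrow>
           (\<exists>j \<in> hom C Y (Dom C p). leg1 C R r \<cdot> (p \<cdot> j) = a \<cdot> e \<and> leg2 C S s \<cdot> (q \<cdot> j) = c \<cdot> e)"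
          by blast
        also have "\<dots> \<longleftrightarrow> (\<exists>b \<in> hom C Y (rdom S). sat R (a \<cdot> e) b \<and> sat S b (c \<cdot> e))"
        proof
          assume "\<exists>j \<in> hom C Y (Dom C p). leg1 C R r \<cdot> (p \<cdot> j) = a \<cdot> e \<and> leg2 C S s \<cdot> (q \<cdot> j) = c \<cdot> e"
          then obtain j where j: "j \<in> hom C Y (Dom C p)"
            "leg1 C R r \<cdot> (p \<cdot> j) = a \<cdot> e" "leg2 C S s \<cdot> (q \<cdot> j) = c \<cdot> e" by blast
          let ?b = "leg1 C S s \<cdot> (q \<cdot> j)"
          have b: "?b \<in> hom C Y (rdom S)" and b': "?b \<in> hom C Y (rcod R)"
            and pj: "p \<cdot> j \<in> hom C Y (Dom C r)" and qj: "q \<cdot> j \<in> hom C Y (Dom C s)"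
            using j(1) k(1) p q RS by (simp_all add: hom_def)
          have "leg2 C R r \<cdot> (p \<cdot> j) = (leg1 C S s \<cdot> q) \<cdot> j"
            using Comp_reassoc[OF com] j(1) p l(2) by (simp add: hom_def)
          also have "\<dots> = ?b" using j(1) q k(1) by (simp add: hom_def)
          finally have "sat R (a \<cdot> e) ?b" "sat S ?b (c \<cdot> e)"
            using sat_legs_iff[OF R r ae b'] sat_legs_iff[OF S s b ce] pj qj j by blast+
          then show "\<exists>b \<in> hom C Y (rdom S). sat R (a \<cdot> e) b \<and> sat S b (c \<cdot> e)" using b by blast
        next
          assume "\<exists>b \<in> hom C Y (rdom S). sat R (a \<cdot> e) b \<and> sat S b (c \<cdot> e)"
          then obtain b where b: "b \<in> hom C Y (rdom S)" "sat R (a \<cdot> e) b" "sat S b (c \<cdot> e)" by blast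
          then have b': "b \<in> hom C Y (rcod R)" using RS by simp
          obtain x y where x: "x \<in> hom C Y (Dom C r)" "leg1 C R r \<cdot> x = a \<cdot> e" "leg2 C R r \<cdot> x = b"
            and y: "y \<in> hom C Y (Dom C s)" "leg1 C S s \<cdot> y = b" "leg2 C S s \<cdot> y = c \<cdot> e"
            using b sat_legs_iff[OF R r ae b'] sat_legs_iff[OF S s b(1) ce] by blast
          then show "\<exists>j \<in> hom C Y (Dom C p). leg1 C R r \<cdot> (p \<cdot> j) = a \<cdot> e \<and> leg2 C S s \<cdot> (q \<cdot> j) = c \<cdot> e"
            using univ[OF x(1) y(1)] by metis
        qed
        finally show ?thesis .
      qed
      then show "factors m (pair C a c) \<longleftrightarrow> ?P a c"
        unfolding image_factors_iff[OF m(2) ac] fg(2) homD(2)[OF a] by blast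
    qed
  qed
  note rel = relation_of_subobjects[OF ne relationsD(1)[OF R] relationsD(2)[OF S], where P = ?P, OF M]
  show "rel_comp C S R \<in> relations C" "rdom (rel_comp C S R) = rdom R" "rcod (rel_comp C S R) = rcod S"
    using rel(1) unfolding * by simp_all
  show "sat (rel_comp C S R) a c \<longleftrightarrow>
      (\<exists>Y e b. e \<in> hom C Y X \<and> regular_epi C e \<and> b \<in> hom C Y (rdom S) \<and> sat R (a \<cdot> e) b \<and> sat S b (c \<cdot> e))"
    if a: "a \<in> hom C X (rdom R)" and c: "c \<in> hom C X (rcod S)"
    using rel(2)[OF a c] unfolding * homD(2)[OF a] by blast
qed

text \<open>
  The tensor product is represented by the product of the two representing monomorphisms, whose
  elements are pairs.
\<close>

lemma rel_tensor_sat: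
  assumes R: "R \<in> relations C" and S: "S \<in> relations C"
  shows "rel_tensor C R S \<in> relations C" "rdom (rel_tensor C R S) = prd C (rdom R) (rdom S)"
    "rcod (rel_tensor C R S) = prd C (rcod R) (rcod S)"
    "a \<in> hom C X (rdom R) \<Longrightarrow> b \<in> hom C X (rdom S) \<Longrightarrow> c \<in> hom C X (rcod R) \<Longrightarrow> d \<in> hom C X (rcod S) \<Longrightarrow>
      sat (rel_tensor C R S) (pair C a b) (pair C c d) \<longleftrightarrow> sat R a c \<and> sat S b d"
proof -
  note RO = relationsD[OF R] and SO = relationsD[OF S]
  let ?p = "\<lambda>r s. pr1 C (Dom C r) (Dom C s)" and ?q = "\<lambda>r s. pr2 C (Dom C r) (Dom C s)"
  let ?f = "\<lambda>r s. pair C (leg1 C R r \<cdot> ?p r s) (leg1 C S s \<cdot> ?q r s)"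
  let ?g = "\<lambda>r s. pair C (leg2 C R r \<cdot> ?p r s) (leg2 C S s \<cdot> ?q r s)"
  let ?\<S> = "(\<lambda>(r, s). subobject C (pair C (?f r s) (?g r s))) ` (rsub R \<times> rsub S)"
  let ?A = "prd C (rdom R) (rdom S)" and ?B = "prd C (rcod R) (rcod S)"
  let ?P = "\<lambda>z w. sat R (pr1 C (rdom R) (rdom S) \<cdot> z) (pr1 C (rcod R) (rcod S) \<cdot> w) \<and>
                  sat S (pr2 C (rdom R) (rdom S) \<cdot> z) (pr2 C (rcod R) (rcod S) \<cdot> w)"
  have *: "rel_tensor C R S = Relation ?A ?B (\<Union>?\<S>)"
    unfolding rel_tensor_def Let_def by (simp add: Sigma_def UN_UN_flatten)
  have M: "\<forall>T \<in> ?\<S>. \<exists>m. monic C m \<and> Cod C m = prd C ?A ?B \<and> T = subobject C m \<and>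
      (\<forall>X. \<forall>z \<in> hom C X ?A. \<forall>w \<in> hom C X ?B. factors m (pair C z w) \<longleftrightarrow> ?P z w)"
  proof
    fix T assume TS: "T \<in> ?\<S>"
    obtain r s where r: "r \<in> rsub R" and s: "s \<in> rsub S" and T: "T = subobject C (pair C (?f r s) (?g r s))"
      using TS by auto
    note l = leg_simps[OF R r] and k = leg_simps[OF S s]
    let ?W = "prd C (Dom C r) (Dom C s)"
    have O: "Dom C r \<in> Obj C" "Dom C s \<in> Obj C" using l(1) k(1) homD(4) by blast+
    have f: "?f r s \<in> hom C ?W ?A" and g: "?g r s \<in> hom C ?W ?B"
      using l(1,2) k(1,2) O by (simp_all add: hom_def)
    have eqs: "?f r s \<cdot> pair C x y = pair C (leg1 C R r \<cdot> x) (leg1 C S s \<cdot> y)"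
      "?g r s \<cdot> pair C x y = pair C (leg2 C R r \<cdot> x) (leg2 C S s \<cdot> y)"
      if "x \<in> hom C X (Dom C r)" "y \<in> hom C X (Dom C s)" for x y X
      using that l(1,2) k(1,2) O by (simp_all add: hom_def)
    show "\<exists>m. monic C m \<and> Cod C m = prd C ?A ?B \<and> T = subobject C m \<and>
      (\<forall>X. \<forall>z \<in> hom C X ?A. \<forall>w \<in> hom C X ?B. factors m (pair C z w) \<longleftrightarrow> ?P z w)"
    proof (intro exI conjI)
      show "monic C (pair C (?f r s) (?g r s))"
      proof (rule monic_pairI[OF f g])
        fix X u v assume uv: "u \<in> hom C X ?W" "v \<in> hom C X ?W" "?f r s \<cdot> u = ?f r s \<cdot> v" "?g r s \<cdot> u = ?g r s \<cdot> v"
        have "\<forall>h \<in> hom C X ?W. \<forall>h' \<in> hom C X ?W. ?f r s \<cdot> h = ?f r s \<cdot> h' \<longrightarrow> ?g r s \<cdot> h = ?g r s \<cdot> h' \<longrightarrow> h = h'"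
          unfolding all_prd[OF O]
        proof (intro ballI impI)
          fix x y x' y'
          assume xy: "x \<in> hom C X (Dom C r)" "y \<in> hom C X (Dom C s)"
            and xy': "x' \<in> hom C X (Dom C r)" "y' \<in> hom C X (Dom C s)"
            and eq: "?f r s \<cdot> pair C x y = ?f r s \<cdot> pair C x' y'" "?g r s \<cdot> pair C x y = ?g r s \<cdot> pair C x' y'"
          have "leg1 C R r \<cdot> x = leg1 C R r \<cdot> x'" "leg2 C R r \<cdot> x = leg2 C R r \<cdot> x'"
            "leg1 C S s \<cdot> y = leg1 C S s \<cdot> y'" "leg2 C S s \<cdot> y = leg2 C S s \<cdot> y'"
            using eq xy xy' l(1,2) k(1,2) unfolding eqs[OF xy] eqs[OF xy'] by (simp_all add: hom_def)
          then have "x = x'" "y = y'"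
            using legs_jointly_monic[OF R r xy(1) xy'(1)] legs_jointly_monic[OF S s xy(2) xy'(2)] by blast+
          then show "pair C x y = pair C x' y'" by simp
        qed
        then show "u = v" using uv by blast
      qed
      show "Cod C (pair C (?f r s) (?g r s)) = prd C ?A ?B" using f g by (simp add: hom_def)
      show "T = subobject C (pair C (?f r s) (?g r s))" by fact
      show "\<forall>X. \<forall>z \<in> hom C X ?A. \<forall>w \<in> hom C X ?B. factors (pair C (?f r s) (?g r s)) (pair C z w) \<longleftrightarrow> ?P z w"
        unfolding all_prd[OF RO(1) SO(1)] all_prd[OF RO(2) SO(2)]
      proof (intro allI ballI)
        fix X a b c d
        assume a: "a \<in> hom C X (rdom R)" and b: "b \<in> hom C X (rdom S)"
          and c: "c \<in> hom C X (rcod R)" and d: "d \<in> hom C X (rcod S)"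
        have "factors (pair C (?f r s) (?g r s)) (pair C (pair C a b) (pair C c d)) \<longleftrightarrow>
           (\<exists>h. h \<in> hom C X ?W \<and> ?f r s \<cdot> h = pair C a b \<and> ?g r s \<cdot> h = pair C c d)"
          using factors_pair_iff[OF f g pair_hom[OF a b] pair_hom[OF c d]] by blast
        also have "\<dots> \<longleftrightarrow> (\<exists>x y. x \<in> hom C X (Dom C r) \<and> y \<in> hom C X (Dom C s) \<and>
             (leg1 C R r \<cdot> x = a \<and> leg2 C R r \<cdot> x = c) \<and> (leg1 C S s \<cdot> y = b \<and> leg2 C S s \<cdot> y = d))"
          unfolding ex_prd[OF O]
        proof (intro ex_cong1 conj_cong[OF refl])
          fix x y assume x: "x \<in> hom C X (Dom C r)" and y: "y \<in> hom C X (Dom C s)"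
          show "(?f r s \<cdot> pair C x y = pair C a b \<and> ?g r s \<cdot> pair C x y = pair C c d) \<longleftrightarrow>
             (leg1 C R r \<cdot> x = a \<and> leg2 C R r \<cdot> x = c) \<and> (leg1 C S s \<cdot> y = b \<and> leg2 C S s \<cdot> y = d)"
            unfolding eqs[OF x y] using x y a b c d l(1,2) k(1,2) by (auto simp: hom_def)
        qed
        also have "\<dots> \<longleftrightarrow> sat R a c \<and> sat S b d"
          unfolding sat_legs_iff[OF R r a c] sat_legs_iff[OF S s b d] by blast
        also have "\<dots> \<longleftrightarrow> ?P (pair C a b) (pair C c d)"
          using homD[OF a] homD[OF b] homD[OF c] homD[OF d] by simp
        finally show "factors (pair C (?f r s) (?g r s)) (pair C (pair C a b) (pair C c d)) \<longleftrightarrow> ?P (pair C a b) (pair C c d)" .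
      qed
    qed
  qed
  have ne: "?\<S> \<noteq> {}" using rsub_nonempty[OF R] rsub_nonempty[OF S] by auto
  have AB: "?A \<in> Obj C" "?B \<in> Obj C" using RO SO by simp_all
  note rel = relation_of_subobjects[OF ne AB, where P = ?P, OF M]
  show "rel_tensor C R S \<in> relations C" "rdom (rel_tensor C R S) = ?A" "rcod (rel_tensor C R S) = ?B"
    using rel(1) unfolding * by simp_all
  show "sat (rel_tensor C R S) (pair C a b) (pair C c d) \<longleftrightarrow> sat R a c \<and> sat S b d"
    if a: "a \<in> hom C X (rdom R)" and b: "b \<in> hom C X (rdom S)" and c: "c \<in> hom C X (rcod R)" and d: "d \<in> hom C X (rcod S)"
    using rel(2)[OF pair_hom[OF a b] pair_hom[OF c d]] unfolding *
    using homD[OF a] homD[OF b] homD[OF c] homD[OF d] by simp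
qed

text \<open>
  For composites with graphs the middle element is determined by the given ones, so no cover remains.
\<close>

lemma sat_comp_graph:
  assumes f: "f \<in> hom C A B" and S: "S \<in> relations C" "rdom S = B"
    and a: "a \<in> hom C X A" and c: "c \<in> hom C X (rcod S)"
  shows "sat (rel_comp C S (graph_rel C f)) a c \<longleftrightarrow> sat S (f \<cdot> a) c"
proof -
  note g = graph_rel_sat[OF f]
  have eq: "rcod (graph_rel C f) = rdom S" using g(3) S(2) by simp
  have a': "a \<in> hom C X (rdom (graph_rel C f))" using a g(2) by simp
  have fa: "f \<cdot> a \<in> hom C X (rdom S)" using f a S(2) by (simp add: hom_def)
  show ?thesis unfolding rel_comp_sat(4)[OF g(1) S(1) eq a' c]
  proof
    assume "\<exists>Y e b. e \<in> hom C Y X \<and> regular_epi C e \<and> b \<in> hom C Y (rdom S) \<and> sat (graph_rel C f) (a \<cdot> e) b \<and> sat S b (c \<cdot> e)"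
    then obtain Y e b where e: "e \<in> hom C Y X" "regular_epi C e" and b: "b \<in> hom C Y (rdom S)"
      "sat (graph_rel C f) (a \<cdot> e) b" "sat S b (c \<cdot> e)" by blast
    have "a \<cdot> e \<in> hom C Y A" using a e by (simp add: hom_def)
    then have "b = (f \<cdot> a) \<cdot> e" using g(4) b S(2) f a e by (simp add: hom_def)
    then show "sat S (f \<cdot> a) c" using sat_local[OF S(1) fa c e] b(3) by simp
  next
    assume "sat S (f \<cdot> a) c"
    moreover have "sat (graph_rel C f) a (f \<cdot> a)" using g(4)[OF a] fa S(2) by simp
    ultimately show "\<exists>Y e b. e \<in> hom C Y X \<and> regular_epi C e \<and> b \<in> hom C Y (rdom S) \<and> sat (graph_rel C f) (a \<cdot> e) b \<and> sat S b (c \<cdot> e)"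
      using fa a c homD[OF a] by (intro exI[of _ X] exI[of _ "Ident C X"] exI[of _ "f \<cdot> a"])
        (simp add: regular_epi_Ident Ident_in_hom homD(3)[OF c] homD(1,2)[OF c])
  qed
qed

lemma sat_graph_dagger_comp:
  assumes f: "f \<in> hom C A B" and S: "S \<in> relations C" "rcod S = B"
    and a: "a \<in> hom C X (rdom S)" and c: "c \<in> hom C X A"
  shows "sat (rel_comp C (rel_dagger C (graph_rel C f)) S) a c \<longleftrightarrow> sat S a (f \<cdot> c)"
proof -
  note g = graph_rel_sat[OF f]
  note d = rel_dagger_sat[OF g(1), unfolded g(2,3)]
  have eq: "rcod S = rdom (rel_dagger C (graph_rel C f))" using d(2) S(2) by simp
  have c': "c \<in> hom C X (rcod (rel_dagger C (graph_rel C f)))" using c d(3) by simp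
  have fc: "f \<cdot> c \<in> hom C X B" using f c by (simp add: hom_def)
  have fc': "f \<cdot> c \<in> hom C X (rcod S)" using fc S(2) by simp
  show ?thesis unfolding rel_comp_sat(4)[OF S(1) d(1) eq a c'] d(2)
  proof
    assume "\<exists>Y e b. e \<in> hom C Y X \<and> regular_epi C e \<and> b \<in> hom C Y B \<and> sat S (a \<cdot> e) b \<and> sat (rel_dagger C (graph_rel C f)) b (c \<cdot> e)"
    then obtain Y e b where e: "e \<in> hom C Y X" "regular_epi C e" and b: "b \<in> hom C Y B"
      "sat S (a \<cdot> e) b" "sat (rel_dagger C (graph_rel C f)) b (c \<cdot> e)" by blast
    have ce: "c \<cdot> e \<in> hom C Y A" using c e by (simp add: hom_def)
    then have "b = (f \<cdot> c) \<cdot> e" using d(4)[OF b(1) ce] g(4)[OF ce b(1)] b f c e by (simp add: hom_def)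
    then show "sat S a (f \<cdot> c)" using sat_local[OF S(1) a fc' e] b(2) by simp
  next
    assume "sat S a (f \<cdot> c)"
    moreover have "sat (rel_dagger C (graph_rel C f)) (f \<cdot> c) c" using g(4)[OF c fc] d(4)[OF fc c] by simp
    ultimately show "\<exists>Y e b. e \<in> hom C Y X \<and> regular_epi C e \<and> b \<in> hom C Y B \<and> sat S (a \<cdot> e) b \<and> sat (rel_dagger C (graph_rel C f)) b (c \<cdot> e)"
      using fc homD[OF a] by (intro exI[of _ X] exI[of _ "Ident C X"] exI[of _ "f \<cdot> c"])
        (simp add: regular_epi_Ident Ident_in_hom homD(3)[OF c] homD(1,2)[OF c])
  qed
qed

end

section \<open>Existence in the internal logic\<close>

context regular_category begin

definition multiplies :: "('a, 'b) relation \<Rightarrow> 'b \<Rightarrow> 'b \<Rightarrow> 'b \<Rightarrow> bool" where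
  "multiplies \<mu> a b c \<longleftrightarrow> sat \<mu> (pair C a b) c"

text \<open>
  The elements of the subobject given by a relation \<open>1 \<rightarrow> A\<close>.
\<close>

definition unit_element :: "('a, 'b) relation \<Rightarrow> 'b \<Rightarrow> bool" where
  "unit_element \<eta> x \<longleftrightarrow> sat \<eta> (bang C (Dom C x)) x"

text \<open>
  Kripke--Joyal semantics of \<open>\<exists>x \<in> A. Q x\<close> at stage \<open>X\<close>: there is a witness on some cover \<open>e\<close>.  The
  predicate receives the cover as well, along which the other elements must be restricted.
\<close>

definition internal_ex :: "'a \<Rightarrow> 'a \<Rightarrow> ('b \<Rightarrow> 'b \<Rightarrow> bool) \<Rightarrow> bool" where
  "internal_ex X A Q \<longleftrightarrow>
     (\<exists>Y e x. e \<in> hom C Y X \<and> regular_epi C e \<and> x \<in> hom C Y A \<and> Q e x)"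

lemma internal_exI:
  assumes "x \<in> hom C X A" "Q (Ident C X) x"
  shows "internal_ex X A Q"
  unfolding internal_ex_def using assms homD(4)[OF assms(1)] regular_epi_Ident Ident_in_hom by blast

lemma internal_exE:
  assumes "internal_ex X A Q"
  obtains Y e x where "e \<in> hom C Y X" "regular_epi C e" "x \<in> hom C Y A" "Q e x"
  using assms unfolding internal_ex_def by blast

lemma internal_ex_mono:
  assumes "internal_ex X A Q"
    and "\<And>Y e x. e \<in> hom C Y X \<Longrightarrow> x \<in> hom C Y A \<Longrightarrow> Q e x \<Longrightarrow> \<exists>x' \<in> hom C Y A. Q' e x'"
  shows "internal_ex X A Q'"
  using assms unfolding internal_ex_def by blast

lemma cover_cancel:
  assumes "e \<in> hom C Y X" "regular_epi C e" "x \<in> hom C X A" "y \<in> hom C X A" "x \<cdot> e = y \<cdot> e"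
  shows "x = y"
  using regular_epi_cancel[OF assms(2) _ _ assms(5)] assms(1,3,4) by (simp add: hom_def)

text \<open>
  A witness that exists on a cover and is unique exists globally: by uniqueness it takes equal values on
  elements identified by the cover, so it descends.
\<close>

lemma unique_choice:
  assumes ex: "internal_ex X A Q"
    and stable: "\<And>Y Z e x z. e \<in> hom C Y X \<Longrightarrow> x \<in> hom C Y A \<Longrightarrow> z \<in> hom C Z Y \<Longrightarrow> Q e x \<Longrightarrow> Q (e \<cdot> z) (x \<cdot> z)"
    and unique: "\<And>Y e x x'. e \<in> hom C Y X \<Longrightarrow> x \<in> hom C Y A \<Longrightarrow> x' \<in> hom C Y A \<Longrightarrow> Q e x \<Longrightarrow> Q e x' \<Longrightarrow> x = x'"
    and descends: "\<And>Y e x. e \<in> hom C Y X \<Longrightarrow> regular_epi C e \<Longrightarrow> x \<in> hom C X A \<Longrightarrow> Q e (x \<cdot> e) \<Longrightarrow> P x"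
  obtains x where "x \<in> hom C X A" "P x"
proof -
  obtain Y e x where e: "e \<in> hom C Y X" "regular_epi C e" and x: "x \<in> hom C Y A" "Q e x"
    using ex by (rule internal_exE)
  have x': "x \<in> hom C (Dom C e) A" using x e by (simp add: hom_def)
  obtain x0 where x0: "x0 \<in> hom C (Cod C e) A" "x0 \<cdot> e = x"
  proof (rule regular_epi_descend[OF e(2) x'])
    fix W y z assume y: "y \<in> hom C W (Dom C e)" and z: "z \<in> hom C W (Dom C e)" and yz: "e \<cdot> y = e \<cdot> z"
    have y': "y \<in> hom C W Y" and z': "z \<in> hom C W Y" using y z e by (simp_all add: hom_def)
    have ey: "e \<cdot> y \<in> hom C W X" "x \<cdot> y \<in> hom C W A" "x \<cdot> z \<in> hom C W A"
      using e x y' z' by (simp_all add: hom_def)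
    show "x \<cdot> y = x \<cdot> z"
      by (rule unique[OF ey]) (use stable[OF e(1) x(1) y' x(2)] stable[OF e(1) x(1) z' x(2)] yz in simp_all)
  qed
  have "x0 \<in> hom C X A" using x0 e by (simp add: hom_def)
  then show ?thesis using that descends[OF e, of x0] x0 x(2) by simp
qed

lemma sat_comp_prd:
  assumes R: "R \<in> relations C" and S: "S \<in> relations C" "rdom S = prd C A B" and RS: "rcod R = prd C A B"
    and AB: "A \<in> Obj C" "B \<in> Obj C"
    and a: "a \<in> hom C X (rdom R)" and c: "c \<in> hom C X (rcod S)"
  shows "sat (rel_comp C S R) a c \<longleftrightarrow>
    (\<exists>Y e x y. e \<in> hom C Y X \<and> regular_epi C e \<and> x \<in> hom C Y A \<and> y \<in> hom C Y B \<and>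
       sat R (a \<cdot> e) (pair C x y) \<and> sat S (pair C x y) (c \<cdot> e))"
proof -
  have eq: "rcod R = rdom S" using S(2) RS by simp
  show ?thesis
    unfolding rel_comp_sat(4)[OF R S(1) eq a c] S(2)
    using ex_prd[OF AB, where P = "\<lambda>b. sat R (a \<cdot> _) b \<and> sat S b (c \<cdot> _)"] by blast
qed

lemma prd_assoc_hom:
  assumes "A \<in> Obj C" "B \<in> Obj C" "D \<in> Obj C"
  shows "prd_assoc C A B D \<in> hom C (prd C (prd C A B) D) (prd C A (prd C B D))"
  using assms by (simp add: prd_assoc_def Let_def hom_def)

lemma prd_assoc_pair:
  assumes "a \<in> hom C X A" "b \<in> hom C X B" "d \<in> hom C X D"
  shows "prd_assoc C A B D \<cdot> pair C (pair C a b) d = pair C a (pair C b d)"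
  using assms homD(5)[OF assms(1)] homD(5)[OF assms(2)] homD(5)[OF assms(3)]
  by (simp add: prd_assoc_def Let_def hom_def)

text \<open>
  As the associativity isomorphism is injective on elements, the middle element \<open>((x, y), w)\<close> is
  determined by its value.
\<close>

lemma sat_prd_assoc_comp:
  assumes O: "A \<in> Obj C" "B \<in> Obj C" "D \<in> Obj C"
    and S: "S \<in> relations C" "rcod S = prd C (prd C A B) D"
    and z: "z \<in> hom C X (rdom S)" and x: "x \<in> hom C X A" "y \<in> hom C X B" "w \<in> hom C X D"
  shows "sat (rel_comp C (graph_rel C (prd_assoc C A B D)) S) z (pair C x (pair C y w)) \<longleftrightarrow>
    sat S z (pair C (pair C x y) w)"
proof -
  let ?f = "prd_assoc C A B D" and ?v = "pair C (pair C x y) w" and ?t = "pair C x (pair C y w)"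
  note f = prd_assoc_hom[OF O]
  note g = graph_rel_sat[OF f]
  have eq: "rcod S = rdom (graph_rel C ?f)" using g(2) S(2) by simp
  have t: "?t \<in> hom C X (prd C A (prd C B D))" and t': "?t \<in> hom C X (rcod (graph_rel C ?f))"
    and v: "?v \<in> hom C X (rcod S)" and v': "?v \<in> hom C X (prd C (prd C A B) D)"
    using x g(3) S(2) by (simp_all add: pair_hom)
  have O2: "prd C A B \<in> Obj C" using O by simp
  show ?thesis unfolding rel_comp_sat(4)[OF S(1) g(1) eq z t'] g(2)
  proof
    assume "\<exists>Y e b. e \<in> hom C Y X \<and> regular_epi C e \<and> b \<in> hom C Y (prd C (prd C A B) D) \<and> sat S (z \<cdot> e) b \<and>
       sat (graph_rel C ?f) b (?t \<cdot> e)"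
    then obtain Y e b where e: "e \<in> hom C Y X" "regular_epi C e" and b: "b \<in> hom C Y (prd C (prd C A B) D)"
      "sat S (z \<cdot> e) b" "sat (graph_rel C ?f) b (?t \<cdot> e)" by blast
    have te: "?t \<cdot> e \<in> hom C Y (prd C A (prd C B D))" using t e by (simp add: hom_def)
    have "\<forall>b \<in> hom C Y (prd C (prd C A B) D). ?f \<cdot> b = ?t \<cdot> e \<longrightarrow> b = ?v \<cdot> e"
      unfolding all_prd[OF O2 O(3)] all_prd[OF O(1,2)]
    proof (intro ballI impI)
      fix a b c assume a: "a \<in> hom C Y A" "b \<in> hom C Y B" "c \<in> hom C Y D"
        and "?f \<cdot> pair C (pair C a b) c = ?t \<cdot> e"
      then have "pair C a (pair C b c) = ?t \<cdot> e" using prd_assoc_pair[OF a] by simp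
      then have "a = x \<cdot> e \<and> b = y \<cdot> e \<and> c = w \<cdot> e" using a x e by (simp add: hom_def)
      then show "pair C (pair C a b) c = ?v \<cdot> e" using x e by (simp add: hom_def)
    qed
    then have "b = ?v \<cdot> e" using g(4)[OF b(1) te] b by blast
    then show "sat S z ?v" using sat_local[OF S(1) z v e] b(2) by simp
  next
    assume "sat S z ?v"
    moreover have "sat (graph_rel C ?f) ?v ?t" using g(4)[OF v' t] prd_assoc_pair[OF x] by simp
    ultimately show "\<exists>Y e b. e \<in> hom C Y X \<and> regular_epi C e \<and> b \<in> hom C Y (prd C (prd C A B) D) \<and> sat S (z \<cdot> e) b \<and>
       sat (graph_rel C ?f) b (?t \<cdot> e)"
      using v' homD[OF z] homD[OF t] by (intro exI[of _ X] exI[of _ "Ident C X"] exI[of _ ?v])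
        (simp add: regular_epi_Ident Ident_in_hom)
  qed
qed

end

section \<open>Frobenius structures on generalized elements\<close>

locale frobenius_data = regular_category C for C :: "('o, 'm, 'z) category_scheme" (structure) +
  fixes A :: 'o and \<mu> \<eta> :: "('o, 'm) relation"
  assumes A: "A \<in> Obj C"
    and \<mu>: "\<mu> \<in> relations C" "rdom \<mu> = prd C A A" "rcod \<mu> = A"
    and \<eta>: "\<eta> \<in> relations C" "rdom \<eta> = terminal_obj C" "rcod \<eta> = A"
begin

abbreviation "M \<equiv> multiplies \<mu>"
abbreviation "U \<equiv> unit_element \<eta>"

lemma M_Comp:
  assumes "a \<in> hom C X A" "b \<in> hom C X A" "c \<in> hom C X A" "y \<in> hom C Y X" "M a b c"
  shows "M (a \<cdot> y) (b \<cdot> y) (c \<cdot> y)"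
  using sat_Comp[OF \<mu>(1), unfolded \<mu>(2,3), OF pair_hom[OF assms(1,2)] assms(3,4)] assms
  unfolding multiplies_def by (simp add: hom_def)

lemma M_local:
  assumes "a \<in> hom C X A" "b \<in> hom C X A" "c \<in> hom C X A" "e \<in> hom C Y X" "regular_epi C e"
    "M (a \<cdot> e) (b \<cdot> e) (c \<cdot> e)"
  shows "M a b c"
  using sat_local[OF \<mu>(1), unfolded \<mu>(2,3), OF pair_hom[OF assms(1,2)] assms(3-5)] assms
  unfolding multiplies_def by (simp add: hom_def)

lemma bang_Comp: "e \<in> hom C Y X \<Longrightarrow> bang C X \<cdot> e = bang C Y"
  by (rule terminal_unique[of _ Y]) (auto dest: homD simp: hom_def Dom_in_Obj Cod_in_Obj)

lemma bang_hom: "X \<in> Obj C \<Longrightarrow> bang C X \<in> hom C X (terminal_obj C)"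
  by (simp add: hom_def)

lemma U_Comp:
  assumes "x \<in> hom C X A" "y \<in> hom C Y X" "U x"
  shows "U (x \<cdot> y)"
  using sat_Comp[OF \<eta>(1), unfolded \<eta>(2,3), OF bang_hom[OF homD(4)[OF assms(1)]] assms(1,2)] assms
    bang_Comp[OF assms(2)]
  unfolding unit_element_def by (simp add: hom_def)

lemma U_local:
  assumes "x \<in> hom C X A" "e \<in> hom C Y X" "regular_epi C e" "U (x \<cdot> e)"
  shows "U x"
  using sat_local[OF \<eta>(1), unfolded \<eta>(2,3), OF bang_hom[OF homD(4)[OF assms(1)]] assms(1-3)] assms
    bang_Comp[OF assms(2)]
  unfolding unit_element_def by (simp add: hom_def)

abbreviation "\<Delta> \<equiv> graph_rel C (Ident C A)"
abbreviation "\<alpha> \<equiv> graph_rel C (prd_assoc C A A A)"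

lemma id_sat:
  "\<Delta> \<in> relations C" "rdom \<Delta> = A" "rcod \<Delta> = A"
  "a \<in> hom C X A \<Longrightarrow> b \<in> hom C X A \<Longrightarrow> sat \<Delta> a b \<longleftrightarrow> a = b"
  using graph_rel_sat[OF Ident_in_hom[OF A]] by (simp_all add: hom_def)

lemmas dagger_sat = rel_dagger_sat[OF \<mu>(1), unfolded \<mu>(2,3)]

text \<open>
  This lemma and the following ones translate each composite relation that occurs in the definition of
  a special dagger Frobenius structure; where a tensor factor is an identity, the
  corresponding component of the intermediate element is determined and needs no quantifier.
\<close>

lemma right_unit_sat:
  assumes a: "a \<in> hom C X A" and c: "c \<in> hom C X A"
  shows "sat (rel_comp C \<mu> (rel_tensor C \<Delta> \<eta>)) (pair C a (bang C X)) c \<longleftrightarrow>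
    internal_ex X A (\<lambda>e x. U x \<and> M (a \<cdot> e) x (c \<cdot> e))"
proof -
  note t = rel_tensor_sat[OF id_sat(1) \<eta>(1), unfolded id_sat(2,3) \<eta>(2,3)]
  have z: "pair C a (bang C X) \<in> hom C X (rdom (rel_tensor C \<Delta> \<eta>))"
    unfolding t(2) by (intro pair_hom a bang_hom homD(4)[OF a])
  have c': "c \<in> hom C X (rcod \<mu>)" using c \<mu>(3) by simp
  have "sat (rel_tensor C \<Delta> \<eta>) (pair C a (bang C X) \<cdot> e) (pair C x y) \<longleftrightarrow> x = a \<cdot> e \<and> U y"
    if "e \<in> hom C Y X" "x \<in> hom C Y A" "y \<in> hom C Y A" for Y e x y
  proof -
    have "pair C a (bang C X) \<cdot> e = pair C (a \<cdot> e) (bang C Y)"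
      using a that homD(4)[OF a] bang_Comp[OF that(1)] by (simp add: hom_def)
    moreover have ae: "a \<cdot> e \<in> hom C Y A" using a that by (simp add: hom_def)
    ultimately show ?thesis
      using t(4)[OF ae bang_hom[OF homD(4)[OF that(2)]] that(2,3)] id_sat(4)[OF ae that(2)] homD(2)[OF that(3)]
      unfolding unit_element_def by auto
  qed
  moreover have "a \<cdot> e \<in> hom C Y A" if "e \<in> hom C Y X" for Y e using a that by (simp add: hom_def)
  ultimately show ?thesis
    unfolding sat_comp_prd[OF t(1) \<mu>(1,2) t(3) A A z c'] internal_ex_def multiplies_def by blast
qed

lemma left_unit_sat:
  assumes a: "a \<in> hom C X A" and c: "c \<in> hom C X A"
  shows "sat (rel_comp C \<mu> (rel_tensor C \<eta> \<Delta>)) (pair C (bang C X) a) c \<longleftrightarrow>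
    internal_ex X A (\<lambda>e x. U x \<and> M x (a \<cdot> e) (c \<cdot> e))"
proof -
  note t = rel_tensor_sat[OF \<eta>(1) id_sat(1), unfolded id_sat(2,3) \<eta>(2,3)]
  have z: "pair C (bang C X) a \<in> hom C X (rdom (rel_tensor C \<eta> \<Delta>))"
    unfolding t(2) by (intro pair_hom a bang_hom homD(4)[OF a])
  have c': "c \<in> hom C X (rcod \<mu>)" using c \<mu>(3) by simp
  have "sat (rel_tensor C \<eta> \<Delta>) (pair C (bang C X) a \<cdot> e) (pair C y x) \<longleftrightarrow> x = a \<cdot> e \<and> U y"
    if "e \<in> hom C Y X" "x \<in> hom C Y A" "y \<in> hom C Y A" for Y e x y
  proof -
    have "pair C (bang C X) a \<cdot> e = pair C (bang C Y) (a \<cdot> e)"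
      using a that homD(4)[OF a] bang_Comp[OF that(1)] by (simp add: hom_def)
    moreover have ae: "a \<cdot> e \<in> hom C Y A" using a that by (simp add: hom_def)
    ultimately show ?thesis
      using t(4)[OF bang_hom[OF homD(4)[OF that(2)]] ae that(3,2)] id_sat(4)[OF ae that(2)] homD(2)[OF that(3)]
      unfolding unit_element_def by auto
  qed
  moreover have "a \<cdot> e \<in> hom C Y A" if "e \<in> hom C Y X" for Y e using a that by (simp add: hom_def)
  ultimately show ?thesis
    unfolding sat_comp_prd[OF t(1) \<mu>(1,2) t(3) A A z c'] internal_ex_def multiplies_def by blast
qed

lemma assoc_left_sat:
  assumes a: "a \<in> hom C X A" and b: "b \<in> hom C X A" and c: "c \<in> hom C X A" and d: "d \<in> hom C X A"
  shows "sat (rel_comp C \<mu> (rel_tensor C \<mu> \<Delta>)) (pair C (pair C a b) c) d \<longleftrightarrow>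
    internal_ex X A (\<lambda>e x. M (a \<cdot> e) (b \<cdot> e) x \<and> M x (c \<cdot> e) (d \<cdot> e))"
proof -
  note t = rel_tensor_sat[OF \<mu>(1) id_sat(1), unfolded id_sat(2,3) \<mu>(2,3)]
  have z: "pair C (pair C a b) c \<in> hom C X (rdom (rel_tensor C \<mu> \<Delta>))"
    unfolding t(2) by (intro pair_hom a b c)
  have d': "d \<in> hom C X (rcod \<mu>)" using d \<mu>(3) by simp
  have "sat (rel_tensor C \<mu> \<Delta>) (pair C (pair C a b) c \<cdot> e) (pair C x y) \<longleftrightarrow>
      M (a \<cdot> e) (b \<cdot> e) x \<and> y = c \<cdot> e"
    if "e \<in> hom C Y X" "x \<in> hom C Y A" "y \<in> hom C Y A" for Y e x y
  proof -
    have "pair C (pair C a b) c \<cdot> e = pair C (pair C (a \<cdot> e) (b \<cdot> e)) (c \<cdot> e)"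
      using a b c that by (simp add: hom_def)
    moreover have ae: "a \<cdot> e \<in> hom C Y A" "b \<cdot> e \<in> hom C Y A" "c \<cdot> e \<in> hom C Y A"
      using a b c that by (simp_all add: hom_def)
    ultimately show ?thesis
      using t(4)[OF pair_hom[OF ae(1,2)] ae(3) that(2,3)] id_sat(4)[OF ae(3) that(3)]
      unfolding multiplies_def by auto
  qed
  moreover have "c \<cdot> e \<in> hom C Y A" if "e \<in> hom C Y X" for Y e using c that by (simp add: hom_def)
  ultimately show ?thesis
    unfolding sat_comp_prd[OF t(1) \<mu>(1,2) t(3) A A z d'] internal_ex_def multiplies_def by blast
qed

lemma assoc_right_sat:
  assumes a: "a \<in> hom C X A" and b: "b \<in> hom C X A" and c: "c \<in> hom C X A" and d: "d \<in> hom C X A"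
  shows "sat (rel_comp C \<mu> (rel_comp C (rel_tensor C \<Delta> \<mu>) \<alpha>))
      (pair C (pair C a b) c) d \<longleftrightarrow>
    internal_ex X A (\<lambda>e x. M (b \<cdot> e) (c \<cdot> e) x \<and> M (a \<cdot> e) x (d \<cdot> e))"
proof -
  note t = rel_tensor_sat[OF id_sat(1) \<mu>(1), unfolded id_sat(2,3) \<mu>(2,3)]
  note f = prd_assoc_hom[OF A A A]
  note g = graph_rel_sat[OF f]
  have gt: "rcod \<alpha> = rdom (rel_tensor C \<Delta> \<mu>)"
    using g(3) t(2) by simp
  note r = rel_comp_sat[OF g(1) t(1) gt, unfolded g(2) t(3)]
  have z: "pair C (pair C a b) c \<in> hom C X (rdom (rel_comp C (rel_tensor C \<Delta> \<mu>) \<alpha>))"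
    unfolding r(2) by (intro pair_hom a b c)
  have d': "d \<in> hom C X (rcod \<mu>)" using d \<mu>(3) by simp
  have "sat (rel_comp C (rel_tensor C \<Delta> \<mu>) \<alpha>)
      (pair C (pair C a b) c \<cdot> e) (pair C x y) \<longleftrightarrow> x = a \<cdot> e \<and> M (b \<cdot> e) (c \<cdot> e) y"
    if "e \<in> hom C Y X" "x \<in> hom C Y A" "y \<in> hom C Y A" for Y e x y
  proof -
    have "pair C (pair C a b) c \<cdot> e = pair C (pair C (a \<cdot> e) (b \<cdot> e)) (c \<cdot> e)"
      using a b c that by (simp add: hom_def)
    moreover have ae: "a \<cdot> e \<in> hom C Y A" "b \<cdot> e \<in> hom C Y A" "c \<cdot> e \<in> hom C Y A"
      using a b c that by (simp_all add: hom_def)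
    moreover have xy: "pair C x y \<in> hom C Y (rcod (rel_tensor C \<Delta> \<mu>))"
      unfolding t(3) using that by (simp add: pair_hom)
    ultimately show ?thesis
      using t(4)[OF ae(1) pair_hom[OF ae(2,3)] that(2,3)] id_sat(4)[OF ae(1) that(2)]
        sat_comp_graph[OF f t(1,2) pair_hom[OF pair_hom[OF ae(1,2)] ae(3)] xy] prd_assoc_pair[OF ae]
      unfolding multiplies_def by auto
  qed
  moreover have "a \<cdot> e \<in> hom C Y A" if "e \<in> hom C Y X" for Y e using a that by (simp add: hom_def)
  ultimately show ?thesis
    unfolding sat_comp_prd[OF r(1) \<mu>(1,2) r(3) A A z d'] internal_ex_def multiplies_def by blast
qed

lemma special_sat:
  assumes c: "c \<in> hom C X A" and d: "d \<in> hom C X A"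
  shows "sat (rel_comp C \<mu> (rel_dagger C \<mu>)) c d \<longleftrightarrow>
    (\<exists>Y e x y. e \<in> hom C Y X \<and> regular_epi C e \<and> x \<in> hom C Y A \<and> y \<in> hom C Y A \<and>
       M x y (c \<cdot> e) \<and> M x y (d \<cdot> e))"
proof -
  have c': "c \<in> hom C X (rdom (rel_dagger C \<mu>))" and d': "d \<in> hom C X (rcod \<mu>)"
    using c d \<mu>(3) dagger_sat(2) by simp_all
  have "sat (rel_dagger C \<mu>) (c \<cdot> e) (pair C x y) \<longleftrightarrow> M x y (c \<cdot> e)"
    if "e \<in> hom C Y X" "x \<in> hom C Y A" "y \<in> hom C Y A" for Y e x y
  proof -
    have ce: "c \<cdot> e \<in> hom C Y A" using c that by (simp add: hom_def)
    show ?thesis unfolding multiplies_def by (rule dagger_sat(4)[OF ce pair_hom[OF that(2,3)]])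
  qed
  then show ?thesis
    unfolding sat_comp_prd[OF dagger_sat(1) \<mu>(1,2) dagger_sat(3) A A c' d'] multiplies_def by blast
qed

lemma frobenius_left_sat:
  assumes a: "a \<in> hom C X A" and b: "b \<in> hom C X A" and c: "c \<in> hom C X A" and d: "d \<in> hom C X A"
  shows "sat (rel_comp C (rel_tensor C \<mu> \<Delta>)
      (rel_comp C (rel_dagger C \<alpha>) (rel_tensor C \<Delta> (rel_dagger C \<mu>))))
      (pair C a b) (pair C c d) \<longleftrightarrow>
    internal_ex X A (\<lambda>e x. M x (d \<cdot> e) (b \<cdot> e) \<and> M (a \<cdot> e) x (c \<cdot> e))"
proof -
  note t = rel_tensor_sat[OF \<mu>(1) id_sat(1), unfolded id_sat(2,3) \<mu>(2,3)]
  note w = rel_tensor_sat[OF id_sat(1) dagger_sat(1), unfolded id_sat(2,3) dagger_sat(2,3)]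
  note f = prd_assoc_hom[OF A A A]
  note g = graph_rel_sat[OF f]
  note h = rel_dagger_sat[OF g(1), unfolded g(2,3)]
  have wh: "rcod (rel_tensor C \<Delta> (rel_dagger C \<mu>)) = rdom (rel_dagger C \<alpha>)"
    using w(3) h(2) by simp
  note r = rel_comp_sat[OF w(1) h(1) wh, unfolded w(2) h(3)]
  let ?R = "rel_comp C (rel_dagger C \<alpha>) (rel_tensor C \<Delta> (rel_dagger C \<mu>))"
  have z: "pair C a b \<in> hom C X (rdom ?R)"
    unfolding r(2) by (intro pair_hom a b)
  have cd: "pair C c d \<in> hom C X (rcod (rel_tensor C \<mu> \<Delta>))"
    unfolding t(3) by (intro pair_hom c d)
  have AA: "prd C A A \<in> Obj C" using A by simp
  have R: "sat ?R (pair C a b \<cdot> e) (pair C (pair C x y) v) \<longleftrightarrow> x = a \<cdot> e \<and> M y v (b \<cdot> e)"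
    and S: "sat (rel_tensor C \<mu> \<Delta>) (pair C (pair C x y) v) (pair C c d \<cdot> e) \<longleftrightarrow>
        M x y (c \<cdot> e) \<and> v = d \<cdot> e"
    if e: "e \<in> hom C Y X" and x: "x \<in> hom C Y A" "y \<in> hom C Y A" "v \<in> hom C Y A" for Y e x y v
  proof -
    have eqs: "pair C a b \<cdot> e = pair C (a \<cdot> e) (b \<cdot> e)" "pair C c d \<cdot> e = pair C (c \<cdot> e) (d \<cdot> e)"
      using a b c d e by (simp_all add: hom_def)
    have ae: "a \<cdot> e \<in> hom C Y A" "b \<cdot> e \<in> hom C Y A" "c \<cdot> e \<in> hom C Y A" "d \<cdot> e \<in> hom C Y A"
      using a b c d e by (simp_all add: hom_def)
    have ab: "pair C (a \<cdot> e) (b \<cdot> e) \<in> hom C Y (rdom (rel_tensor C \<Delta> (rel_dagger C \<mu>)))"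
      unfolding w(2) by (intro pair_hom ae)
    show "sat ?R (pair C a b \<cdot> e) (pair C (pair C x y) v) \<longleftrightarrow> x = a \<cdot> e \<and> M y v (b \<cdot> e)"
      unfolding eqs sat_graph_dagger_comp[OF f w(1,3) ab pair_hom[OF pair_hom[OF x(1,2)] x(3)]]
        prd_assoc_pair[OF x] w(4)[OF ae(1,2) x(1) pair_hom[OF x(2,3)]] id_sat(4)[OF ae(1) x(1)]
        dagger_sat(4)[OF ae(2) pair_hom[OF x(2,3)]] multiplies_def by auto
    show "sat (rel_tensor C \<mu> \<Delta>) (pair C (pair C x y) v) (pair C c d \<cdot> e) \<longleftrightarrow>
        M x y (c \<cdot> e) \<and> v = d \<cdot> e"
      unfolding eqs t(4)[OF pair_hom[OF x(1,2)] x(3) ae(3,4)] id_sat(4)[OF x(3) ae(4)] multiplies_def ..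
  qed
  have hm: "a \<cdot> e \<in> hom C Y A" "d \<cdot> e \<in> hom C Y A" if "e \<in> hom C Y X" for Y e
    using a d that by (simp_all add: hom_def)
  have "sat (rel_comp C (rel_tensor C \<mu> \<Delta>) ?R) (pair C a b) (pair C c d) \<longleftrightarrow>
    (\<exists>Y e. e \<in> hom C Y X \<and> regular_epi C e \<and> (\<exists>z. z \<in> hom C Y (prd C A A) \<and>
      (\<exists>v. v \<in> hom C Y A \<and> sat ?R (pair C a b \<cdot> e) (pair C z v) \<and>
         sat (rel_tensor C \<mu> \<Delta>) (pair C z v) (pair C c d \<cdot> e))))"
    unfolding sat_comp_prd[OF r(1) t(1,2) r(3) AA A z cd] by blast
  also have "\<dots> \<longleftrightarrow> (\<exists>Y e. e \<in> hom C Y X \<and> regular_epi C e \<and> (\<exists>x y v. x \<in> hom C Y A \<and> y \<in> hom C Y A \<and> v \<in> hom C Y A \<and>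
      sat ?R (pair C a b \<cdot> e) (pair C (pair C x y) v) \<and>
         sat (rel_tensor C \<mu> \<Delta>) (pair C (pair C x y) v) (pair C c d \<cdot> e)))"
    unfolding ex_prd[OF A A] by blast
  also have "\<dots> \<longleftrightarrow> (\<exists>Y e. e \<in> hom C Y X \<and> regular_epi C e \<and> (\<exists>x y v. x \<in> hom C Y A \<and> y \<in> hom C Y A \<and> v \<in> hom C Y A \<and>
      (x = a \<cdot> e \<and> M y v (b \<cdot> e)) \<and> M x y (c \<cdot> e) \<and> v = d \<cdot> e))"
    using R S by (intro ex_cong1 conj_cong[OF refl]) blast
  also have "\<dots> \<longleftrightarrow> internal_ex X A (\<lambda>e x. M x (d \<cdot> e) (b \<cdot> e) \<and> M (a \<cdot> e) x (c \<cdot> e))"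
    unfolding internal_ex_def using hm by blast
  finally show ?thesis .
qed

lemma frobenius_right_sat:
  assumes a: "a \<in> hom C X A" and b: "b \<in> hom C X A" and c: "c \<in> hom C X A" and d: "d \<in> hom C X A"
  shows "sat (rel_comp C (rel_tensor C \<Delta> \<mu>)
      (rel_comp C \<alpha> (rel_tensor C (rel_dagger C \<mu>) \<Delta>)))
      (pair C a b) (pair C c d) \<longleftrightarrow>
    internal_ex X A (\<lambda>e y. M (c \<cdot> e) y (a \<cdot> e) \<and> M y (b \<cdot> e) (d \<cdot> e))"
proof -
  note t = rel_tensor_sat[OF id_sat(1) \<mu>(1), unfolded id_sat(2,3) \<mu>(2,3)]
  note w = rel_tensor_sat[OF dagger_sat(1) id_sat(1), unfolded id_sat(2,3) dagger_sat(2,3)]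
  note f = prd_assoc_hom[OF A A A]
  note g = graph_rel_sat[OF f]
  have wg: "rcod (rel_tensor C (rel_dagger C \<mu>) \<Delta>) = rdom \<alpha>"
    using w(3) g(2) by simp
  note r = rel_comp_sat[OF w(1) g(1) wg, unfolded w(2) g(3)]
  let ?R = "rel_comp C \<alpha> (rel_tensor C (rel_dagger C \<mu>) \<Delta>)"
  have z: "pair C a b \<in> hom C X (rdom ?R)"
    unfolding r(2) by (intro pair_hom a b)
  have cd: "pair C c d \<in> hom C X (rcod (rel_tensor C \<Delta> \<mu>))"
    unfolding t(3) by (intro pair_hom c d)
  have AA: "prd C A A \<in> Obj C" using A by simp
  have R: "sat ?R (pair C a b \<cdot> e) (pair C x (pair C y v)) \<longleftrightarrow> M x y (a \<cdot> e) \<and> v = b \<cdot> e"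
    and S: "sat (rel_tensor C \<Delta> \<mu>) (pair C x (pair C y v)) (pair C c d \<cdot> e) \<longleftrightarrow>
        x = c \<cdot> e \<and> M y v (d \<cdot> e)"
    if e: "e \<in> hom C Y X" and x: "x \<in> hom C Y A" "y \<in> hom C Y A" "v \<in> hom C Y A" for Y e x y v
  proof -
    have eqs: "pair C a b \<cdot> e = pair C (a \<cdot> e) (b \<cdot> e)" "pair C c d \<cdot> e = pair C (c \<cdot> e) (d \<cdot> e)"
      using a b c d e by (simp_all add: hom_def)
    have ae: "a \<cdot> e \<in> hom C Y A" "b \<cdot> e \<in> hom C Y A" "c \<cdot> e \<in> hom C Y A" "d \<cdot> e \<in> hom C Y A"
      using a b c d e by (simp_all add: hom_def)
    have ab: "pair C (a \<cdot> e) (b \<cdot> e) \<in> hom C Y (rdom (rel_tensor C (rel_dagger C \<mu>) \<Delta>))"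
      unfolding w(2) by (intro pair_hom ae)
    show "sat ?R (pair C a b \<cdot> e) (pair C x (pair C y v)) \<longleftrightarrow> M x y (a \<cdot> e) \<and> v = b \<cdot> e"
      unfolding eqs sat_prd_assoc_comp[OF A A A w(1,3) ab x]
        w(4)[OF ae(1,2) pair_hom[OF x(1,2)] x(3)] id_sat(4)[OF ae(2) x(3)]
        dagger_sat(4)[OF ae(1) pair_hom[OF x(1,2)]] multiplies_def by auto
    show "sat (rel_tensor C \<Delta> \<mu>) (pair C x (pair C y v)) (pair C c d \<cdot> e) \<longleftrightarrow>
        x = c \<cdot> e \<and> M y v (d \<cdot> e)"
      unfolding eqs t(4)[OF x(1) pair_hom[OF x(2,3)] ae(3,4)] id_sat(4)[OF x(1) ae(3)] multiplies_def ..
  qed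
  have hm: "b \<cdot> e \<in> hom C Y A" "c \<cdot> e \<in> hom C Y A" if "e \<in> hom C Y X" for Y e
    using b c that by (simp_all add: hom_def)
  have "sat (rel_comp C (rel_tensor C \<Delta> \<mu>) ?R) (pair C a b) (pair C c d) \<longleftrightarrow>
    (\<exists>Y e. e \<in> hom C Y X \<and> regular_epi C e \<and> (\<exists>z. z \<in> hom C Y (prd C A A) \<and>
      (\<exists>x. x \<in> hom C Y A \<and> sat ?R (pair C a b \<cdot> e) (pair C x z) \<and>
         sat (rel_tensor C \<Delta> \<mu>) (pair C x z) (pair C c d \<cdot> e))))"
    unfolding sat_comp_prd[OF r(1) t(1,2) r(3) A AA z cd] by blast
  also have "\<dots> \<longleftrightarrow> (\<exists>Y e. e \<in> hom C Y X \<and> regular_epi C e \<and> (\<exists>y v x. x \<in> hom C Y A \<and> y \<in> hom C Y A \<and> v \<in> hom C Y A \<and>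
      sat ?R (pair C a b \<cdot> e) (pair C x (pair C y v)) \<and>
         sat (rel_tensor C \<Delta> \<mu>) (pair C x (pair C y v)) (pair C c d \<cdot> e)))"
    unfolding ex_prd[OF A A] by blast
  also have "\<dots> \<longleftrightarrow> (\<exists>Y e. e \<in> hom C Y X \<and> regular_epi C e \<and> (\<exists>y v x. x \<in> hom C Y A \<and> y \<in> hom C Y A \<and> v \<in> hom C Y A \<and>
      (M x y (a \<cdot> e) \<and> v = b \<cdot> e) \<and> x = c \<cdot> e \<and> M y v (d \<cdot> e)))"
    using R S by (intro ex_cong1 conj_cong[OF refl]) blast
  also have "\<dots> \<longleftrightarrow> internal_ex X A (\<lambda>e y. M (c \<cdot> e) y (a \<cdot> e) \<and> M y (b \<cdot> e) (d \<cdot> e))"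
    unfolding internal_ex_def using hm by blast
  finally show ?thesis .
qed

text \<open>
  The axioms, written in the internal logic: \<open>(\<exists>x. U x \<and> \<mu>(a, x, c)) \<longleftrightarrow> a = c\<close> and its mirror image,
  associativity in the form \<open>(\<exists>x. \<mu>(a, b, x) \<and> \<mu>(x, c, d)) \<longleftrightarrow> (\<exists>x. \<mu>(b, c, x) \<and> \<mu>(a, x, d))\<close>,
  speciality \<open>(\<exists>x y. \<mu>(x, y, c) \<and> \<mu>(x, y, d)) \<longleftrightarrow> c = d\<close>, and the Frobenius law
  \<open>(\<exists>x. \<mu>(x, d, b) \<and> \<mu>(a, x, c)) \<longleftrightarrow> (\<exists>y. \<mu>(c, y, a) \<and> \<mu>(y, b, d))\<close>.
\<close>

lemma special_dagger_frobenius_iff: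
  "special_dagger_frobenius (Rel C) A \<mu> \<eta> \<longleftrightarrow>
    (\<forall>X. \<forall>a \<in> hom C X A. \<forall>c \<in> hom C X A.
      internal_ex X A (\<lambda>e x. U x \<and> M (a \<cdot> e) x (c \<cdot> e)) \<longleftrightarrow> a = c) \<and>
    (\<forall>X. \<forall>a \<in> hom C X A. \<forall>c \<in> hom C X A.
      internal_ex X A (\<lambda>e x. U x \<and> M x (a \<cdot> e) (c \<cdot> e)) \<longleftrightarrow> a = c) \<and>
    (\<forall>X. \<forall>a \<in> hom C X A. \<forall>b \<in> hom C X A. \<forall>c \<in> hom C X A. \<forall>d \<in> hom C X A.
      internal_ex X A (\<lambda>e x. M (a \<cdot> e) (b \<cdot> e) x \<and> M x (c \<cdot> e) (d \<cdot> e)) \<longleftrightarrow>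
      internal_ex X A (\<lambda>e x. M (b \<cdot> e) (c \<cdot> e) x \<and> M (a \<cdot> e) x (d \<cdot> e))) \<and>
    (\<forall>X. \<forall>c \<in> hom C X A. \<forall>d \<in> hom C X A.
      (\<exists>Y e x y. e \<in> hom C Y X \<and> regular_epi C e \<and> x \<in> hom C Y A \<and> y \<in> hom C Y A \<and>
         M x y (c \<cdot> e) \<and> M x y (d \<cdot> e)) \<longleftrightarrow> c = d) \<and>
    (\<forall>X. \<forall>a \<in> hom C X A. \<forall>b \<in> hom C X A. \<forall>c \<in> hom C X A. \<forall>d \<in> hom C X A.
      internal_ex X A (\<lambda>e x. M x (d \<cdot> e) (b \<cdot> e) \<and> M (a \<cdot> e) x (c \<cdot> e)) \<longleftrightarrow>
      internal_ex X A (\<lambda>e y. M (c \<cdot> e) y (a \<cdot> e) \<and> M y (b \<cdot> e) (d \<cdot> e)))"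
proof -
  have AA: "prd C A A \<in> Obj C" and I: "terminal_obj C \<in> Obj C" using A by simp_all
  note f = prd_assoc_hom[OF A A A]
  note g = graph_rel_sat[OF f]
  note h = rel_dagger_sat[OF g(1), unfolded g(2,3)]
  note idm = rel_tensor_sat[OF id_sat(1) \<mu>(1), unfolded id_sat(2,3) \<mu>(2,3)]
  note mid = rel_tensor_sat[OF \<mu>(1) id_sat(1), unfolded id_sat(2,3) \<mu>(2,3)]
  note idd = rel_tensor_sat[OF id_sat(1) dagger_sat(1), unfolded id_sat(2,3) dagger_sat(2,3)]
  note did = rel_tensor_sat[OF dagger_sat(1) id_sat(1), unfolded id_sat(2,3) dagger_sat(2,3)]
  note ide = rel_tensor_sat[OF id_sat(1) \<eta>(1), unfolded id_sat(2,3) \<eta>(2,3)]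
  note eid = rel_tensor_sat[OF \<eta>(1) id_sat(1), unfolded id_sat(2,3) \<eta>(2,3)]
  have p1: "pr1 C A (terminal_obj C) \<in> hom C (prd C A (terminal_obj C)) A"
    and p2: "pr2 C (terminal_obj C) A \<in> hom C (prd C (terminal_obj C) A) A"
    using A by (simp_all add: hom_def)
  note ru = graph_rel_sat[OF p1] and lu = graph_rel_sat[OF p2]
  note facts = g(1-3) h(1-3) idm(1-3) mid(1-3) idd(1-3) did(1-3) ide(1-3) eid(1-3) ru(1-3) lu(1-3)
    id_sat(1-3) dagger_sat(1-3) \<mu> \<eta> rel_comp_sat(1-3)
  have 1: "rel_comp C \<mu> (rel_tensor C \<Delta> \<eta>) = graph_rel C (pr1 C A (terminal_obj C)) \<longleftrightarrow>
    (\<forall>X. \<forall>a \<in> hom C X A. \<forall>c \<in> hom C X A.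
      internal_ex X A (\<lambda>e x. U x \<and> M (a \<cdot> e) x (c \<cdot> e)) \<longleftrightarrow> a = c)"
  proof -
    have "sat (graph_rel C (pr1 C A (terminal_obj C))) (pair C a (bang C X)) c \<longleftrightarrow> a = c"
      if "a \<in> hom C X A" "c \<in> hom C X A" for a c X
      using ru(4)[OF pair_hom[OF that(1) bang_hom[OF homD(4)[OF that(1)]]] that(2)] that homD(4)[OF that(1)]
      by (simp add: hom_def)
    then show ?thesis
      by (subst relation_eq_iff) (auto simp: facts all_prd[OF A I] all_terminal right_unit_sat dest: homD(4))
  qed
  have 2: "rel_comp C \<mu> (rel_tensor C \<eta> \<Delta>) = graph_rel C (pr2 C (terminal_obj C) A) \<longleftrightarrow>
    (\<forall>X. \<forall>a \<in> hom C X A. \<forall>c \<in> hom C X A.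
      internal_ex X A (\<lambda>e x. U x \<and> M x (a \<cdot> e) (c \<cdot> e)) \<longleftrightarrow> a = c)"
  proof -
    have "sat (graph_rel C (pr2 C (terminal_obj C) A)) (pair C (bang C X) a) c \<longleftrightarrow> a = c"
      if "a \<in> hom C X A" "c \<in> hom C X A" for a c X
      using lu(4)[OF pair_hom[OF bang_hom[OF homD(4)[OF that(1)]] that(1)] that(2)] that homD(4)[OF that(1)]
      by (simp add: hom_def)
    then show ?thesis
      by (subst relation_eq_iff) (auto simp: facts all_prd[OF I A] all_terminal left_unit_sat dest: homD(4))
  qed
  have 3: "rel_comp C \<mu> (rel_tensor C \<mu> \<Delta>) =
      rel_comp C \<mu> (rel_comp C (rel_tensor C \<Delta> \<mu>) \<alpha>) \<longleftrightarrow>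
    (\<forall>X. \<forall>a \<in> hom C X A. \<forall>b \<in> hom C X A. \<forall>c \<in> hom C X A. \<forall>d \<in> hom C X A.
      internal_ex X A (\<lambda>e x. M (a \<cdot> e) (b \<cdot> e) x \<and> M x (c \<cdot> e) (d \<cdot> e)) \<longleftrightarrow>
      internal_ex X A (\<lambda>e x. M (b \<cdot> e) (c \<cdot> e) x \<and> M (a \<cdot> e) x (d \<cdot> e)))"
    by (subst relation_eq_iff)
      (simp_all add: facts all_prd[OF AA A] all_prd[OF A A] assoc_left_sat assoc_right_sat cong: ball_cong)
  have 4: "rel_comp C \<mu> (rel_dagger C \<mu>) = \<Delta> \<longleftrightarrow>
    (\<forall>X. \<forall>c \<in> hom C X A. \<forall>d \<in> hom C X A.
      (\<exists>Y e x y. e \<in> hom C Y X \<and> regular_epi C e \<and> x \<in> hom C Y A \<and> y \<in> hom C Y A \<and>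
         M x y (c \<cdot> e) \<and> M x y (d \<cdot> e)) \<longleftrightarrow> c = d)"
    by (subst relation_eq_iff) (simp_all add: facts id_sat(4) special_sat cong: ball_cong)
  have 5: "rel_comp C (rel_tensor C \<mu> \<Delta>)
      (rel_comp C (rel_dagger C \<alpha>) (rel_tensor C \<Delta> (rel_dagger C \<mu>))) =
     rel_comp C (rel_tensor C \<Delta> \<mu>)
      (rel_comp C \<alpha> (rel_tensor C (rel_dagger C \<mu>) \<Delta>)) \<longleftrightarrow>
    (\<forall>X. \<forall>a \<in> hom C X A. \<forall>b \<in> hom C X A. \<forall>c \<in> hom C X A. \<forall>d \<in> hom C X A.
      internal_ex X A (\<lambda>e x. M x (d \<cdot> e) (b \<cdot> e) \<and> M (a \<cdot> e) x (c \<cdot> e)) \<longleftrightarrow>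
      internal_ex X A (\<lambda>e y. M (c \<cdot> e) y (a \<cdot> e) \<and> M y (b \<cdot> e) (d \<cdot> e)))"
    by (subst relation_eq_iff)
      (simp_all add: facts all_prd[OF A A] frobenius_left_sat frobenius_right_sat cong: ball_cong)
  show ?thesis
    unfolding special_dagger_frobenius_def 1[symmetric] 2[symmetric] 3[symmetric] 4[symmetric] 5[symmetric]
    using A \<mu> \<eta> by (simp add: Rel_def hom_def)
qed

end

section \<open>From Frobenius structures to groupoids\<close>

locale frobenius_structure = frobenius_data +
  assumes frobenius: "special_dagger_frobenius (Rel C) A \<mu> \<eta>"
begin

lemma A_Comp: "a \<in> hom C X A \<Longrightarrow> y \<in> hom C Y X \<Longrightarrow> a \<cdot> y \<in> hom C Y A"
  by (rule Comp_in_hom)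

lemma right_unit:
  "a \<in> hom C X A \<Longrightarrow> c \<in> hom C X A \<Longrightarrow> internal_ex X A (\<lambda>e x. U x \<and> M (a \<cdot> e) x (c \<cdot> e)) \<longleftrightarrow> a = c"
  using frobenius special_dagger_frobenius_iff by blast

lemma left_unit:
  "a \<in> hom C X A \<Longrightarrow> c \<in> hom C X A \<Longrightarrow> internal_ex X A (\<lambda>e x. U x \<and> M x (a \<cdot> e) (c \<cdot> e)) \<longleftrightarrow> a = c"
  using frobenius special_dagger_frobenius_iff by blast

lemma Comp_id: "a \<in> hom C X A \<Longrightarrow> a \<cdot> Ident C X = a"
  by (rule Comp_Ident_right)

lemma M_right_unit:
  assumes "a \<in> hom C X A" "c \<in> hom C X A" "x \<in> hom C X A" "U x" "M a x c"
  shows "a = c"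
proof -
  have "internal_ex X A (\<lambda>e x. U x \<and> M (a \<cdot> e) x (c \<cdot> e))"
    by (rule internal_exI[OF assms(3)]) (use assms Comp_id in simp)
  then show ?thesis using right_unit assms by blast
qed

lemma M_left_unit:
  assumes "a \<in> hom C X A" "c \<in> hom C X A" "x \<in> hom C X A" "U x" "M x a c"
  shows "a = c"
proof -
  have "internal_ex X A (\<lambda>e x. U x \<and> M x (a \<cdot> e) (c \<cdot> e))"
    by (rule internal_exI[OF assms(3)]) (use assms Comp_id in simp)
  then show ?thesis using left_unit assms by blast
qed

text \<open>
  One half of speciality: the multiplication is a partial function.
\<close>

lemma M_functional:
  assumes "a \<in> hom C X A" "b \<in> hom C X A" "c \<in> hom C X A" "d \<in> hom C X A" "M a b c" "M a b d"
  shows "c = d"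
proof -
  have "\<exists>Y e x y. e \<in> hom C Y X \<and> regular_epi C e \<and> x \<in> hom C Y A \<and> y \<in> hom C Y A \<and>
         M x y (c \<cdot> e) \<and> M x y (d \<cdot> e)"
    using assms Comp_id homD(4)[OF assms(1)] regular_epi_Ident Ident_in_hom by metis
  then show ?thesis using frobenius assms(3,4) special_dagger_frobenius_iff by blast
qed

lemma M_assoc:
  assumes h: "a \<in> hom C X A" "b \<in> hom C X A" "c \<in> hom C X A" "d \<in> hom C X A" "x \<in> hom C X A"
    and m: "M a b x" "M x c d"
  obtains Y e y where "e \<in> hom C Y X" "regular_epi C e" "y \<in> hom C Y A"
    "M (b \<cdot> e) (c \<cdot> e) y" "M (a \<cdot> e) y (d \<cdot> e)"
proof -
  have "internal_ex X A (\<lambda>e x. M (a \<cdot> e) (b \<cdot> e) x \<and> M x (c \<cdot> e) (d \<cdot> e))"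
    by (rule internal_exI[OF h(5)]) (use h m Comp_id in simp)
  then have "internal_ex X A (\<lambda>e x. M (b \<cdot> e) (c \<cdot> e) x \<and> M (a \<cdot> e) x (d \<cdot> e))"
    using frobenius h special_dagger_frobenius_iff by blast
  then show ?thesis using that by (auto elim: internal_exE)
qed

lemma M_assoc_converse:
  assumes h: "a \<in> hom C X A" "b \<in> hom C X A" "c \<in> hom C X A" "d \<in> hom C X A" "x \<in> hom C X A"
    and m: "M b c x" "M a x d"
  obtains Y e y where "e \<in> hom C Y X" "regular_epi C e" "y \<in> hom C Y A"
    "M (a \<cdot> e) (b \<cdot> e) y" "M y (c \<cdot> e) (d \<cdot> e)"
proof -
  have "internal_ex X A (\<lambda>e x. M (b \<cdot> e) (c \<cdot> e) x \<and> M (a \<cdot> e) x (d \<cdot> e))"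
    by (rule internal_exI[OF h(5)]) (use h m Comp_id in simp)
  then have "internal_ex X A (\<lambda>e x. M (a \<cdot> e) (b \<cdot> e) x \<and> M x (c \<cdot> e) (d \<cdot> e))"
    using frobenius h special_dagger_frobenius_iff by blast
  then show ?thesis using that by (auto elim: internal_exE)
qed

lemma M_frobenius:
  assumes h: "a \<in> hom C X A" "b \<in> hom C X A" "c \<in> hom C X A" "d \<in> hom C X A" "y \<in> hom C X A"
    and m: "M c y a" "M y b d"
  shows "internal_ex X A (\<lambda>e x. M x (d \<cdot> e) (b \<cdot> e) \<and> M (a \<cdot> e) x (c \<cdot> e))"
proof -
  have "internal_ex X A (\<lambda>e y. M (c \<cdot> e) y (a \<cdot> e) \<and> M y (b \<cdot> e) (d \<cdot> e))"
    by (rule internal_exI[OF h(5)]) (use h m Comp_id in simp)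
  then show ?thesis using frobenius h special_dagger_frobenius_iff by blast
qed

text \<open>
  If \<open>a x = a\<close> and \<open>a x' = a\<close> for units \<open>x\<close> and \<open>x'\<close>, then \<open>(a x) x'\<close> is defined, so by associativity
  \<open>x x'\<close> is defined, and it equals both \<open>x\<close> and \<open>x'\<close>.
\<close>

lemma right_unit_unique:
  assumes h: "a \<in> hom C X A" "x \<in> hom C X A" "x' \<in> hom C X A" and U: "U x" "U x'" and m: "M a x a" "M a x' a"
  shows "x = x'"
proof -
  obtain Y e y where e: "e \<in> hom C Y X" "regular_epi C e" and y: "y \<in> hom C Y A"
    "M (x \<cdot> e) (x' \<cdot> e) y" "M (a \<cdot> e) y (a \<cdot> e)"
    by (rule M_assoc[OF h(1,2,3) h(1) h(1) m])
  note he = h[THEN A_Comp, OF e(1)]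
  have "x \<cdot> e = y" using M_right_unit[OF he(2) y(1) he(3) U_Comp[OF h(3) e(1) U(2)] y(2)] .
  moreover have "x' \<cdot> e = y" using M_left_unit[OF he(3) y(1) he(2) U_Comp[OF h(2) e(1) U(1)] y(2)] .
  ultimately show ?thesis using cover_cancel[OF e h(2,3)] by simp
qed

lemma left_unit_unique:
  assumes h: "a \<in> hom C X A" "x \<in> hom C X A" "x' \<in> hom C X A" and U: "U x" "U x'" and m: "M x a a" "M x' a a"
  shows "x = x'"
proof -
  obtain Y e y where e: "e \<in> hom C Y X" "regular_epi C e" and y: "y \<in> hom C Y A"
    "M (x \<cdot> e) (x' \<cdot> e) y" "M y (a \<cdot> e) (a \<cdot> e)"
    by (rule M_assoc_converse[OF h(2,3,1) h(1) h(1) m(2,1)])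
  note he = h[THEN A_Comp, OF e(1)]
  have "x \<cdot> e = y" using M_right_unit[OF he(2) y(1) he(3) U_Comp[OF h(3) e(1) U(2)] y(2)] .
  moreover have "x' \<cdot> e = y" using M_left_unit[OF he(3) y(1) he(2) U_Comp[OF h(2) e(1) U(1)] y(2)] .
  ultimately show ?thesis using cover_cancel[OF e h(2,3)] by simp
qed

text \<open>
  The source of the generic element \<open>Ident C A\<close>: the unit law provides a right unit on a cover, and by
  uniqueness it descends.
\<close>

lemma source_exists: "\<exists>s \<in> hom C A A. U s \<and> M (Ident C A) s (Ident C A)"
proof -
  note I = Ident_in_hom[OF A]
  have Ie: "Ident C A \<cdot> e = e" "e \<in> hom C Y A \<Longrightarrow> e \<in> hom C Y A" if "e \<in> hom C Y A" for e Y
    using that by (rule Comp_Ident_left)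
  have ex: "internal_ex A A (\<lambda>e x. U x \<and> M (Ident C A \<cdot> e) x (Ident C A \<cdot> e))"
    using right_unit[OF I I] by simp
  then have ex: "internal_ex A A (\<lambda>e x. U x \<and> M e x e)"
    using Ie by (elim internal_ex_mono) auto
  show ?thesis
  proof (rule unique_choice[OF ex, where P = "\<lambda>x. U x \<and> M (Ident C A) x (Ident C A)"])
    show "U (x \<cdot> z) \<and> M (e \<cdot> z) (x \<cdot> z) (e \<cdot> z)"
      if "e \<in> hom C Y A" "x \<in> hom C Y A" "z \<in> hom C Z Y" "U x \<and> M e x e" for Y Z e x z
      using that U_Comp M_Comp by blast
    show "x = x'"
      if "e \<in> hom C Y A" "x \<in> hom C Y A" "x' \<in> hom C Y A" "U x \<and> M e x e" "U x' \<and> M e x' e" for Y e x x'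
      using that right_unit_unique by blast
    show "U x \<and> M (Ident C A) x (Ident C A)"
      if "e \<in> hom C Y A" "regular_epi C e" "x \<in> hom C A A" "U (x \<cdot> e) \<and> M e (x \<cdot> e) e" for Y e x
      using that U_local[OF that(3,1,2)] M_local[OF I that(3) I that(1,2)] Ie(1)[OF that(1)] by simp
  qed blast
qed

lemma target_exists: "\<exists>s \<in> hom C A A. U s \<and> M s (Ident C A) (Ident C A)"
proof -
  note I = Ident_in_hom[OF A]
  have Ie: "Ident C A \<cdot> e = e" if "e \<in> hom C Y A" for e Y
    using that by (rule Comp_Ident_left)
  have ex: "internal_ex A A (\<lambda>e x. U x \<and> M x (Ident C A \<cdot> e) (Ident C A \<cdot> e))"
    using left_unit[OF I I] by simp
  then have ex: "internal_ex A A (\<lambda>e x. U x \<and> M x e e)"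
    using Ie by (elim internal_ex_mono) auto
  show ?thesis
  proof (rule unique_choice[OF ex, where P = "\<lambda>x. U x \<and> M x (Ident C A) (Ident C A)"])
    show "U (x \<cdot> z) \<and> M (x \<cdot> z) (e \<cdot> z) (e \<cdot> z)"
      if "e \<in> hom C Y A" "x \<in> hom C Y A" "z \<in> hom C Z Y" "U x \<and> M x e e" for Y Z e x z
      using that U_Comp M_Comp by blast
    show "x = x'"
      if "e \<in> hom C Y A" "x \<in> hom C Y A" "x' \<in> hom C Y A" "U x \<and> M x e e" "U x' \<and> M x' e e" for Y e x x'
      using that left_unit_unique by blast
    show "U x \<and> M x (Ident C A) (Ident C A)"
      if "e \<in> hom C Y A" "regular_epi C e" "x \<in> hom C A A" "U (x \<cdot> e) \<and> M (x \<cdot> e) e e" for Y e x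
      using that U_local[OF that(3,1,2)] M_local[OF that(3) I I that(1,2)] Ie[OF that(1)] by simp
  qed blast
qed

text \<open>
  Source and target, as endomorphisms of the object of arrows that take values in the subobject of
  units.
\<close>

definition s :: 'b where "s = (SOME s. s \<in> hom C A A \<and> U s \<and> M (Ident C A) s (Ident C A))"
definition t :: 'b where "t = (SOME t. t \<in> hom C A A \<and> U t \<and> M t (Ident C A) (Ident C A))"

lemma s_hom: "s \<in> hom C A A" and s_Ident: "U s" "M (Ident C A) s (Ident C A)"
  using someI_ex[OF source_exists[unfolded Bex_def]] unfolding s_def by blast+

lemma t_hom: "t \<in> hom C A A" and t_Ident: "U t" "M t (Ident C A) (Ident C A)"
  using someI_ex[OF target_exists[unfolded Bex_def]] unfolding t_def by blast+

lemma s_props: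
  assumes a: "a \<in> hom C X A"
  shows "s \<cdot> a \<in> hom C X A" "U (s \<cdot> a)" "M a (s \<cdot> a) a"
    "x \<in> hom C X A \<Longrightarrow> U x \<Longrightarrow> M a x a \<Longrightarrow> s \<cdot> a = x"
proof -
  note I = Ident_in_hom[OF A]
  show 1: "s \<cdot> a \<in> hom C X A" and 2: "U (s \<cdot> a)" using A_Comp[OF s_hom a] U_Comp[OF s_hom a s_Ident(1)] .
  show 3: "M a (s \<cdot> a) a" using M_Comp[OF I s_hom I a s_Ident(2)] Comp_Ident_left[OF a] by simp
  show "x \<in> hom C X A \<Longrightarrow> U x \<Longrightarrow> M a x a \<Longrightarrow> s \<cdot> a = x"
    using right_unit_unique[OF a 1 _ 2 _ 3] by blast
qed

lemma t_props:
  assumes a: "a \<in> hom C X A"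
  shows "t \<cdot> a \<in> hom C X A" "U (t \<cdot> a)" "M (t \<cdot> a) a a"
    "x \<in> hom C X A \<Longrightarrow> U x \<Longrightarrow> M x a a \<Longrightarrow> t \<cdot> a = x"
proof -
  note I = Ident_in_hom[OF A]
  show 1: "t \<cdot> a \<in> hom C X A" and 2: "U (t \<cdot> a)" using A_Comp[OF t_hom a] U_Comp[OF t_hom a t_Ident(1)] .
  show 3: "M (t \<cdot> a) a a" using M_Comp[OF t_hom I I a t_Ident(2)] Comp_Ident_left[OF a] by simp
  show "x \<in> hom C X A \<Longrightarrow> U x \<Longrightarrow> M x a a \<Longrightarrow> t \<cdot> a = x"
    using left_unit_unique[OF a 1 _ 2 _ 3] by blast
qed

lemma st_assoc:
  assumes "a \<in> hom C X A" "e \<in> hom C Y X"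
  shows "(s \<cdot> a) \<cdot> e = s \<cdot> (a \<cdot> e)" "(t \<cdot> a) \<cdot> e = t \<cdot> (a \<cdot> e)"
  using Comp_assoc[OF assms(2,1) s_hom] Comp_assoc[OF assms(2,1) t_hom] .

text \<open>
  If \<open>a b\<close> is defined then so is \<open>(a (s a)) b = a ((s a) b)\<close>; hence \<open>s a\<close> is a left unit of \<open>b\<close>.
\<close>

lemma M_composable:
  assumes h: "a \<in> hom C X A" "b \<in> hom C X A" "c \<in> hom C X A" and m: "M a b c"
  shows "s \<cdot> a = t \<cdot> b"
proof -
  note sa = s_props[OF h(1)]
  obtain Y e y where e: "e \<in> hom C Y X" "regular_epi C e" and y: "y \<in> hom C Y A"
    "M ((s \<cdot> a) \<cdot> e) (b \<cdot> e) y" "M (a \<cdot> e) y (c \<cdot> e)"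
    by (rule M_assoc[OF h(1) sa(1) h(2,3,1) sa(3) m])
  note he = h[THEN A_Comp, OF e(1)] and se = A_Comp[OF sa(1) e(1)] U_Comp[OF sa(1) e(1) sa(2)]
  have "b \<cdot> e = y" using M_left_unit[OF he(2) y(1) se y(2)] .
  then have "t \<cdot> (b \<cdot> e) = (s \<cdot> a) \<cdot> e" using t_props(4)[OF he(2) se] y(2) by simp
  then have "(s \<cdot> a) \<cdot> e = (t \<cdot> b) \<cdot> e" using st_assoc[OF h(2) e(1)] by simp
  then show ?thesis using cover_cancel[OF e sa(1) t_props(1)[OF h(2)]] by simp
qed

text \<open>
  The Frobenius law, applied to \<open>(t a) a = a\<close> and \<open>a (s a) = a\<close>, yields an \<open>x\<close> with \<open>x a = s a\<close> and
  \<open>a x = t a\<close>.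
\<close>

lemma inverse_local:
  assumes a: "a \<in> hom C X A"
  shows "internal_ex X A (\<lambda>e x. M x (a \<cdot> e) (s \<cdot> (a \<cdot> e)) \<and> M (a \<cdot> e) x (t \<cdot> (a \<cdot> e)))"
  by (rule internal_ex_mono[OF M_frobenius[OF a s_props(1)[OF a] t_props(1)[OF a] a a t_props(3)[OF a] s_props(3)[OF a]]])
    (use st_assoc[OF a] in auto)

text \<open>
  If \<open>s a = t b\<close> and \<open>x\<close> is an inverse of \<open>a\<close>, then \<open>(x a) b = (s a) b = (t b) b\<close> is defined, so by
  associativity \<open>a b\<close> is defined on a cover; as products are unique, they descend.
\<close>

lemma M_total:
  assumes a: "a \<in> hom C X A" and b: "b \<in> hom C X A" and st: "s \<cdot> a = t \<cdot> b"
  obtains c where "c \<in> hom C X A" "M a b c"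
proof -
  obtain Y e x where e: "e \<in> hom C Y X" "regular_epi C e" and x: "x \<in> hom C Y A" "M x (a \<cdot> e) (s \<cdot> (a \<cdot> e))"
    using inverse_local[OF a] by (auto elim: internal_exE)
  have ae: "a \<cdot> e \<in> hom C Y A" and be: "b \<cdot> e \<in> hom C Y A" using A_Comp a b e by blast+
  have "M (s \<cdot> (a \<cdot> e)) (b \<cdot> e) (b \<cdot> e)"
    using t_props(3)[OF be] st st_assoc(1)[OF a e(1)] st_assoc(2)[OF b e(1)] by simp
  then obtain Z e' y where e': "e' \<in> hom C Z Y" "regular_epi C e'" and y: "y \<in> hom C Z A"
      "M ((a \<cdot> e) \<cdot> e') ((b \<cdot> e) \<cdot> e') y"
    by (rule M_assoc[OF x(1) ae be be s_props(1)[OF ae] x(2)])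
  have ee: "e \<cdot> e' \<in> hom C Z X" "regular_epi C (e \<cdot> e')"
    using e e' regular_epi_Comp[OF e'(2) e(2)] by (simp_all add: hom_def)
  have "M (a \<cdot> (e \<cdot> e')) (b \<cdot> (e \<cdot> e')) y"
    using y(2) Comp_assoc[OF e'(1) e(1) a] Comp_assoc[OF e'(1) e(1) b] by simp
  with ee y(1) have ex: "internal_ex X A (\<lambda>e x. M (a \<cdot> e) (b \<cdot> e) x)"
    unfolding internal_ex_def by blast
  show ?thesis
  proof (rule unique_choice[OF ex, where P = "\<lambda>c. M a b c"])
    show "M (a \<cdot> (e \<cdot> z)) (b \<cdot> (e \<cdot> z)) (x \<cdot> z)"
      if "e \<in> hom C Y X" "x \<in> hom C Y A" "z \<in> hom C Z Y" "M (a \<cdot> e) (b \<cdot> e) x" for Y Z e x z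
      using M_Comp[OF A_Comp[OF a that(1)] A_Comp[OF b that(1)] that(2,3,4)]
        Comp_assoc[OF that(3,1) a] Comp_assoc[OF that(3,1) b] by simp
    show "x = x'"
      if "e \<in> hom C Y X" "x \<in> hom C Y A" "x' \<in> hom C Y A" "M (a \<cdot> e) (b \<cdot> e) x" "M (a \<cdot> e) (b \<cdot> e) x'" for Y e x x'
      using M_functional[OF A_Comp[OF a that(1)] A_Comp[OF b that(1)] that(2-5)] .
    show "M a b x"
      if "e \<in> hom C Y X" "regular_epi C e" "x \<in> hom C X A" "M (a \<cdot> e) (b \<cdot> e) (x \<cdot> e)" for Y e x
      using M_local[OF a b that(3,1,2,4)] .
  qed (rule that)
qed

text \<open>
  Associativity gives \<open>c (s b) = (a b) (s b) = a (b (s b)) = c\<close>, so \<open>s b\<close> is the source of \<open>c = a b\<close>;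
  dually for targets.
\<close>

lemma M_source_target:
  assumes h: "a \<in> hom C X A" "b \<in> hom C X A" "c \<in> hom C X A" and m: "M a b c"
  shows "s \<cdot> c = s \<cdot> b" "t \<cdot> c = t \<cdot> a"
proof -
  note sb = s_props[OF h(2)] and ta = t_props[OF h(1)]
  obtain Y e y where e: "e \<in> hom C Y X" "regular_epi C e" and y: "y \<in> hom C Y A"
    "M (a \<cdot> e) (b \<cdot> e) y" "M y ((s \<cdot> b) \<cdot> e) (c \<cdot> e)"
    by (rule M_assoc_converse[OF h(1,2) sb(1) h(3) h(2) sb(3) m])
  note he = h[THEN A_Comp, OF e(1)] and se = A_Comp[OF sb(1) e(1)] U_Comp[OF sb(1) e(1) sb(2)]
  have "y = c \<cdot> e" using M_functional[OF he(1,2) y(1) he(3) y(2) M_Comp[OF h e(1) m]] .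
  then have "s \<cdot> (c \<cdot> e) = (s \<cdot> b) \<cdot> e" using s_props(4)[OF he(3) se] y(3) by simp
  then have "(s \<cdot> c) \<cdot> e = (s \<cdot> b) \<cdot> e" using st_assoc[OF h(3) e(1)] by simp
  then show "s \<cdot> c = s \<cdot> b" using cover_cancel[OF e s_props(1)[OF h(3)] sb(1)] by simp
next
  note ta = t_props[OF h(1)]
  obtain Y e y where e: "e \<in> hom C Y X" "regular_epi C e" and y: "y \<in> hom C Y A"
    "M (a \<cdot> e) (b \<cdot> e) y" "M ((t \<cdot> a) \<cdot> e) y (c \<cdot> e)"
    by (rule M_assoc[OF ta(1) h(1,2,3,1) ta(3) m])
  note he = h[THEN A_Comp, OF e(1)] and te = A_Comp[OF ta(1) e(1)] U_Comp[OF ta(1) e(1) ta(2)]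
  have "y = c \<cdot> e" using M_functional[OF he(1,2) y(1) he(3) y(2) M_Comp[OF h e(1) m]] .
  then have "t \<cdot> (c \<cdot> e) = (t \<cdot> a) \<cdot> e" using t_props(4)[OF he(3) te] y(3) by simp
  then have "(t \<cdot> c) \<cdot> e = (t \<cdot> a) \<cdot> e" using st_assoc[OF h(3) e(1)] by simp
  then show "t \<cdot> c = t \<cdot> a" using cover_cancel[OF e t_props(1)[OF h(3)] ta(1)] by simp
qed

lemma unit_source_target:
  assumes x: "x \<in> hom C X A" and U: "U x"
  shows "s \<cdot> x = x" "t \<cdot> x = x"
  using M_left_unit[OF s_props(1)[OF x] x x U s_props(3)[OF x]]
    M_right_unit[OF t_props(1)[OF x] x x U t_props(3)[OF x]] by simp_all

text \<open>
  \<open>x = x (t a) = x (a x') = (x a) x' = (s a) x' = x'\<close>.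
\<close>

lemma inverse_unique:
  assumes h: "a \<in> hom C X A" "x \<in> hom C X A" "x' \<in> hom C X A"
    and m: "M x a (s \<cdot> a)" "M a x' (t \<cdot> a)"
  shows "x = x'"
proof -
  note sa = s_props(1)[OF h(1)] and ta = t_props[OF h(1)]
  have "s \<cdot> a = t \<cdot> x'" using M_composable[OF h(1,3) ta(1) m(2)] .
  then have "M (s \<cdot> a) x' x'" using t_props(3)[OF h(3)] by simp
  then obtain Y e y where e: "e \<in> hom C Y X" "regular_epi C e" and y: "y \<in> hom C Y A"
    "M (a \<cdot> e) (x' \<cdot> e) y" "M (x \<cdot> e) y (x' \<cdot> e)"
    by (rule M_assoc[OF h(2,1,3,3) sa m(1)])
  note he = h[THEN A_Comp, OF e(1)] and te = A_Comp[OF ta(1) e(1)] U_Comp[OF ta(1) e(1) ta(2)]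
  have "y = (t \<cdot> a) \<cdot> e" using M_functional[OF he(1,3) y(1) te(1) y(2) M_Comp[OF h(1,3) ta(1) e(1) m(2)]] .
  then have "x \<cdot> e = x' \<cdot> e" using M_right_unit[OF he(2,3) te] y(3) by simp
  then show ?thesis using cover_cancel[OF e h(2,3)] by simp
qed

lemma inverse_exists:
  obtains i where "i \<in> hom C A A" "M i (Ident C A) s" "M (Ident C A) i t"
proof -
  note I = Ident_in_hom[OF A]
  have Ie: "Ident C A \<cdot> e = e" if "e \<in> hom C Y A" for e Y
    using that by (rule Comp_Ident_left)
  have ex: "internal_ex A A (\<lambda>e x. M x e (s \<cdot> e) \<and> M e x (t \<cdot> e))"
    by (rule internal_ex_mono[OF inverse_local[OF I]]) (use Ie in auto)
  show ?thesis
  proof (rule unique_choice[OF ex, where P = "\<lambda>i. M i (Ident C A) s \<and> M (Ident C A) i t"])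
    show "M (x \<cdot> z) (e \<cdot> z) (s \<cdot> (e \<cdot> z)) \<and> M (e \<cdot> z) (x \<cdot> z) (t \<cdot> (e \<cdot> z))"
      if "e \<in> hom C Y A" "x \<in> hom C Y A" "z \<in> hom C Z Y" "M x e (s \<cdot> e) \<and> M e x (t \<cdot> e)" for Y Z e x z
      using M_Comp[OF that(2,1) s_props(1)[OF that(1)] that(3)] M_Comp[OF that(1,2) t_props(1)[OF that(1)] that(3)]
        that(4) st_assoc[OF that(1,3)] by simp
    show "x = x'"
      if "e \<in> hom C Y A" "x \<in> hom C Y A" "x' \<in> hom C Y A" "M x e (s \<cdot> e) \<and> M e x (t \<cdot> e)"
        "M x' e (s \<cdot> e) \<and> M e x' (t \<cdot> e)" for Y e x x'
      using inverse_unique[OF that(1-3)] that(4,5) by blast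
    show "M x (Ident C A) s \<and> M (Ident C A) x t"
      if "e \<in> hom C Y A" "regular_epi C e" "x \<in> hom C A A" "M (x \<cdot> e) e (s \<cdot> e) \<and> M e (x \<cdot> e) (t \<cdot> e)" for Y e x
      using M_local[OF that(3) I s_hom that(1,2)] M_local[OF I that(3) t_hom that(1,2)] that(4) Ie[OF that(1)] by simp
  qed (use that in blast)
qed

end

section \<open>The relations of an internal groupoid\<close>

context regular_category begin

text \<open>
  Multiplication in an internal category as an operation on composable pairs of generalized elements,
  natural in the stage.
\<close>

lemma mult_simps:
  assumes st: "src G \<in> hom C A D" "tgt G \<in> hom C A D" and m: "cmp G \<in> hom C (composable C G) A"
    and ab: "a \<in> hom C X A" "b \<in> hom C X A" "src G \<cdot> a = tgt G \<cdot> b"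
  shows "mult C G a b \<in> hom C X A" "y \<in> hom C Y X \<Longrightarrow> mult C G a b \<cdot> y = mult C G (a \<cdot> y) (b \<cdot> y)"
    "pb_pair C (src G) (tgt G) a b \<in> hom C X (composable C G)"
proof -
  let ?p = "pb_pair C (src G) (tgt G)"
  have p: "?p a b \<in> hom C X (composable C G)" using st ab by (simp add: hom_def)
  then show "?p a b \<in> hom C X (composable C G)" "mult C G a b \<in> hom C X A"
    unfolding mult_def using m by (simp_all add: hom_def)
  assume y: "y \<in> hom C Y X"
  have aby: "src G \<cdot> (a \<cdot> y) = tgt G \<cdot> (b \<cdot> y)" "a \<cdot> y \<in> hom C Y A" "b \<cdot> y \<in> hom C Y A"
    using Comp_reassoc[OF ab(3), of y] st ab(1,2) y by (simp_all add: hom_def)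
  have q: "?p (a \<cdot> y) (b \<cdot> y) \<in> hom C Y (composable C G)" using st aby by (simp add: hom_def)
  have py: "?p a b \<cdot> y \<in> hom C Y (composable C G)" using p y by (simp add: hom_def)
  have "?p a b \<cdot> y = ?p (a \<cdot> y) (b \<cdot> y)"
    by (rule pb_ext[OF _ _ _ py q])
      (use st ab aby p y in \<open>simp_all add: hom_def flip: Comp_assoc_simp\<close>)
  then show "mult C G a b \<cdot> y = mult C G (a \<cdot> y) (b \<cdot> y)"
    unfolding mult_def using m p y by (simp add: hom_def)
qed

lemma mult_first_second:
  assumes st: "src G \<in> hom C A D" "tgt G \<in> hom C A D" and m: "cmp G \<in> hom C (composable C G) A"
  shows "first C G \<in> hom C (composable C G) A" "second C G \<in> hom C (composable C G) A"
    "src G \<cdot> first C G = tgt G \<cdot> second C G" "mult C G (first C G) (second C G) = cmp G"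
proof -
  show fs: "first C G \<in> hom C (composable C G) A" "second C G \<in> hom C (composable C G) A"
    "src G \<cdot> first C G = tgt G \<cdot> second C G"
    using st pb_commutes[of "src G" "tgt G"] by (simp_all add: hom_def)
  have "pb_pair C (src G) (tgt G) (first C G) (second C G) = Ident C (composable C G)"
    by (rule pb_ext[of "src G" "tgt G" _ "composable C G"]) (use st fs in \<open>simp_all add: hom_def\<close>)
  then show "mult C G (first C G) (second C G) = cmp G" unfolding mult_def using m by (simp add: hom_def)
qed

lemma composition_rel_sat:
  fixes G :: "('a, 'b) internal_groupoid"
  assumes st: "src G \<in> hom C A D" "tgt G \<in> hom C A D" and m: "cmp G \<in> hom C (composable C G) A"
  shows "composition_rel C G \<in> relations C" "rdom (composition_rel C G) = prd C A A" "rcod (composition_rel C G) = A"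
    "a \<in> hom C X A \<Longrightarrow> b \<in> hom C X A \<Longrightarrow> c \<in> hom C X A \<Longrightarrow>
      multiplies (composition_rel C G) a b c \<longleftrightarrow> src G \<cdot> a = tgt G \<cdot> b \<and> mult C G a b = c"
proof -
  note fs = mult_first_second[OF st m]
  have ty: "src G \<in> Arr C" "tgt G \<in> Arr C" "Cod C (src G) = Cod C (tgt G)" using st by (simp_all add: hom_def)
  note p = pair_hom[OF fs(1,2)]
  have mono: "monic C (pair C (pair C (first C G) (second C G)) (cmp G))"
  proof (rule monic_pairI[OF p m])
    fix X h k assume h: "h \<in> hom C X (composable C G)" "k \<in> hom C X (composable C G)"
      and "pair C (first C G) (second C G) \<cdot> h = pair C (first C G) (second C G) \<cdot> k"
    then have "first C G \<cdot> h = first C G \<cdot> k" "second C G \<cdot> h = second C G \<cdot> k"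
      using fs(1,2) by (simp_all add: hom_def)
    then show "h = k" by (rule pb_ext[OF ty h])
  qed
  note sp = span_rel_sat[OF p m mono]
  show "composition_rel C G \<in> relations C" "rdom (composition_rel C G) = prd C A A" "rcod (composition_rel C G) = A"
    unfolding composition_rel_def using sp by blast+
  assume ab: "a \<in> hom C X A" "b \<in> hom C X A" and c: "c \<in> hom C X A"
  have "multiplies (composition_rel C G) a b c \<longleftrightarrow>
     (\<exists>k \<in> hom C X (composable C G). pair C (first C G) (second C G) \<cdot> k = pair C a b \<and> cmp G \<cdot> k = c)"
    unfolding multiplies_def composition_rel_def using sp(4)[OF pair_hom[OF ab] c] ab by (simp add: hom_def)
  also have "\<dots> \<longleftrightarrow> (\<exists>k \<in> hom C X (composable C G). first C G \<cdot> k = a \<and> second C G \<cdot> k = b \<and> cmp G \<cdot> k = c)"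
    by (rule bex_cong) (use fs(1,2) ab in \<open>auto simp: hom_def\<close>)
  also have "\<dots> \<longleftrightarrow> src G \<cdot> a = tgt G \<cdot> b \<and> mult C G a b = c"
  proof
    assume "\<exists>k \<in> hom C X (composable C G). first C G \<cdot> k = a \<and> second C G \<cdot> k = b \<and> cmp G \<cdot> k = c"
    then obtain k where k: "k \<in> hom C X (composable C G)" "first C G \<cdot> k = a" "second C G \<cdot> k = b" "cmp G \<cdot> k = c"
      by blast
    have "src G \<cdot> (first C G \<cdot> k) = (tgt G \<cdot> second C G) \<cdot> k"
      by (rule Comp_reassoc[OF fs(3)]) (use fs(1) st k(1) in \<open>simp_all add: hom_def\<close>)
    then have 1: "src G \<cdot> a = tgt G \<cdot> b" using k fs(2) st by (simp add: hom_def)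
    have "mult C G (first C G) (second C G) \<cdot> k = mult C G a b"
      using mult_simps(2)[OF st m fs(1-3) k(1)] k by simp
    then show "src G \<cdot> a = tgt G \<cdot> b \<and> mult C G a b = c" using 1 fs(4) k by simp
  next
    assume *: "src G \<cdot> a = tgt G \<cdot> b \<and> mult C G a b = c"
    then have st': "src G \<cdot> a = tgt G \<cdot> b" by simp
    show "\<exists>k \<in> hom C X (composable C G). first C G \<cdot> k = a \<and> second C G \<cdot> k = b \<and> cmp G \<cdot> k = c"
      by (rule bexI[OF _ mult_simps(3)[OF st m ab st']])
        (use * st ab in \<open>auto simp: mult_def hom_def\<close>)
  qed
  finally show "multiplies (composition_rel C G) a b c \<longleftrightarrow> src G \<cdot> a = tgt G \<cdot> b \<and> mult C G a b = c" .
qed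

lemma state_rel_sat:
  assumes u: "monic C u" "u \<in> hom C D A"
  shows "state_rel C u \<in> relations C" "rdom (state_rel C u) = terminal_obj C" "rcod (state_rel C u) = A"
    "x \<in> hom C X A \<Longrightarrow> unit_element (state_rel C u) x \<longleftrightarrow> (\<exists>y \<in> hom C X D. u \<cdot> y = x)"
proof -
  have D: "Dom C u = D" "D \<in> Obj C" using u homD by auto
  then have b: "bang C D \<in> hom C D (terminal_obj C)" by (simp add: hom_def)
  have mono: "monic C (pair C (bang C D) u)"
    by (rule monic_pairI[OF b u(2)]) (use monicD[OF u(1)] D in blast)
  note sp = span_rel_sat[OF b u(2) mono]
  show "state_rel C u \<in> relations C" "rdom (state_rel C u) = terminal_obj C" "rcod (state_rel C u) = A"
    unfolding state_rel_def D(1) using sp by blast+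
  assume x: "x \<in> hom C X A"
  have bx: "bang C X \<in> hom C X (terminal_obj C)" using homD(4)[OF x] by (simp add: hom_def)
  have "bang C D \<cdot> y = bang C X" if "y \<in> hom C X D" for y
    by (rule terminal_unique[OF Comp_in_hom[OF that b] bx])
  then show "unit_element (state_rel C u) x \<longleftrightarrow> (\<exists>y \<in> hom C X D. u \<cdot> y = x)"
    unfolding unit_element_def state_rel_def D(1) homD(2)[OF x] sp(4)[OF bx x] homD(2)[OF bx] by blast
qed

text \<open>
  The second leg of a subobject of \<open>1 \<times> A\<close> is a monomorphism, since the first leg carries no
  information.
\<close>

lemma represents_unit_exists:
  assumes \<eta>: "\<eta> \<in> relations C" "rdom \<eta> = terminal_obj C" "rcod \<eta> = A"
  shows "\<exists>u. represents_unit C u A \<eta>"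
proof -
  have A: "A \<in> Obj C" using relationsD[OF \<eta>(1)] \<eta>(3) by simp
  obtain r where r: "r \<in> rsub \<eta>" using rsub_nonempty[OF \<eta>(1)] by blast
  note r' = rsubD[OF \<eta>(1) r] and l = leg_simps[OF \<eta>(1) r, unfolded \<eta>(2,3)]
  have "monic C (leg2 C \<eta> r)" unfolding monic_def
  proof (intro conjI allI ballI impI)
    show "leg2 C \<eta> r \<in> Arr C" using l by (simp add: hom_def)
    fix X f g assume f: "f \<in> hom C X (Dom C (leg2 C \<eta> r))" "g \<in> hom C X (Dom C (leg2 C \<eta> r))"
      and eq: "leg2 C \<eta> r \<cdot> f = leg2 C \<eta> r \<cdot> g"
    have f': "f \<in> hom C X (Dom C r)" "g \<in> hom C X (Dom C r)" using f homD(2)[OF l(2)] by simp_all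
    show "f = g"
      by (rule legs_jointly_monic[OF \<eta>(1) r f' _ eq])
        (rule terminal_unique[OF Comp_in_hom[OF f'(1) l(1)] Comp_in_hom[OF f'(2) l(1)]])
  qed
  moreover have "state_rel C (leg2 C \<eta> r) = \<eta>"
  proof -
    have O: "Dom C r \<in> Obj C" using homD(4)[OF l(2)] .
    have "bang C (Dom C r) = leg1 C \<eta> r"
      by (rule terminal_unique[OF _ l(1)]) (use O in \<open>simp add: hom_def\<close>)
    then show ?thesis unfolding state_rel_def span_rel_def homD(2)[OF l(2)]
      using l r'(3) \<eta>(2,3) by (intro relation.expand) (simp add: hom_def)
  qed
  ultimately show ?thesis unfolding represents_unit_def using l(2) by (auto simp: hom_def)
qed

end

section \<open>The groupoid of a Frobenius structure\<close>

context frobenius_structure begin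

text \<open>
  Source, target and inverse are given by \<open>s\<close>, \<open>t\<close> and the inverse of the generic element; the first two
  factor through \<open>u\<close> because their values are units.  Composition is the product of the generic
  composable pair.  All groupoid laws then follow from the corresponding facts about generalized
  elements, as \<open>u\<close> is a monomorphism and products are unique.
\<close>

lemma groupoid_exists:
  assumes u: "represents_unit C u A \<eta>"
  shows "\<exists>G. groupoid_from_frobenius C (A, \<mu>, \<eta>) u G"
proof -
  let ?D = "Dom C u"
  have um: "monic C u" and uh: "u \<in> hom C ?D A" and \<eta>u: "state_rel C u = \<eta>"
    using u unfolding represents_unit_def by (auto simp: hom_def monic_Arr)
  have U_iff: "U x \<longleftrightarrow> (\<exists>y \<in> hom C X ?D. u \<cdot> y = x)" if "x \<in> hom C X A" for x X
    using state_rel_sat(4)[OF um uh that] \<eta>u by simp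
  have cancel_u: "x = y" if "u \<cdot> x = u \<cdot> y" "x \<in> hom C X ?D" "y \<in> hom C X ?D" for x y X
    using monicD[OF um that] .
  note I = Ident_in_hom[OF A]
  obtain \<sigma> where \<sigma>: "\<sigma> \<in> hom C A ?D" "u \<cdot> \<sigma> = s" using U_iff[OF s_hom] s_Ident(1) by blast
  obtain \<tau> where \<tau>: "\<tau> \<in> hom C A ?D" "u \<cdot> \<tau> = t" using U_iff[OF t_hom] t_Ident(1) by blast
  have u\<sigma>: "u \<cdot> (\<sigma> \<cdot> a) = s \<cdot> a" "u \<cdot> (\<tau> \<cdot> a) = t \<cdot> a" "\<sigma> \<cdot> a \<in> hom C X ?D" "\<tau> \<cdot> a \<in> hom C X ?D"
    if "a \<in> hom C X A" for a X
    using Comp_reassoc[OF \<sigma>(2), of a] Comp_reassoc[OF \<tau>(2), of a] \<sigma>(1) \<tau>(1) uh that by (simp_all add: hom_def)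
  have comp_iff: "\<sigma> \<cdot> a = \<tau> \<cdot> b \<longleftrightarrow> s \<cdot> a = t \<cdot> b" if "a \<in> hom C X A" "b \<in> hom C X A" for a b X
    using u\<sigma>[OF that(1)] u\<sigma>[OF that(2)] cancel_u by metis
  let ?f1 = "pb1 C \<sigma> \<tau>" and ?f2 = "pb2 C \<sigma> \<tau>" and ?P = "pb C \<sigma> \<tau>"
  have f: "?f1 \<in> hom C ?P A" "?f2 \<in> hom C ?P A" "\<sigma> \<cdot> ?f1 = \<tau> \<cdot> ?f2"
    using \<sigma>(1) \<tau>(1) pb_commutes[of \<sigma> \<tau>] by (simp_all add: hom_def)
  then have "s \<cdot> ?f1 = t \<cdot> ?f2" using comp_iff by blast
  then obtain m where m: "m \<in> hom C ?P A" "M ?f1 ?f2 m" using M_total[OF f(1,2)] by blast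
  obtain i where i: "i \<in> hom C A A" "M i (Ident C A) s" "M (Ident C A) i t" by (rule inverse_exists)
  define G :: "('a, 'b) internal_groupoid" where
    "G = \<lparr>C0 = ?D, C1 = A, src = \<sigma>, tgt = \<tau>, idn = u, cmp = m, invn = i\<rparr>"
  have G: "C0 G = ?D" "C1 G = A" "src G = \<sigma>" "tgt G = \<tau>" "idn G = u" "cmp G = m" "invn G = i"
    unfolding G_def by simp_all
  have st: "src G \<in> hom C A ?D" "tgt G \<in> hom C A ?D" and mh: "cmp G \<in> hom C (composable C G) A"
    unfolding G using \<sigma> \<tau> m by simp_all
  have mul: "mult C G a b \<in> hom C X A" "M a b (mult C G a b)"
    if ab: "a \<in> hom C X A" "b \<in> hom C X A" "s \<cdot> a = t \<cdot> b" for a b X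
  proof -
    have st': "src G \<cdot> a = tgt G \<cdot> b" unfolding G using comp_iff[OF ab(1,2)] ab(3) by simp
    show 1: "mult C G a b \<in> hom C X A" using mult_simps(1)[OF st mh ab(1,2) st'] .
    have k: "pb_pair C \<sigma> \<tau> a b \<in> hom C X ?P" using mult_simps(3)[OF st mh ab(1,2) st'] unfolding G .
    have "?f1 \<cdot> pb_pair C \<sigma> \<tau> a b = a" "?f2 \<cdot> pb_pair C \<sigma> \<tau> a b = b"
      using \<sigma>(1) \<tau>(1) ab(1,2) st' unfolding G by (simp_all add: hom_def)
    then show "M a b (mult C G a b)"
      using M_Comp[OF f(1,2) m(1) k m(2)] unfolding mult_def G by simp
  qed
  have mulI: "mult C G a b = c" if abc: "a \<in> hom C X A" "b \<in> hom C X A" "c \<in> hom C X A" and M: "M a b c" for a b c X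
    using M_functional[OF abc(1,2) _ abc(3) _ M] mul[OF abc(1,2) M_composable[OF abc M]] by blast
  note sI = s_hom Comp_Ident_right[OF s_hom] and tI = t_hom Comp_Ident_right[OF t_hom]
  have "internal_category C G" unfolding internal_category_def
  proof (intro conjI)
    show "C0 G \<in> Obj C" "C1 G \<in> Obj C" "src G \<in> hom C (C1 G) (C0 G)" "tgt G \<in> hom C (C1 G) (C0 G)"
      "idn G \<in> hom C (C0 G) (C1 G)" "cmp G \<in> hom C (composable C G) (C1 G)"
      unfolding G using A uh homD(4)[OF uh] \<sigma>(1) \<tau>(1) m(1) by simp_all
    have Du: "Ident C ?D \<in> hom C ?D ?D" "u \<cdot> Ident C ?D = u"
      using Ident_in_hom[OF homD(4)[OF uh]] Comp_Ident_right[OF uh] .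
    have "U u" using U_iff[OF uh] Du by blast
    then have "s \<cdot> u = u" "t \<cdot> u = u" using unit_source_target[OF uh] by blast+
    then show "src G \<cdot> idn G = Ident C (C0 G)" "tgt G \<cdot> idn G = Ident C (C0 G)"
      unfolding G using cancel_u[OF _ u\<sigma>(3)[OF uh] Du(1)] cancel_u[OF _ u\<sigma>(4)[OF uh] Du(1)] u\<sigma>(1,2)[OF uh] Du(2)
      by simp_all
    note sm = M_source_target[OF f(1,2) m]
    show "src G \<cdot> cmp G = src G \<cdot> second C G" "tgt G \<cdot> cmp G = tgt G \<cdot> first C G"
      unfolding G using cancel_u[OF _ u\<sigma>(3)[OF m(1)] u\<sigma>(3)[OF f(2)]] cancel_u[OF _ u\<sigma>(4)[OF m(1)] u\<sigma>(4)[OF f(1)]]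
        u\<sigma>(1)[OF m(1)] u\<sigma>(1)[OF f(2)] u\<sigma>(2)[OF m(1)] u\<sigma>(2)[OF f(1)] sm by simp_all
    show "mult C G (idn G \<cdot> tgt G) (Ident C (C1 G)) = Ident C (C1 G)"
      using mulI[OF t_hom I I t_Ident(2)] unfolding G \<tau>(2) .
    show "mult C G (Ident C (C1 G)) (idn G \<cdot> src G) = Ident C (C1 G)"
      using mulI[OF I s_hom I s_Ident(2)] unfolding G \<sigma>(2) .
    show "let ab = pb1 C (src G \<cdot> second C G) (tgt G);
          a = first C G \<cdot> ab; b = second C G \<cdot> ab; c = pb2 C (src G \<cdot> second C G) (tgt G)
      in mult C G (mult C G a b) c = mult C G a (mult C G b c)"
    proof -
      let ?ab = "pb1 C (\<sigma> \<cdot> ?f2) \<tau>" and ?c = "pb2 C (\<sigma> \<cdot> ?f2) \<tau>" and ?T = "pb C (\<sigma> \<cdot> ?f2) \<tau>"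
      let ?a = "?f1 \<cdot> ?ab" and ?b = "?f2 \<cdot> ?ab"
      have h: "?ab \<in> hom C ?T ?P" "?c \<in> hom C ?T A" "(\<sigma> \<cdot> ?f2) \<cdot> ?ab = \<tau> \<cdot> ?c"
        using f(2) \<sigma>(1) \<tau>(1) pb_commutes[of "\<sigma> \<cdot> ?f2" \<tau>] by (simp_all add: hom_def)
      have ab: "?a \<in> hom C ?T A" "?b \<in> hom C ?T A" using h f by (simp_all add: hom_def)
      have bc: "\<sigma> \<cdot> ?b = \<tau> \<cdot> ?c" using h f(2) \<sigma>(1) by (simp add: hom_def)
      have "\<sigma> \<cdot> ?a = (\<tau> \<cdot> ?f2) \<cdot> ?ab"
        using Comp_reassoc[OF f(3), of ?ab] f(1) \<sigma>(1) h(1) by (simp add: hom_def)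
      then have ab': "\<sigma> \<cdot> ?a = \<tau> \<cdot> ?b" using f(2) \<tau>(1) h(1) by (simp add: hom_def)
      have sab: "s \<cdot> ?a = t \<cdot> ?b" and sbc: "s \<cdot> ?b = t \<cdot> ?c"
        using comp_iff[OF ab] comp_iff[OF ab(2) h(2)] ab' bc by blast+
      note mab = mul[OF ab sab] and mbc = mul[OF ab(2) h(2) sbc]
      have s1: "s \<cdot> mult C G ?a ?b = t \<cdot> ?c" using M_source_target(1)[OF ab mab] sbc by simp
      have s2: "s \<cdot> ?a = t \<cdot> mult C G ?b ?c" using M_source_target(2)[OF ab(2) h(2) mbc] sab by simp
      note l = mul[OF mab(1) h(2) s1] and r = mul[OF ab(1) mbc(1) s2]
      let ?z = "mult C G (mult C G ?a ?b) ?c"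
      obtain Y e y where e: "e \<in> hom C Y ?T" "regular_epi C e" and y: "y \<in> hom C Y A"
        "M (?b \<cdot> e) (?c \<cdot> e) y" "M (?a \<cdot> e) y (?z \<cdot> e)"
        by (rule M_assoc[OF ab h(2) l(1) mab(1) mab(2) l(2)])
      have "y = mult C G ?b ?c \<cdot> e"
        by (rule M_functional[OF A_Comp[OF ab(2) e(1)] A_Comp[OF h(2) e(1)] y(1) A_Comp[OF mbc(1) e(1)] y(2)
            M_Comp[OF ab(2) h(2) mbc(1) e(1) mbc(2)]])
      then have "M ?a (mult C G ?b ?c) ?z" using M_local[OF ab(1) mbc(1) l(1) e] y(3) by simp
      then have "?z = mult C G ?a (mult C G ?b ?c)"
        using M_functional[OF ab(1) mbc(1) l(1) r(1) _ r(2)] by blast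
      then show ?thesis unfolding Let_def G .
    qed
  qed
  moreover have "s \<cdot> i = t" "t \<cdot> i = s"
    using M_composable[OF i(1) I s_hom i(2)] M_composable[OF I i(1) t_hom i(3)] sI(2) tI(2) by simp_all
  then have "src G \<cdot> invn G = tgt G" "tgt G \<cdot> invn G = src G"
    unfolding G using cancel_u[OF _ u\<sigma>(3)[OF i(1)] \<tau>(1)] cancel_u[OF _ u\<sigma>(4)[OF i(1)] \<sigma>(1)]
      u\<sigma>(1,2)[OF i(1)] \<sigma>(2) \<tau>(2) by simp_all
  moreover have "mult C G (invn G) (Ident C (C1 G)) = idn G \<cdot> src G"
    "mult C G (Ident C (C1 G)) (invn G) = idn G \<cdot> tgt G"
    using mulI[OF i(1) I s_hom i(2)] mulI[OF I i(1) t_hom i(3)] unfolding G \<sigma>(2) \<tau>(2) .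
  ultimately have "internal_groupoid C G" unfolding internal_groupoid_def using i(1) G(2,7) by simp
  moreover have "\<mu> = composition_rel C G"
  proof (rule relation_eqI)
    note cr = composition_rel_sat[OF st mh]
    show "\<mu> \<in> relations C" "composition_rel C G \<in> relations C"
      "rdom \<mu> = rdom (composition_rel C G)" "rcod \<mu> = rcod (composition_rel C G)"
      using \<mu> cr(1-3) by simp_all
    have "\<forall>z \<in> hom C X (prd C A A). \<forall>c \<in> hom C X A. sat \<mu> z c \<longleftrightarrow> sat (composition_rel C G) z c" for X
      unfolding all_prd[OF A A]
    proof (intro ballI)
      fix a b c assume abc: "a \<in> hom C X A" "b \<in> hom C X A" "c \<in> hom C X A"
      have "M a b c \<longleftrightarrow> s \<cdot> a = t \<cdot> b \<and> mult C G a b = c"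
        using mul[OF abc(1,2)] mulI[OF abc] M_composable[OF abc] by blast
      then show "sat \<mu> (pair C a b) c \<longleftrightarrow> sat (composition_rel C G) (pair C a b) c"
        using cr(4)[OF abc] comp_iff[OF abc(1,2)] unfolding multiplies_def G by simp
    qed
    then show "sat \<mu> z c \<longleftrightarrow> sat (composition_rel C G) z c"
      if "z \<in> hom C X (rdom (composition_rel C G))" "c \<in> hom C X (rcod (composition_rel C G))" for X z c
      using that unfolding cr(2,3) by blast
  qed
  ultimately show ?thesis unfolding groupoid_from_frobenius_def using G by auto
qed

end

section \<open>From groupoids to Frobenius structures\<close>

locale internal_groupoid_in = regular_category C for C :: "('o, 'm, 'z) category_scheme" (structure) +
  fixes G :: "('o, 'm) internal_groupoid"
  assumes groupoid: "internal_groupoid C G"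
begin

abbreviation "A \<equiv> C1 G"
abbreviation "D \<equiv> C0 G"

lemma arrows:
  "D \<in> Obj C" "A \<in> Obj C" "src G \<in> hom C A D" "tgt G \<in> hom C A D" "idn G \<in> hom C D A"
  "cmp G \<in> hom C (composable C G) A" "invn G \<in> hom C A A"
  using groupoid unfolding internal_groupoid_def internal_category_def by auto

lemmas G_mult = mult_simps[OF arrows(3,4,6)]

lemma src_idn: "src G \<cdot> idn G = Ident C D" and tgt_idn: "tgt G \<cdot> idn G = Ident C D"
  using groupoid unfolding internal_groupoid_def internal_category_def by auto

lemma hom_el:
  assumes "a \<in> hom C X A"
  shows "src G \<cdot> a \<in> hom C X D" "tgt G \<cdot> a \<in> hom C X D" "invn G \<cdot> a \<in> hom C X A"
  using assms arrows by (simp_all add: hom_def)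

lemma idn_el: "y \<in> hom C X D \<Longrightarrow> idn G \<cdot> y \<in> hom C X A"
  using arrows by (simp add: hom_def)

lemma unit_el:
  assumes "y \<in> hom C X D"
  shows "src G \<cdot> (idn G \<cdot> y) = y" "tgt G \<cdot> (idn G \<cdot> y) = y"
  using Comp_reassoc[OF src_idn, of y] Comp_reassoc[OF tgt_idn, of y] assms arrows
  by (simp_all add: hom_def)

lemma monic_idn: "monic C (idn G)"
  unfolding monic_def
proof (intro conjI allI ballI impI)
  show "idn G \<in> Arr C" using arrows by (simp add: hom_def)
  fix X f g assume f: "f \<in> hom C X (Dom C (idn G))" "g \<in> hom C X (Dom C (idn G))" "idn G \<cdot> f = idn G \<cdot> g"
  then have "f \<in> hom C X D" "g \<in> hom C X D" using arrows(5) by (simp_all add: hom_def)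
  then show "f = g" using unit_el(1) f(3) by metis
qed

lemma mult_source_target:
  assumes ab: "a \<in> hom C X A" "b \<in> hom C X A" "src G \<cdot> a = tgt G \<cdot> b"
  shows "src G \<cdot> mult C G a b = src G \<cdot> b" "tgt G \<cdot> mult C G a b = tgt G \<cdot> a"
proof -
  have eq: "src G \<cdot> cmp G = src G \<cdot> second C G" "tgt G \<cdot> cmp G = tgt G \<cdot> first C G"
    using groupoid unfolding internal_groupoid_def internal_category_def by auto
  note k = G_mult(3)[OF ab]
  let ?k = "pb_pair C (src G) (tgt G) a b"
  have ty: "src G \<in> Arr C" "tgt G \<in> Arr C" "Dom C (src G) = A" "Dom C (tgt G) = A" "cmp G \<in> Arr C" "Cod C (cmp G) = A"
    "Dom C (cmp G) = composable C G" "?k \<in> Arr C" "Cod C ?k = composable C G" "Cod C (src G) = D" "Cod C (tgt G) = D"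
    using arrows k by (simp_all add: hom_def)
  have p: "first C G \<cdot> ?k = a" "second C G \<cdot> ?k = b" using ab ty by (simp_all add: hom_def)
  show "src G \<cdot> mult C G a b = src G \<cdot> b"
    unfolding mult_def using Comp_reassoc[OF eq(1), of ?k] p ty by simp
  show "tgt G \<cdot> mult C G a b = tgt G \<cdot> a"
    unfolding mult_def using Comp_reassoc[OF eq(2), of ?k] p ty by simp
qed

lemma unit_mult:
  assumes a: "a \<in> hom C X A"
  shows "mult C G (idn G \<cdot> (tgt G \<cdot> a)) a = a" "mult C G a (idn G \<cdot> (src G \<cdot> a)) = a"
proof -
  note I = Ident_in_hom[OF arrows(2)]
  have eq: "mult C G (idn G \<cdot> tgt G) (Ident C A) = Ident C A" "mult C G (Ident C A) (idn G \<cdot> src G) = Ident C A"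
    using groupoid unfolding internal_groupoid_def internal_category_def by auto
  have ty: "idn G \<cdot> tgt G \<in> hom C A A" "idn G \<cdot> src G \<in> hom C A A"
    using arrows by (simp_all add: hom_def)
  have st: "src G \<cdot> (idn G \<cdot> tgt G) = tgt G \<cdot> Ident C A" "src G \<cdot> Ident C A = tgt G \<cdot> (idn G \<cdot> src G)"
    using unit_el arrows Comp_Ident_right by metis+
  have "mult C G (idn G \<cdot> tgt G) (Ident C A) \<cdot> a = mult C G (idn G \<cdot> (tgt G \<cdot> a)) a"
    "mult C G (Ident C A) (idn G \<cdot> src G) \<cdot> a = mult C G a (idn G \<cdot> (src G \<cdot> a))"
    using G_mult(2)[OF ty(1) I st(1) a] G_mult(2)[OF I ty(2) st(2) a] a arrows by (simp_all add: hom_def)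
  then show "mult C G (idn G \<cdot> (tgt G \<cdot> a)) a = a" "mult C G a (idn G \<cdot> (src G \<cdot> a)) = a"
    unfolding eq using Comp_Ident_left[OF a] by simp_all
qed

lemma inverse_mult:
  assumes a: "a \<in> hom C X A"
  shows "src G \<cdot> (invn G \<cdot> a) = tgt G \<cdot> a" "tgt G \<cdot> (invn G \<cdot> a) = src G \<cdot> a"
    "mult C G (invn G \<cdot> a) a = idn G \<cdot> (src G \<cdot> a)" "mult C G a (invn G \<cdot> a) = idn G \<cdot> (tgt G \<cdot> a)"
proof -
  note I = Ident_in_hom[OF arrows(2)]
  have eq: "src G \<cdot> invn G = tgt G" "tgt G \<cdot> invn G = src G"
    "mult C G (invn G) (Ident C A) = idn G \<cdot> src G" "mult C G (Ident C A) (invn G) = idn G \<cdot> tgt G"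
    using groupoid unfolding internal_groupoid_def by auto
  show "src G \<cdot> (invn G \<cdot> a) = tgt G \<cdot> a" "tgt G \<cdot> (invn G \<cdot> a) = src G \<cdot> a"
    using Comp_reassoc[OF eq(1), of a] Comp_reassoc[OF eq(2), of a] arrows a by (simp_all add: hom_def)
  have st: "src G \<cdot> invn G = tgt G \<cdot> Ident C A" "src G \<cdot> Ident C A = tgt G \<cdot> invn G"
    using eq Comp_Ident_right arrows by metis+
  have "mult C G (invn G) (Ident C A) \<cdot> a = mult C G (invn G \<cdot> a) a"
    "mult C G (Ident C A) (invn G) \<cdot> a = mult C G a (invn G \<cdot> a)"
    using G_mult(2)[OF arrows(7) I st(1) a] G_mult(2)[OF I arrows(7) st(2) a] Comp_Ident_left[OF a] by simp_all
  then show "mult C G (invn G \<cdot> a) a = idn G \<cdot> (src G \<cdot> a)" "mult C G a (invn G \<cdot> a) = idn G \<cdot> (tgt G \<cdot> a)"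
    unfolding eq using a arrows by (simp_all add: hom_def)
qed

text \<open>
  The associativity equation concerns the generic composable triple; every composable triple of
  elements is obtained from it by substitution.
\<close>

lemma mult_assoc:
  assumes abc: "a \<in> hom C X A" "b \<in> hom C X A" "c \<in> hom C X A"
    and st: "src G \<cdot> a = tgt G \<cdot> b" "src G \<cdot> b = tgt G \<cdot> c"
  shows "mult C G (mult C G a b) c = mult C G a (mult C G b c)"
proof -
  note fs = mult_first_second[OF arrows(3,4,6)]
  let ?f = "src G \<cdot> second C G"
  have f: "?f \<in> hom C (composable C G) D" using fs arrows by (simp add: hom_def)
  have ty: "?f \<in> Arr C" "tgt G \<in> Arr C" "Cod C ?f = Cod C (tgt G)" "Dom C ?f = composable C G" "Dom C (tgt G) = A"
    using f arrows by (simp_all add: hom_def)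
  let ?ab = "pb1 C ?f (tgt G)" and ?c = "pb2 C ?f (tgt G)" and ?T = "pb C ?f (tgt G)"
  let ?a = "first C G \<cdot> ?ab" and ?b = "second C G \<cdot> ?ab"
  have h: "?ab \<in> hom C ?T (composable C G)" "?c \<in> hom C ?T A" "?f \<cdot> ?ab = tgt G \<cdot> ?c"
    using ty pb_commutes[OF ty(1-3)] by (simp_all add: hom_def)
  have ab: "?a \<in> hom C ?T A" "?b \<in> hom C ?T A" using h(1) fs(1,2) by (simp_all add: hom_def)
  have st2: "src G \<cdot> ?b = tgt G \<cdot> ?c" using h fs(2) arrows(3) by (simp add: hom_def)
  have st1: "src G \<cdot> ?a = tgt G \<cdot> ?b"
    using Comp_reassoc[OF fs(3), of ?ab] h(1) fs(1,2) arrows(3,4) by (simp add: hom_def)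
  have eq: "mult C G (mult C G ?a ?b) ?c = mult C G ?a (mult C G ?b ?c)"
    using groupoid unfolding internal_groupoid_def internal_category_def Let_def by blast
  \<comment> \<open>\<open>w\<close> is the given triple as an element of the object of composable triples\<close>
  note k = G_mult(3)[OF abc(1,2) st(1)]
  let ?k = "pb_pair C (src G) (tgt G) a b"
  have kk: "first C G \<cdot> ?k = a" "second C G \<cdot> ?k = b"
    using arrows(3,4) abc st by (simp_all add: hom_def)
  have fk: "?f \<cdot> ?k = tgt G \<cdot> c" using kk fs(2) arrows(3) k st(2) by (simp add: hom_def)
  have ch: "c \<in> hom C X (Dom C (tgt G))" and kh: "?k \<in> hom C X (Dom C ?f)" using abc(3) k ty by simp_all
  obtain w where w: "w \<in> hom C X ?T" "?ab \<cdot> w = ?k" "?c \<cdot> w = c"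
    using pb_pair_unique[OF ty(1-3) kh ch fk] by blast
  have aw: "?a \<cdot> w = a" "?b \<cdot> w = b" using w(1,2) kk h(1) fs(1,2) by (simp_all add: hom_def)
  have s1: "src G \<cdot> mult C G ?a ?b = tgt G \<cdot> ?c" and s2: "src G \<cdot> ?a = tgt G \<cdot> mult C G ?b ?c"
    using mult_source_target[OF ab st1] mult_source_target[OF ab(2) h(2) st2] st1 st2 by simp_all
  note m1 = G_mult[OF ab st1] and m2 = G_mult[OF ab(2) h(2) st2]
  have "mult C G (mult C G ?a ?b) ?c \<cdot> w = mult C G (mult C G a b) c"
    using G_mult(2)[OF m1(1) h(2) s1 w(1)] m1(2)[OF w(1)] aw w(3) by simp
  moreover have "mult C G ?a (mult C G ?b ?c) \<cdot> w = mult C G a (mult C G b c)"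
    using G_mult(2)[OF ab(1) m2(1) s2 w(1)] m2(2)[OF w(1)] aw w(3) by simp
  ultimately show ?thesis using eq by simp
qed

abbreviation "M a b c \<equiv> src G \<cdot> a = tgt G \<cdot> b \<and> mult C G a b = c"

text \<open>
  In a groupoid, the two sides of associativity and of the Frobenius law have explicit witnesses over any
  stage, so only statements without covers remain to be checked: if \<open>x d = b\<close> and \<open>a x = c\<close>, then
  \<open>y = x\<^sup>-\<^sup>1\<close> satisfies \<open>c y = a\<close> and \<open>y b = d\<close>, and conversely.
\<close>

lemma M_assoc_left:
  assumes "a \<in> hom C X A" "b \<in> hom C X A" "c \<in> hom C X A" "M a b x" "M x c d"
  shows "\<exists>y \<in> hom C X A. M b c y \<and> M a y d"
  using assms mult_assoc mult_source_target G_mult(1) by metis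

lemma M_assoc_right:
  assumes "a \<in> hom C X A" "b \<in> hom C X A" "c \<in> hom C X A" "M b c x" "M a x d"
  shows "\<exists>y \<in> hom C X A. M a b y \<and> M y c d"
  using assms mult_assoc mult_source_target G_mult(1) by metis

lemma M_inverse_left:
  assumes h: "x \<in> hom C X A" "d \<in> hom C X A" and m: "M x d b"
  shows "M (invn G \<cdot> x) b d"
proof -
  note i = inverse_mult[OF h(1)] and ix = hom_el(3)[OF h(1)]
  have "mult C G (invn G \<cdot> x) (mult C G x d) = mult C G (mult C G (invn G \<cdot> x) x) d"
    using mult_assoc[OF ix h i(1)] m by simp
  also have "\<dots> = d" using i(3) m unit_mult(1)[OF h(2)] by simp
  finally show ?thesis using m i(1) mult_source_target(2)[OF h] by auto
qed

lemma M_inverse_right: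
  assumes h: "a \<in> hom C X A" "x \<in> hom C X A" and m: "M a x c"
  shows "M c (invn G \<cdot> x) a"
proof -
  note i = inverse_mult[OF h(2)] and ix = hom_el(3)[OF h(2)]
  have "mult C G (mult C G a x) (invn G \<cdot> x) = mult C G a (mult C G x (invn G \<cdot> x))"
    using mult_assoc[OF h ix conjunct1[OF m] i(2)[symmetric]] .
  also have "\<dots> = a" using i(4) m unit_mult(2)[OF h(1)] by simp
  finally show ?thesis using m i(2) mult_source_target(1)[OF h] by auto
qed

lemmas comp_sat = composition_rel_sat[OF arrows(3,4,6)]
lemmas unit_sat = state_rel_sat[OF monic_idn arrows(5)]

lemma unit_element_iff:
  assumes x: "x \<in> hom C X A"
  shows "unit_element (state_rel C (idn G)) x \<longleftrightarrow> idn G \<cdot> (src G \<cdot> x) = x"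
    "unit_element (state_rel C (idn G)) x \<longleftrightarrow> idn G \<cdot> (tgt G \<cdot> x) = x"
  unfolding unit_sat(4)[OF x] using unit_el hom_el[OF x] by metis+

lemma idn_src_unique:
  assumes "a \<in> hom C X A" "x \<in> hom C X A" "unit_element (state_rel C (idn G)) x" "M a x a"
  shows "idn G \<cdot> (src G \<cdot> a) = x"
  using assms unit_element_iff by simp

lemma idn_tgt_unique:
  assumes "a \<in> hom C X A" "x \<in> hom C X A" "unit_element (state_rel C (idn G)) x" "M x a a"
  shows "idn G \<cdot> (tgt G \<cdot> a) = x"
  using assms unit_element_iff[OF assms(2)] by metis

text \<open>
  In the laws that assert an equality, the equality is obtained on a cover and cancelled; the converse
  witnesses are obtained from the identities \<open>idn G \<cdot> (src G \<cdot> a)\<close> and \<open>idn G \<cdot> (tgt G \<cdot> a)\<close>.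
\<close>

lemma frobenius: "special_dagger_frobenius (Rel C) A (composition_rel C G) (state_rel C (idn G))"
proof -
  interpret F: frobenius_data C A "composition_rel C G" "state_rel C (idn G)"
    by unfold_locales (use arrows(2) comp_sat(1-3) unit_sat(1-3) in simp_all)
  note MM = comp_sat(4)
  have el: "a \<cdot> e \<in> hom C Y A" if "a \<in> hom C X A" "e \<in> hom C Y X" for a e X Y
    using Comp_in_hom that by blast
  have cancel: "a = c" if "e \<in> hom C Y X" "regular_epi C e" "a \<in> hom C X A" "c \<in> hom C X A" "a \<cdot> e = c \<cdot> e" for a c e X Y
    using cover_cancel that by blast
  show ?thesis unfolding F.special_dagger_frobenius_iff
  proof (intro conjI allI ballI)
    fix X a c assume a: "a \<in> hom C X A" and c: "c \<in> hom C X A"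
    show "internal_ex X A (\<lambda>e x. F.U x \<and> F.M (a \<cdot> e) x (c \<cdot> e)) \<longleftrightarrow> a = c"
    proof
      assume "internal_ex X A (\<lambda>e x. F.U x \<and> F.M (a \<cdot> e) x (c \<cdot> e))"
      then obtain Y e x where e: "e \<in> hom C Y X" "regular_epi C e" and x: "x \<in> hom C Y A"
        "F.U x" "F.M (a \<cdot> e) x (c \<cdot> e)" by (auto elim: internal_exE)
      have "M (a \<cdot> e) x (c \<cdot> e)" using x MM[OF el[OF a e(1)] x(1) el[OF c e(1)]] by simp
      then have "a \<cdot> e = c \<cdot> e"
        using unit_element_iff(2)[OF x(1)] x(2) unit_mult(2)[OF el[OF a e(1)]] by simp
      then show "a = c" using cancel[OF e a c] by simp
    next
      assume "a = c"
      let ?x = "idn G \<cdot> (src G \<cdot> a)"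
      have x: "?x \<in> hom C X A" using idn_el hom_el(1)[OF a] by blast
      have "F.U ?x" unfolding unit_element_iff(1)[OF x] using unit_el(1)[OF hom_el(1)[OF a]] by simp
      moreover have "F.M a ?x a" unfolding MM[OF a x a]
        using unit_el(2)[OF hom_el(1)[OF a]] unit_mult(2)[OF a] by simp
      ultimately show "internal_ex X A (\<lambda>e x. F.U x \<and> F.M (a \<cdot> e) x (c \<cdot> e))"
        using \<open>a = c\<close> Comp_Ident_right[OF a] by (intro internal_exI[OF x]) simp
    qed
    show "internal_ex X A (\<lambda>e x. F.U x \<and> F.M x (a \<cdot> e) (c \<cdot> e)) \<longleftrightarrow> a = c"
    proof
      assume "internal_ex X A (\<lambda>e x. F.U x \<and> F.M x (a \<cdot> e) (c \<cdot> e))"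
      then obtain Y e x where e: "e \<in> hom C Y X" "regular_epi C e" and x: "x \<in> hom C Y A"
        "F.U x" "F.M x (a \<cdot> e) (c \<cdot> e)" by (auto elim: internal_exE)
      have "M x (a \<cdot> e) (c \<cdot> e)" using x MM[OF x(1) el[OF a e(1)] el[OF c e(1)]] by simp
      then have "a \<cdot> e = c \<cdot> e"
        using unit_element_iff(1)[OF x(1)] x(2) unit_mult(1)[OF el[OF a e(1)]] by simp
      then show "a = c" using cancel[OF e a c] by simp
    next
      assume "a = c"
      let ?x = "idn G \<cdot> (tgt G \<cdot> a)"
      have x: "?x \<in> hom C X A" using idn_el hom_el(2)[OF a] by blast
      have "F.U ?x" unfolding unit_element_iff(1)[OF x] using unit_el(1)[OF hom_el(2)[OF a]] by simp
      moreover have "F.M ?x a a" unfolding MM[OF x a a]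
        using unit_el(1)[OF hom_el(2)[OF a]] unit_mult(1)[OF a] by simp
      ultimately show "internal_ex X A (\<lambda>e x. F.U x \<and> F.M x (a \<cdot> e) (c \<cdot> e))"
        using \<open>a = c\<close> Comp_Ident_right[OF a] by (intro internal_exI[OF x]) simp
    qed
    show "(\<exists>Y e x y. e \<in> hom C Y X \<and> regular_epi C e \<and> x \<in> hom C Y A \<and> y \<in> hom C Y A \<and>
         F.M x y (a \<cdot> e) \<and> F.M x y (c \<cdot> e)) \<longleftrightarrow> a = c"
    proof
      assume "\<exists>Y e x y. e \<in> hom C Y X \<and> regular_epi C e \<and> x \<in> hom C Y A \<and> y \<in> hom C Y A \<and>
         F.M x y (a \<cdot> e) \<and> F.M x y (c \<cdot> e)"
      then obtain Y e x y where e: "e \<in> hom C Y X" "regular_epi C e" and x: "x \<in> hom C Y A" "y \<in> hom C Y A"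
        "F.M x y (a \<cdot> e)" "F.M x y (c \<cdot> e)" by blast
      have "a \<cdot> e = c \<cdot> e" using x(3,4) MM[OF x(1,2) el[OF a e(1)]] MM[OF x(1,2) el[OF c e(1)]] by simp
      then show "a = c" using cancel[OF e a c] by simp
    next
      assume "a = c"
      let ?x = "idn G \<cdot> (tgt G \<cdot> a)"
      have x: "?x \<in> hom C X A" using idn_el hom_el(2)[OF a] by blast
      have "F.M ?x a a" unfolding MM[OF x a a]
        using unit_el(1)[OF hom_el(2)[OF a]] unit_mult(1)[OF a] by simp
      then have "F.M ?x a (a \<cdot> Ident C X) \<and> F.M ?x a (c \<cdot> Ident C X)"
        using \<open>a = c\<close> Comp_Ident_right[OF a] by simp
      then show "\<exists>Y e x y. e \<in> hom C Y X \<and> regular_epi C e \<and> x \<in> hom C Y A \<and> y \<in> hom C Y A \<and>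
         F.M x y (a \<cdot> e) \<and> F.M x y (c \<cdot> e)"
        using x a Ident_in_hom[OF homD(4)[OF a]] regular_epi_Ident[OF homD(4)[OF a]] by blast
    qed
  next
    fix X a b c d assume h: "a \<in> hom C X A" "b \<in> hom C X A" "c \<in> hom C X A" "d \<in> hom C X A"
    show "internal_ex X A (\<lambda>e x. F.M (a \<cdot> e) (b \<cdot> e) x \<and> F.M x (c \<cdot> e) (d \<cdot> e)) \<longleftrightarrow>
      internal_ex X A (\<lambda>e x. F.M (b \<cdot> e) (c \<cdot> e) x \<and> F.M (a \<cdot> e) x (d \<cdot> e))"
    proof (intro iffI; elim internal_ex_mono)
      fix Y e x assume e: "e \<in> hom C Y X" and x: "x \<in> hom C Y A"
      note he = h[THEN el, OF e]
      show "\<exists>y \<in> hom C Y A. F.M (b \<cdot> e) (c \<cdot> e) y \<and> F.M (a \<cdot> e) y (d \<cdot> e)"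
        if "F.M (a \<cdot> e) (b \<cdot> e) x \<and> F.M x (c \<cdot> e) (d \<cdot> e)"
        using M_assoc_left[OF he(1-3), of x "d \<cdot> e"] that MM he x by (simp cong: bex_cong)
      show "\<exists>y \<in> hom C Y A. F.M (a \<cdot> e) (b \<cdot> e) y \<and> F.M y (c \<cdot> e) (d \<cdot> e)"
        if "F.M (b \<cdot> e) (c \<cdot> e) x \<and> F.M (a \<cdot> e) x (d \<cdot> e)"
        using M_assoc_right[OF he(1-3), of x "d \<cdot> e"] that MM he x by (simp cong: bex_cong)
    qed
    show "internal_ex X A (\<lambda>e x. F.M x (d \<cdot> e) (b \<cdot> e) \<and> F.M (a \<cdot> e) x (c \<cdot> e)) \<longleftrightarrow>
      internal_ex X A (\<lambda>e y. F.M (c \<cdot> e) y (a \<cdot> e) \<and> F.M y (b \<cdot> e) (d \<cdot> e))"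
    proof (intro iffI; elim internal_ex_mono)
      fix Y e x assume e: "e \<in> hom C Y X" and x: "x \<in> hom C Y A"
      note he = h[THEN el, OF e]
      note ix = hom_el(3)[OF x]
      \<comment> \<open>the witness on either side is the inverse of the one on the other side\<close>
      show "\<exists>y \<in> hom C Y A. F.M (c \<cdot> e) y (a \<cdot> e) \<and> F.M y (b \<cdot> e) (d \<cdot> e)"
        if "F.M x (d \<cdot> e) (b \<cdot> e) \<and> F.M (a \<cdot> e) x (c \<cdot> e)"
        using M_inverse_left[OF x he(4)] M_inverse_right[OF he(1) x] that MM he x ix by (intro bexI[OF _ ix]) simp
      show "\<exists>y \<in> hom C Y A. F.M y (d \<cdot> e) (b \<cdot> e) \<and> F.M (a \<cdot> e) y (c \<cdot> e)"
        if "F.M (c \<cdot> e) x (a \<cdot> e) \<and> F.M x (b \<cdot> e) (d \<cdot> e)"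
        using M_inverse_left[OF x he(2)] M_inverse_right[OF he(3) x] that MM he x ix by (intro bexI[OF _ ix]) simp
    qed
  qed
qed

end

section \<open>Groupoids with the same composition relation\<close>

context regular_category begin

text \<open>
  The composition relation and the subobject of identities determine the rest of the structure: the
  identity at the source of \<open>a\<close> is the only unit \<open>x\<close> with \<open>a x = a\<close>, dually for targets, and inverses
  are determined by products and units.  It suffices to consider the generic element \<open>Ident C (C1 G)\<close>.
\<close>

lemma groupoids_agree:
  fixes G H :: "('a, 'b) internal_groupoid"
  assumes G: "internal_groupoid C G" and H: "internal_groupoid C H" and A: "C1 H = C1 G"
    and \<mu>: "composition_rel C H = composition_rel C G"
    and \<eta>: "state_rel C (idn H) = state_rel C (idn G)"
  shows "idn H \<cdot> src H = idn G \<cdot> src G" "idn H \<cdot> tgt H = idn G \<cdot> tgt G" "invn H = invn G"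
    "mult C G (first C H) (second C H) = cmp H"
proof -
  interpret G: internal_groupoid_in C G using G by unfold_locales
  interpret H: internal_groupoid_in C H using H by unfold_locales
  note GM = G.comp_sat(4) and HM = H.comp_sat(4)[unfolded A \<mu>]
  note Hs = H.arrows[unfolded A]
  have M: "G.M a b c \<longleftrightarrow> H.M a b c" if "a \<in> hom C X (C1 G)" "b \<in> hom C X (C1 G)" "c \<in> hom C X (C1 G)" for a b c X
    using GM[OF that] HM[OF that] by simp
  let ?I = "Ident C (C1 G)"
  have I: "?I \<in> hom C (C1 G) (C1 G)" using Ident_in_hom G.arrows(2) by blast
  have I': "?I \<in> hom C (C1 H) (C1 H)" using I A by simp
  have cI: "src G \<cdot> ?I = src G" "tgt G \<cdot> ?I = tgt G" "src H \<cdot> ?I = src H" "tgt H \<cdot> ?I = tgt H" "invn H \<cdot> ?I = invn H"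
    using Comp_Ident_right G.arrows(3,4) Hs(3,4,7) by blast+
  have s: "idn H \<cdot> src H \<in> hom C (C1 G) (C1 G)" and t: "idn H \<cdot> tgt H \<in> hom C (C1 G) (C1 G)"
    using Comp_in_hom Hs(3-5) by blast+
  have s': "idn H \<cdot> src H \<in> hom C (C1 G) (C1 H)" and t': "idn H \<cdot> tgt H \<in> hom C (C1 G) (C1 H)" using s t A by simp_all
  have U: "unit_element (state_rel C (idn G)) (idn H \<cdot> src H)" "unit_element (state_rel C (idn G)) (idn H \<cdot> tgt H)"
    using H.unit_sat(4)[OF s'] H.unit_sat(4)[OF t'] Hs(3,4) unfolding \<eta> by blast+
  have "H.M ?I (idn H \<cdot> src H) ?I" "H.M (idn H \<cdot> tgt H) ?I ?I"
    using H.unit_el H.unit_mult[OF I'] Hs(3,4) cI by auto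
  then have "G.M ?I (idn H \<cdot> src H) ?I" "G.M (idn H \<cdot> tgt H) ?I ?I" using M I s t by blast+
  then show ss: "idn H \<cdot> src H = idn G \<cdot> src G" and tt: "idn H \<cdot> tgt H = idn G \<cdot> tgt G"
    using G.idn_src_unique[OF I s U(1)] G.idn_tgt_unique[OF I t U(2)] cI by simp_all
  have "H.M (invn H) ?I (idn H \<cdot> src H)" using H.inverse_mult[OF I'] cI by simp
  then have m: "G.M (invn H) ?I (idn G \<cdot> src G)" using M[OF Hs(7) I s] ss by simp
  have ms: "G.M (idn G \<cdot> src G) (invn G) (invn H)"
    using G.M_inverse_right[OF Hs(7) I m] Comp_Ident_right[OF G.arrows(7)] by simp
  have "tgt G \<cdot> invn G = src G" using G.inverse_mult(2)[OF I] cI Comp_Ident_right[OF G.arrows(7)] by simp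
  then show "invn H = invn G" using ms G.unit_mult(1)[OF G.arrows(7)] by simp
  note fs = mult_first_second[OF Hs(3,4,6)]
  show "mult C G (first C H) (second C H) = cmp H"
    using M[OF fs(1,2) Hs(6)] fs(3,4) by blast
qed

lemma groupoids_eq:
  fixes G H :: "('a, 'b) internal_groupoid"
  assumes G: "internal_groupoid C G" and H: "internal_groupoid C H" and A: "C1 H = C1 G"
    and \<mu>: "composition_rel C H = composition_rel C G" and u: "idn H = idn G" and D: "C0 H = C0 G"
  shows "H = G"
proof -
  interpret G: internal_groupoid_in C G using G by unfold_locales
  interpret H: internal_groupoid_in C H using H by unfold_locales
  note Hs = H.arrows[unfolded A D]
  have \<eta>: "state_rel C (idn H) = state_rel C (idn G)" using u by simp
  note agree = groupoids_agree[OF G H A \<mu> \<eta>]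
  have dom: "Dom C (idn G) = C0 G" using homD(2)[OF G.arrows(5)] .
  have s: "src H = src G"
    by (rule monicD[OF G.monic_idn, unfolded dom]) (use agree(1) u Hs(3) G.arrows(3) in simp_all)
  have t: "tgt H = tgt G"
    by (rule monicD[OF G.monic_idn, unfolded dom]) (use agree(2) u Hs(4) G.arrows(4) in simp_all)
  have "cmp H = cmp G" using agree(4) mult_first_second(4)[OF G.arrows(3,4,6)] s t by simp
  then show ?thesis using s t u A D agree(3) by (intro internal_groupoid.equality) simp_all
qed

text \<open>
  The identity arrows of both groupoids represent the same subobject, hence factor through each other;
  the comparison of objects is this factorization.
\<close>

lemma groupoids_iso_on_objects:
  fixes G H :: "('a, 'b) internal_groupoid"
  assumes G: "internal_groupoid C G" and H: "internal_groupoid C H" and A: "C1 H = C1 G"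
    and \<mu>: "composition_rel C H = composition_rel C G" and \<eta>: "state_rel C (idn H) = state_rel C (idn G)"
  shows "iso_on_objects C H G"
proof -
  interpret G: internal_groupoid_in C G using G by unfold_locales
  interpret H: internal_groupoid_in C H using H by unfold_locales
  note Hs = H.arrows[unfolded A]
  note agree = groupoids_agree[OF G H A \<mu> \<eta>]
  note us = H.unit_sat(4)[unfolded A \<eta>]
  have "\<exists>f \<in> hom C (C0 H) (C0 G). idn G \<cdot> f = idn H"
    unfolding G.unit_sat(4)[OF Hs(5), symmetric] unfolding us[OF Hs(5)]
    using Ident_in_hom[OF Hs(1)] Comp_Ident_right[OF Hs(5)] by blast
  then obtain f where f: "f \<in> hom C (C0 H) (C0 G)" "idn G \<cdot> f = idn H" by blast
  have "\<exists>g \<in> hom C (C0 G) (C0 H). idn H \<cdot> g = idn G"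
    unfolding us[OF G.arrows(5), symmetric] unfolding G.unit_sat(4)[OF G.arrows(5)]
    using Ident_in_hom[OF G.arrows(1)] Comp_Ident_right[OF G.arrows(5)] by blast
  then obtain g where g: "g \<in> hom C (C0 G) (C0 H)" "idn H \<cdot> g = idn G" by blast
  have Gc: "x = y" if "idn G \<cdot> x = idn G \<cdot> y" "x \<in> hom C X (C0 G)" "y \<in> hom C X (C0 G)" for x y X
    using monicD[OF G.monic_idn that(1)] that(2,3) homD(2)[OF G.arrows(5)] by simp
  have Hc: "x = y" if "idn H \<cdot> x = idn H \<cdot> y" "x \<in> hom C X (C0 H)" "y \<in> hom C X (C0 H)" for x y X
    using monicD[OF H.monic_idn that(1)] that(2,3) homD(2)[OF Hs(5)] by simp
  have idf: "idn G \<cdot> (f \<cdot> y) = idn H \<cdot> y" if "y \<in> hom C X (C0 H)" for y X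
    using Comp_assoc[OF that f(1) G.arrows(5)] f(2) by simp
  have idg: "idn H \<cdot> (g \<cdot> y) = idn G \<cdot> y" if "y \<in> hom C X (C0 G)" for y X
    using Comp_assoc[OF that g(1) Hs(5)] g(2) by simp
  note ID = Ident_in_hom[OF Hs(1)] Ident_in_hom[OF G.arrows(1)]
  have "g \<cdot> f = Ident C (C0 H)"
    by (rule Hc[OF _ Comp_in_hom[OF f(1) g(1)] ID(1)]) (use idg[OF f(1)] f(2) Comp_Ident_right[OF Hs(5)] in simp)
  moreover have "f \<cdot> g = Ident C (C0 G)"
    by (rule Gc[OF _ Comp_in_hom[OF g(1) f(1)] ID(2)]) (use idf[OF g(1)] g(2) Comp_Ident_right[OF G.arrows(5)] in simp)
  ultimately have "iso C f" unfolding iso_def using f(1) g(1) homD[OF f(1)] by auto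
  moreover have "src G = f \<cdot> src H"
    by (rule Gc[OF _ G.arrows(3) Comp_in_hom[OF Hs(3) f(1)]]) (use idf[OF Hs(3)] agree(1) in simp)
  moreover have "tgt G = f \<cdot> tgt H"
    by (rule Gc[OF _ G.arrows(4) Comp_in_hom[OF Hs(4) f(1)]]) (use idf[OF Hs(4)] agree(2) in simp)
  ultimately show ?thesis unfolding iso_on_objects_def using A agree(3,4) f by blast
qed

lemma frobenius_structureI:
  assumes "special_dagger_frobenius (Rel C) A \<mu> \<eta>"
  shows "frobenius_structure C A \<mu> \<eta>"
  by unfold_locales (use assms in \<open>auto simp: special_dagger_frobenius_def Rel_def hom_def\<close>)

lemma ex1_groupoid_from_frobenius:
  assumes F: "special_dagger_frobenius (Rel C) A \<mu> \<eta>" and u: "represents_unit C u A \<eta>"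
  shows "\<exists>!G. groupoid_from_frobenius C (A, \<mu>, \<eta>) u G"
proof -
  interpret frobenius_structure C A \<mu> \<eta> by (rule frobenius_structureI[OF F])
  show ?thesis
  proof (rule ex_ex1I[OF groupoid_exists[OF u]])
    fix H G assume "groupoid_from_frobenius C (A, \<mu>, \<eta>) u H" "groupoid_from_frobenius C (A, \<mu>, \<eta>) u G"
    then show "H = G" unfolding groupoid_from_frobenius_def by (intro groupoids_eq) auto
  qed
qed

lemma groupoid_of_frobenius:
  assumes F: "special_dagger_frobenius (Rel C) A \<mu> \<eta>" and u: "represents_unit C u A \<eta>"
  shows "groupoid_from_frobenius C (A, \<mu>, \<eta>) u (groupoid_of_frobenius C (A, \<mu>, \<eta>) u)"
  unfolding groupoid_of_frobenius_def by (rule theI'[OF ex1_groupoid_from_frobenius[OF F u]])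

end

theorem theorem3p4:
  fixes C :: "('o, 'm) category"
  assumes "regular_category C"
  shows
    "(\<forall>A \<mu> \<eta>. special_dagger_frobenius (Rel C) A \<mu> \<eta> \<longrightarrow>
        (\<exists>u. represents_unit C u A \<eta>) \<and>
        (\<forall>u. represents_unit C u A \<eta> \<longrightarrow> (\<exists>!G. groupoid_from_frobenius C (A, \<mu>, \<eta>) u G))) \<and>
     (\<forall>G. internal_groupoid C G \<longrightarrow>
        monic C (idn G) \<and>
        special_dagger_frobenius (Rel C) (C1 G) (composition_rel C G) (state_rel C (idn G))) \<and>
     (\<forall>A \<mu> \<eta> u. special_dagger_frobenius (Rel C) A \<mu> \<eta> \<and> represents_unit C u A \<eta> \<longrightarrow>
        frobenius_of_groupoid C (groupoid_of_frobenius C (A, \<mu>, \<eta>) u) = (A, \<mu>, \<eta>)) \<and>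
     (\<forall>G. internal_groupoid C G \<longrightarrow>
        groupoid_of_frobenius C (frobenius_of_groupoid C G) (idn G) = G \<and>
        (\<forall>u. represents_unit C u (C1 G) (state_rel C (idn G)) \<longrightarrow>
           iso_on_objects C (groupoid_of_frobenius C (frobenius_of_groupoid C G) u) G))"
proof -
  interpret regular_category C by fact
  show ?thesis
  proof (intro conjI allI impI)
    fix A \<mu> \<eta> assume F: "special_dagger_frobenius (Rel C) A \<mu> \<eta>"
    interpret F: frobenius_structure C A \<mu> \<eta> by (rule frobenius_structureI[OF F])
    show "\<exists>u. represents_unit C u A \<eta>" by (rule represents_unit_exists[OF F.\<eta>])
    show "\<exists>!G. groupoid_from_frobenius C (A, \<mu>, \<eta>) u G" if "represents_unit C u A \<eta>" for u
      by (rule ex1_groupoid_from_frobenius[OF F that])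
  next
    fix G :: "('o, 'm) internal_groupoid" assume "internal_groupoid C G"
    then interpret G: internal_groupoid_in C G by unfold_locales
    show "monic C (idn G)" by (rule G.monic_idn)
    show "special_dagger_frobenius (Rel C) (C1 G) (composition_rel C G) (state_rel C (idn G))"
      by (rule G.frobenius)
  next
    fix A \<mu> \<eta> u
    assume "special_dagger_frobenius (Rel C) A \<mu> \<eta> \<and> represents_unit C u A \<eta>"
    then show "frobenius_of_groupoid C (groupoid_of_frobenius C (A, \<mu>, \<eta>) u) = (A, \<mu>, \<eta>)"
      using groupoid_of_frobenius[of A \<mu> \<eta> u]
      unfolding groupoid_from_frobenius_def frobenius_of_groupoid_def represents_unit_def by auto
  next
    fix G :: "('o, 'm) internal_groupoid" assume G: "internal_groupoid C G"
    then interpret G: internal_groupoid_in C G by unfold_locales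
    note F = G.frobenius
    have "represents_unit C (idn G) (C1 G) (state_rel C (idn G))"
      unfolding represents_unit_def using G.monic_idn homD[OF G.arrows(5)] by simp
    then have "groupoid_from_frobenius C (frobenius_of_groupoid C G) (idn G)
        (groupoid_of_frobenius C (frobenius_of_groupoid C G) (idn G))"
      unfolding frobenius_of_groupoid_def by (rule groupoid_of_frobenius[OF F])
    then show "groupoid_of_frobenius C (frobenius_of_groupoid C G) (idn G) = G"
      unfolding groupoid_from_frobenius_def frobenius_of_groupoid_def
      using homD(2)[OF G.arrows(5)] by (intro groupoids_eq[OF G]) auto
    show "iso_on_objects C (groupoid_of_frobenius C (frobenius_of_groupoid C G) u) G"
      if u: "represents_unit C u (C1 G) (state_rel C (idn G))" for u
    proof -
      have "groupoid_from_frobenius C (frobenius_of_groupoid C G) u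
          (groupoid_of_frobenius C (frobenius_of_groupoid C G) u)"
        unfolding frobenius_of_groupoid_def by (rule groupoid_of_frobenius[OF F u])
      then show ?thesis using u
        unfolding groupoid_from_frobenius_def frobenius_of_groupoid_def represents_unit_def
        by (intro groupoids_iso_on_objects[OF G]) auto
    qed
  qed
qed

end
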